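(* Assume that $1<p<\infty$ and that $X$ is a proper connected metric space equipped with a locally doubling measure $\mu$ supporting a local $p$-Poincaré inequality. Let $\Omega_1\subset\Omega_2\subset\dots\subset\Omega=\bigcup_{j=1}^\infty\Omega_j$ be an increasing sequence of open sets, and let $E\subset\Omega_1$ be such that $\mathrm{cap}_p(E,\Omega_1)<\infty$. Then $$\mathrm{cap}_p(E,\Omega)=\lim_{j\to\infty}\mathrm{cap}_p(E,\Omega_j).$$
   Context: $X=(X,d,\mu)$ is a metric space equipped with a positive complete Borel measure $\mu$ with $0<\mu(B)<\infty$ for every ball $B$. Balls are open and come with a fixed centre and radius; $\lambda B(x,r):=B(x,\lambda r)$. $\overline{\mathbf{R}}=[-\infty,\infty]$ and $\chi_A$ is the characteristic function of $A$. The sets $\Omega_j$, $\Omega$ and $E$ may be unbounded. Upper gradients. A curve is a nonconstant compact rectifiable curve, parameterized by arc length $ds$. A property holds for $p$-almost every curve if there is a nonnegative $\rho\in L^p(X)$ with $\int_\gamma\rho\,ds=\infty$ for every curve $\gamma$ for which it fails. A measurable $g:X\to[0,\infty]$ is a $p$-weak upper gradient of $f:X\to\overline{\mathbf{R}}$ if for $p$-almost all curves $\gamma:[0,l_\gamma]\to X$, $|f(\gamma(0))-f(\gamma(l_\gamma))|\le\int_\gamma g\,ds$, where the left-hand side is $\infty$ if at least one of the terms is infinite. If $f$ has a $p$-weak upper gradient in $L^p_{\rm loc}(X)$, then $g_f$ denotes its minimal $p$-weak upper gradient ($g_f\le g$ a.e. for every $p$-weak upper gradient $g\in L^p_{\rm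 loc}(X)$ of $f$). $N^{1,p}(X)$ is the space of measurable $f$, defined everywhere with values in $\overline{\mathbf{R}}$, with $\|f\|_{N^{1,p}(X)}^p=\int_X|f|^p\,d\mu+\inf_g\int_X g^p\,d\mu<\infty$, infimum over all $p$-weak upper gradients $g$ of $f$. For measurable $E\subset X$ these notions are defined by regarding $(E,d|_E,\mu|_E)$ as a metric space. Doubling and Poincaré. $\mu$ is doubling within an open set $U$ if there is $C>0$ with $\mu(2B)\le C\mu(B)$ for all balls $B\subset U$. The $p$-Poincaré inequality holds within $U$ if there are $C>0$, $\lambda\ge1$ such that for all balls $B\subset U$ with radius $r_B$, all integrable $u$ on $\lambda B$ and all $p$-weak upper gradients $g$ of $u$ in $\lambda B$, $\frac1{\mu(B)}\int_B|u-u_B|\,d\mu\le Cr_B\bigl(\frac1{\mu(\lambda B)}\int_{\lambda B}g^p\,d\mu\bigr)^{1/p}$, where $u_B=\frac1{\mu(B)}\int_B u\,d\mu$. Each property is local if for every $x\in X$ there is $r>0$ such that it holds within $B(x,r)$. $X$ is proper if all closed bounded sets are compact. Condenser capacity. For open $\Omega$ and bounded $E\subset\Omega$, $\mathrm{cap}_p(E,\Omega)=\inf_u\int_\Omega g_u^p\,d\mu$ over $u\in N^{1,p}(X)$ with $\chi_E\le u\le\chi_\Omega$ ($=\infty$ if there is no such $u$); for unbounded $E\subset\Omega$, $\mathrm{cap}_p(E,\Omega)=\lim_{j\to\infty}\mathrm{cap}_p(E\cap B(x_0,j),\Omega)$, where $x_0\in X$ is any fixed point (the limit does not depend on it). Also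 $\mathrm{cap}_p(\emptyset,\emptyset)=0$. *)

theory Defs
  imports "HOL-Analysis.Analysis"
begin

(* A metric measure space is given by a measure M whose underlying set is space M, with the metric
   of the ambient type.  Passing to a measurable subset A with the restricted metric and
   measure amounts to replacing M by restrict_space M A. *)

(* "Complete Borel measure" is read in the usual sense of analysis on metric spaces:
   the completion of a measure on the Borel sigma-algebra, so that every measurable function
   agrees a.e. with a Borel function.  The measure lives on the whole type. *)
definition metric_measure_space :: "'a::metric_space measure \<Rightarrow> bool" where
  "metric_measure_space M \<longleftrightarrow>
     (\<exists>N. sets N = sets borel \<and> M = completion N) \<and>
     (\<forall>x r. 0 < r \<longrightarrow> 0 < emeasure M (ball x r) \<and> emeasure M (ball x r) < \<infinity>)"

definition ennpowr :: "ennreal \<Rightarrow> real \<Rightarrow> ennreal" where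
  "ennpowr a p = (if a = \<infinity> then \<infinity> else ennreal (enn2real a powr p))"  (* for p > 0 *)

definition curve_length :: "(real \<Rightarrow> 'a::metric_space) \<Rightarrow> real \<Rightarrow> real \<Rightarrow> ennreal" where
  "curve_length \<gamma> a b =
     (SUP ts \<in> {ts. sorted ts \<and> set ts \<subseteq> {a..b}}.
        \<Sum>i<length ts - 1. ennreal (dist (\<gamma> (ts ! i)) (\<gamma> (ts ! Suc i))))"

(* Nonconstant compact rectifiable curves parameterized by arc length on [0,l].
   Such a map is automatically 1-Lipschitz; its values outside [0,l] are irrelevant. *)
definition arclength_curve :: "'a::metric_space set \<Rightarrow> (real \<Rightarrow> 'a) \<Rightarrow> real \<Rightarrow> bool" where
  "arclength_curve A \<gamma> l \<longleftrightarrow>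
     0 < l \<and> \<gamma> ` {0..l} \<subseteq> A \<and>
     (\<forall>s t. 0 \<le> s \<and> s \<le> t \<and> t \<le> l \<longrightarrow> curve_length \<gamma> s t = ennreal (t - s))"

(* For a merely measurable \<rho> the composition with \<gamma> need not be measurable, and nn_integral is then
   the lower integral.  This does not matter for p-almost every curve, since \<rho> agrees a.e. with a
   Borel function. *)
definition curve_integral :: "('a \<Rightarrow> ennreal) \<Rightarrow> (real \<Rightarrow> 'a) \<Rightarrow> real \<Rightarrow> ennreal" where
  "curve_integral \<rho> \<gamma> l = (\<integral>\<^sup>+t\<in>{0..l}. \<rho> (\<gamma> t) \<partial>lebesgue)"

definition ae_curve ::
  "real \<Rightarrow> 'a::metric_space measure \<Rightarrow> ((real \<Rightarrow> 'a) \<Rightarrow> real \<Rightarrow> bool) \<Rightarrow> bool" where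
  "ae_curve p M P \<longleftrightarrow>
     (\<exists>\<rho> \<in> borel_measurable M.
        (\<integral>\<^sup>+x. ennpowr (\<rho> x) p \<partial>M) < \<infinity> \<and>
        (\<forall>\<gamma> l. arclength_curve (space M) \<gamma> l \<and> \<not> P \<gamma> l \<longrightarrow> curve_integral \<rho> \<gamma> l = \<infinity>))"

definition ext_diff :: "ereal \<Rightarrow> ereal \<Rightarrow> ennreal" where
  "ext_diff a b = (if \<bar>a\<bar> = \<infinity> \<or> \<bar>b\<bar> = \<infinity> then \<infinity> else e2ennreal \<bar>a - b\<bar>)"

definition weak_upper_gradient ::
  "real \<Rightarrow> 'a::metric_space measure \<Rightarrow> ('a \<Rightarrow> ereal) \<Rightarrow> ('a \<Rightarrow> ennreal) \<Rightarrow> bool" where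
  "weak_upper_gradient p M f g \<longleftrightarrow>
     g \<in> borel_measurable M \<and>
     ae_curve p M (\<lambda>\<gamma> l. ext_diff (f (\<gamma> 0)) (f (\<gamma> l)) \<le> curve_integral g \<gamma> l)"

definition Lp_loc :: "real \<Rightarrow> 'a::metric_space measure \<Rightarrow> ('a \<Rightarrow> ennreal) set" where
  "Lp_loc p M = {g \<in> borel_measurable M.
     \<forall>x\<in>space M. \<exists>r>0. (\<integral>\<^sup>+y\<in>ball x r. ennpowr (g y) p \<partial>M) < \<infinity>}"

definition is_minimal_weak_upper_gradient ::
  "real \<Rightarrow> 'a::metric_space measure \<Rightarrow> ('a \<Rightarrow> ereal) \<Rightarrow> ('a \<Rightarrow> ennreal) \<Rightarrow> bool" where
  "is_minimal_weak_upper_gradient p M f g \<longleftrightarrow>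
     weak_upper_gradient p M f g \<and> g \<in> Lp_loc p M \<and>
     (\<forall>h. weak_upper_gradient p M f h \<and> h \<in> Lp_loc p M \<longrightarrow> (AE x in M. g x \<le> h x))"

(* Only determined up to a.e. equality, hence the choice operator. *)
definition minimal_weak_upper_gradient ::
  "real \<Rightarrow> 'a::metric_space measure \<Rightarrow> ('a \<Rightarrow> ereal) \<Rightarrow> ('a \<Rightarrow> ennreal)" where
  "minimal_weak_upper_gradient p M f = (SOME g. is_minimal_weak_upper_gradient p M f g)"

(* The p-th power of the Newtonian norm. *)
definition newtonian_energy :: "real \<Rightarrow> 'a::metric_space measure \<Rightarrow> ('a \<Rightarrow> ereal) \<Rightarrow> ennreal" where
  "newtonian_energy p M f =
     (\<integral>\<^sup>+x. ennpowr (e2ennreal \<bar>f x\<bar>) p \<partial>M) +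
     (INF g \<in> {g. weak_upper_gradient p M f g}. \<integral>\<^sup>+x. ennpowr (g x) p \<partial>M)"

definition newtonian_space :: "real \<Rightarrow> 'a::metric_space measure \<Rightarrow> ('a \<Rightarrow> ereal) set" where
  "newtonian_space p M = {f \<in> borel_measurable M. newtonian_energy p M f < \<infinity>}"

definition doubling_within :: "'a::metric_space measure \<Rightarrow> 'a set \<Rightarrow> bool" where
  "doubling_within M U \<longleftrightarrow>
     (\<exists>C>0. \<forall>x r. 0 < r \<and> ball x r \<subseteq> U \<longrightarrow>
        emeasure M (ball x (2 * r)) \<le> ennreal C * emeasure M (ball x r))"

(* For integrable u the set where u is infinite is null, so real_of_ereal does not
   change the mean value. *)
definition mean_value :: "'a measure \<Rightarrow> 'a set \<Rightarrow> ('a \<Rightarrow> ereal) \<Rightarrow> real" where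
  "mean_value M B u = (\<integral>x\<in>B. real_of_ereal (u x) \<partial>M) / measure M B"

definition poincare_within :: "real \<Rightarrow> 'a::metric_space measure \<Rightarrow> 'a set \<Rightarrow> bool" where
  "poincare_within p M U \<longleftrightarrow>
     (\<exists>C>0. \<exists>\<Lambda>\<ge>1. \<forall>x r. 0 < r \<and> ball x r \<subseteq> U \<longrightarrow>
       (\<forall>u g. u \<in> borel_measurable (restrict_space M (ball x (\<Lambda> * r))) \<and>
          (\<integral>\<^sup>+y\<in>ball x (\<Lambda> * r). e2ennreal \<bar>u y\<bar> \<partial>M) < \<infinity> \<and>
          weak_upper_gradient p (restrict_space M (ball x (\<Lambda> * r))) u g \<longrightarrow>
          (\<integral>\<^sup>+y\<in>ball x r. e2ennreal \<bar>u y - ereal (mean_value M (ball x r) u)\<bar> \<partial>M)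
              / emeasure M (ball x r)
            \<le> ennreal (C * r) *
              ennpowr ((\<integral>\<^sup>+y\<in>ball x (\<Lambda> * r). ennpowr (g y) p \<partial>M) / emeasure M (ball x (\<Lambda> * r)))
                (1 / p)))"

definition locally_doubling :: "'a::metric_space measure \<Rightarrow> bool" where
  "locally_doubling M \<longleftrightarrow> (\<forall>x. \<exists>r>0. doubling_within M (ball x r))"

definition local_poincare :: "real \<Rightarrow> 'a::metric_space measure \<Rightarrow> bool" where
  "local_poincare p M \<longleftrightarrow> (\<forall>x. \<exists>r>0. poincare_within p M (ball x r))"

(* For bounded E; the infimum over the empty set is \<infinity> in ennreal. *)
definition cap_bounded ::
  "real \<Rightarrow> 'a::metric_space measure \<Rightarrow> 'a set \<Rightarrow> 'a set \<Rightarrow> ennreal" where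
  "cap_bounded p M E \<Omega> =
     (INF u \<in> {u \<in> newtonian_space p M. \<forall>x. indicator E x \<le> u x \<and> u x \<le> indicator \<Omega> x}.
        \<integral>\<^sup>+x\<in>\<Omega>. ennpowr (minimal_weak_upper_gradient p M u x) p \<partial>M)"

(* For unbounded E this is the limit along balls, which is the same for every centre x0. *)
definition cap ::
  "real \<Rightarrow> 'a::metric_space measure \<Rightarrow> 'a set \<Rightarrow> 'a set \<Rightarrow> ennreal" where
  "cap p M E \<Omega> =
     (if bounded E then cap_bounded p M E \<Omega>
      else (THE L. \<forall>x0. (\<lambda>j::nat. cap_bounded p M (E \<inter> ball x0 (real j)) \<Omega>) \<longlonglongrightarrow> L))"

end

(* Let u be admissible for (E, Omega) with E bounded.  After cutting u off outside a ball and enlarging its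
   upper gradient slightly, there is a lower semicontinuous genuine upper gradient G of u, bounded
   from below on that ball.  Let u_j(x) be the infimum of the integral of G over curves from x
   to the complement of Omega_j (intersected with the ball), truncated at 1.  Then u_j has upper
   gradient G, vanishes outside Omega_j, and by a compactness argument for Lipschitz curves u_j increases
   to a function u_oo >= u.  If w is admissible for (E, Omega_1), then
   v_j = max(u_j, min(u_oo, w)) is admissible for (E, Omega_j), and its energy is at most the energy
   of G plus the energy of w over {u_j < w < u_oo}; these sets decrease to the empty set.

   For unbounded E put E_k = E \<inter> B(x0,k).  Maxima and minima of admissible functions give the strong
   subadditivity cap(E_k,Omega_j) + cap(E_K,Omega_1) <= cap(E_K,Omega_j) + cap(E_k,Omega_1) for k >= K,
   so finiteness of cap(E,Omega_1) makes the passage from E_K to E_k uniform in j. *)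

theory Submission
  imports Defs "HOL-Library.Diagonal_Subsequence"
begin

section \<open>Interval bounds for functions of one variable\<close>

text \<open>The obstacle is that neither \<open>E\<close> nor the set where \<open>u\<close> is
  positive is compactly contained in \<Omega>, and \<open>u\<close> is not continuous, so lowering
  \<open>u\<close> slightly does not fit it into a single \<Omega>_j. The potentials u_j do fit, but
  they reach 1 on \<open>E\<close> only in the limit and without uniformity. The function w repairs
  the value on \<open>E\<close>, and dominated convergence makes its cost disappear.

  This only works with sharp gradients of maxima and minima: the gradient of whichever function is
  active at a point. With the larger of the two gradients, the energy of w would be paid in full.
  Sharpness is a question about functions of one variable along curves, and is settled there by
  exchanging integrable bounds on Borel sets.

  The two properties of G serve the compactness argument. The lower bound \<epsilon> limits a curve
  of integral below c to length c/\<epsilon>, so that relevant curves stay in a compact ball;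
  semicontinuity lets Fatou's lemma pass to limit curves. The same argument with a fixed target
  shows that sublevel sets of potentials are closed, hence that potentials are measurable.\<close>

abbreviation seg_integral :: "(real \<Rightarrow> ennreal) \<Rightarrow> real \<Rightarrow> real \<Rightarrow> ennreal" where
  "seg_integral k a b \<equiv> (\<integral>\<^sup>+x\<in>{a..b}. k x \<partial>lborel)"

text \<open>This is the integrated form of a bound \<open>k\<close> on the absolute value of the
  derivative. Asking it of all subintervals, and not only of \<open>[0,l]\<close>, allows bounds to
  be replaced piecewise.\<close>

definition var_bound :: "(real \<Rightarrow> real) \<Rightarrow> (real \<Rightarrow> ennreal) \<Rightarrow> real \<Rightarrow> bool" where
  "var_bound \<phi> k l \<longleftrightarrow> (\<forall>s t. 0 \<le> s \<longrightarrow> s \<le> t \<longrightarrow> t \<le> l \<longrightarrow>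
     ennreal \<bar>\<phi> t - \<phi> s\<bar> \<le> seg_integral k s t)"

lemma var_boundD:
  "\<lbrakk>var_bound \<phi> k l; 0 \<le> s; s \<le> t; t \<le> l\<rbrakk> \<Longrightarrow> ennreal \<bar>\<phi> t - \<phi> s\<bar> \<le> seg_integral k s t"
  unfolding var_bound_def by blast

lemma var_bound_cong:
  assumes "\<And>x. x \<in> {0..l} \<Longrightarrow> \<phi> x = \<phi>' x" "\<And>x. x \<in> {0..l} \<Longrightarrow> k x = k' x"
  shows "var_bound \<phi> k l \<longleftrightarrow> var_bound \<phi>' k' l"
proof -
  have "seg_integral k s t = seg_integral k' s t" if "0 \<le> s" "t \<le> l" for s t
    by (intro nn_integral_cong) (use assms(2) that in "auto split: split_indicator")
  then show ?thesis
    unfolding var_bound_def using assms(1) by auto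
qed

lemma var_bound_mono:
  assumes "var_bound \<phi> k l" "\<And>x. x \<in> {0..l} \<Longrightarrow> k x \<le> k' x"
  shows "var_bound \<phi> k' l"
  unfolding var_bound_def
proof (intro allI impI)
  fix s t :: real assume *: "0 \<le> s" "s \<le> t" "t \<le> l"
  have "seg_integral k s t \<le> seg_integral k' s t"
    by (intro nn_integral_mono) (use assms(2) * in "auto split: split_indicator")
  with var_boundD[OF assms(1) *] show "ennreal \<bar>\<phi> t - \<phi> s\<bar> \<le> seg_integral k' s t"
    by (rule order_trans)
qed

lemma nn_integral_Icc_split:
  fixes k :: "real \<Rightarrow> ennreal"
  assumes [measurable]: "k \<in> borel_measurable borel" and "s \<le> a" "a \<le> t"
  shows "seg_integral k s t = seg_integral k s a + seg_integral k a t"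
proof -
  have ne: "AE x in lborel. x \<noteq> a" by (rule AE_lborel_singleton)
  have "seg_integral k s t = (\<integral>\<^sup>+x. k x * indicator {s..a} x + k x * indicator {a..t} x \<partial>lborel)"
    by (intro nn_integral_cong_AE, use ne in eventually_elim)
       (use assms in "auto split: split_indicator")
  also have "\<dots> = seg_integral k s a + seg_integral k a t"
    by (intro nn_integral_add) auto
  finally show ?thesis .
qed

lemma ennreal_abs_triangle: "ennreal \<bar>x - z\<bar> \<le> ennreal \<bar>x - y\<bar> + ennreal \<bar>y - z\<bar>"
  by (simp flip: ennreal_plus)

text \<open>Splitting an increment at \<open>a\<close> charges each half to its own bound, and the
  point \<open>a\<close> is null. Half-lines generate the Borel sets, so this is the base case of
  the induction in \<open>var_bound_if\<close>.\<close>

lemma var_bound_if_atMost: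
  assumes [measurable]: "k1 \<in> borel_measurable borel" "k2 \<in> borel_measurable borel"
    and "var_bound \<phi> k1 l" "var_bound \<phi> k2 l"
  shows "var_bound \<phi> (\<lambda>x. if x \<in> {..a} then k1 x else k2 x) l"
  unfolding var_bound_def
proof (intro allI impI)
  fix s t :: real assume *: "0 \<le> s" "s \<le> t" "t \<le> l"
  let ?k = "\<lambda>x. if x \<in> {..a} then k1 x else k2 x"
  have ne: "AE x in lborel. x \<noteq> a" by (rule AE_lborel_singleton)
  have e1: "seg_integral ?k u v = seg_integral k1 u v" if "v \<le> a" for u v
    by (intro nn_integral_cong) (use that in "auto split: split_indicator")
  have e2: "seg_integral ?k u v = seg_integral k2 u v" if "a \<le> u" for u v
    by (intro nn_integral_cong_AE, use ne in eventually_elim)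
       (use that in "auto split: split_indicator")
  show "ennreal \<bar>\<phi> t - \<phi> s\<bar> \<le> seg_integral ?k s t"
  proof -
    consider "t \<le> a" | "a \<le> s" | "s \<le> a" "a \<le> t" by linarith
    then show ?thesis
    proof cases
      case 1 then show ?thesis using var_boundD[OF assms(3) *] e1 by simp
    next
      case 2 then show ?thesis using var_boundD[OF assms(4) *] e2 by simp
    next
      case 3
      have "ennreal \<bar>\<phi> t - \<phi> s\<bar> \<le> ennreal \<bar>\<phi> t - \<phi> a\<bar> + ennreal \<bar>\<phi> a - \<phi> s\<bar>"
        by (rule ennreal_abs_triangle)
      also have "\<dots> \<le> seg_integral k2 a t + seg_integral k1 s a"
        by (intro add_mono var_boundD[OF assms(4)] var_boundD[OF assms(3)]) (use 3 * in auto)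
      also have "\<dots> = seg_integral ?k s a + seg_integral ?k a t"
        using e1[of a s] e2[of a t] by (simp add: add.commute)
      also have "\<dots> = seg_integral ?k s t"
        by (rule nn_integral_Icc_split[symmetric]) (use 3 in auto)
      finally show ?thesis .
    qed
  qed
qed

text \<open>The sets on which one bound may be exchanged for another form a \<open>\<sigma>\<close>-algebra containing the
  half-lines; this replaces any use of differentiation theorems for absolutely continuous functions.\<close>

lemma var_bound_if:
  assumes K[measurable]: "K \<in> borel_measurable borel" and Kfin: "seg_integral K 0 l < \<infinity>"
    and A: "A \<in> sets borel"
    and "k1 \<in> borel_measurable borel" "k2 \<in> borel_measurable borel"
    and "\<And>x. k1 x \<le> K x" "\<And>x. k2 x \<le> K x"
    and "var_bound \<phi> k1 l" "var_bound \<phi> k2 l"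
  shows "var_bound \<phi> (\<lambda>x. if x \<in> A then k1 x else k2 x) l"
proof -
  have "A \<in> sigma_sets UNIV (range (\<lambda>a::real. {..a}))"
    using A by (metis borel_eq_atMost sets_measure_of top_greatest Pow_UNIV)
  then show ?thesis using assms(4-)
  proof (induction A arbitrary: k1 k2 rule: sigma_sets.induct)
    case (Basic a) then show ?case using var_bound_if_atMost by auto
  next
    case Empty then show ?case by simp
  next
    case (Compl a)
    \<comment> \<open>A complement swaps the two bounds, which is why the induction keeps
      \<open>k1\<close> and \<open>k2\<close> arbitrary.\<close>
    have "var_bound \<phi> (\<lambda>x. if x \<in> a then k2 x else k1 x) l" by (rule Compl.IH) (use Compl in auto)
    then show ?case by (rule var_bound_mono) auto
  next
    case (Union a)
    have ab[measurable]: "a i \<in> sets borel" for i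
      using Union(1)[of i] by (metis borel_eq_atMost sets_measure_of top_greatest Pow_UNIV)
    note [measurable] = Union.prems(1,2)
    \<comment> \<open>The union need not be disjoint: \<open>k n\<close> has switched to
      \<open>k1\<close> on the first \<open>n\<close> sets, and the induction hypothesis for
      \<open>a n\<close> is applied to the pair \<open>k1\<close>, \<open>k n\<close>.\<close>
    define k where "k n x = (if x \<in> (\<Union>i<n. a i) then k1 x else k2 x)" for n :: nat and x
    have km[measurable]: "k n \<in> borel_measurable borel" for n unfolding k_def by measurable
    have kK: "k n x \<le> K x" for n x using Union.prems(3,4) by (simp add: k_def)
    have vb: "var_bound \<phi> (k n) l" for n
    proof (induction n)
      case 0 then show ?case using Union.prems(6) by (simp add: k_def[abs_def])
    next
      case (Suc n)
      have "var_bound \<phi> (\<lambda>x. if x \<in> a n then k1 x else k n x) l"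
        by (rule Union.IH) (use Union.prems kK Suc in auto)
      then show ?case by (rule var_bound_mono) (auto simp: k_def lessThan_Suc)
    qed
    let ?k = "\<lambda>x. if x \<in> \<Union> (range a) then k1 x else k2 x"
    have lim: "(\<lambda>n. k n x) \<longlonglongrightarrow> ?k x" for x
    proof (cases "x \<in> \<Union> (range a)")
      case True
      then obtain i where i: "x \<in> a i" by auto
      have "eventually (\<lambda>n. k n x = ?k x) sequentially"
        using eventually_gt_at_top[of i] by eventually_elim (use i in "auto simp: k_def")
      then show ?thesis by (rule tendsto_eventually)
    next
      case False then show ?thesis by (auto simp: k_def intro!: tendsto_eventually)
    qed
    show ?case unfolding var_bound_def
    proof (intro allI impI)
      fix s t :: real assume *: "0 \<le> s" "s \<le> t" "t \<le> l"
      \<comment> \<open>The common integrable majorant \<open>K\<close> is carried through the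
        induction for the sake of this dominated convergence.\<close>
      have "(\<lambda>n. \<integral>\<^sup>+x. k n x * indicator {s..t} x \<partial>lborel) \<longlonglongrightarrow> (\<integral>\<^sup>+x. ?k x * indicator {s..t} x \<partial>lborel)"
      proof (rule nn_integral_dominated_convergence[where w="\<lambda>x. K x * indicator {0..l} x"])
        show "AE x in lborel. k n x * indicator {s..t} x \<le> K x * indicator {0..l} x" for n
          by (intro AE_I2) (use kK * in "auto split: split_indicator")
        show "AE x in lborel. (\<lambda>n. k n x * indicator {s..t} x) \<longlonglongrightarrow> ?k x * indicator {s..t} x"
        proof (rule AE_I2)
          fix x show "(\<lambda>n. k n x * indicator {s..t} x) \<longlonglongrightarrow> ?k x * indicator {s..t} x"
            using lim[of x] by (cases "x \<in> {s..t}") simp_all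
        qed
      qed (use Kfin in auto)
      then show "ennreal \<bar>\<phi> t - \<phi> s\<bar> \<le> seg_integral ?k s t"
        by (rule Lim_bounded2) (use var_boundD[OF vb *] in auto)
    qed
  qed
qed

lemma var_bound_add:
  assumes [measurable]: "k1 \<in> borel_measurable borel" "k2 \<in> borel_measurable borel"
    and "var_bound \<phi> k1 l" "var_bound \<psi> k2 l"
    and "\<And>s t. \<bar>\<zeta> t - \<zeta> s\<bar> \<le> \<bar>\<phi> t - \<phi> s\<bar> + \<bar>\<psi> t - \<psi> s\<bar>"
  shows "var_bound \<zeta> (\<lambda>x. k1 x + k2 x) l"
  unfolding var_bound_def
proof (intro allI impI)
  fix s t :: real assume *: "0 \<le> s" "s \<le> t" "t \<le> l"
  have "ennreal \<bar>\<zeta> t - \<zeta> s\<bar> \<le> ennreal \<bar>\<phi> t - \<phi> s\<bar> + ennreal \<bar>\<psi> t - \<psi> s\<bar>"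
    using assms(5) by (simp flip: ennreal_plus)
  also have "\<dots> \<le> seg_integral k1 s t + seg_integral k2 s t"
    by (intro add_mono var_boundD[OF assms(3) *] var_boundD[OF assms(4) *])
  also have "\<dots> = (\<integral>\<^sup>+x. k1 x * indicator {s..t} x + k2 x * indicator {s..t} x \<partial>lborel)"
    by (rule nn_integral_add[symmetric]) auto
  also have "\<dots> = seg_integral (\<lambda>x. (k1 x + k2 x)) s t"
    by (simp add: distrib_right)
  finally show "ennreal \<bar>\<zeta> t - \<zeta> s\<bar> \<le> seg_integral (\<lambda>x. (k1 x + k2 x)) s t" .
qed

lemma var_bound_compress:
  assumes "var_bound \<phi> k l" "\<And>s t. \<bar>\<psi> t - \<psi> s\<bar> \<le> \<bar>\<phi> t - \<phi> s\<bar>"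
  shows "var_bound \<psi> k l"
  unfolding var_bound_def
proof (intro allI impI)
  fix s t :: real assume *: "0 \<le> s" "s \<le> t" "t \<le> l"
  have "ennreal \<bar>\<psi> t - \<psi> s\<bar> \<le> ennreal \<bar>\<phi> t - \<phi> s\<bar>" using assms(2) by (simp add: ennreal_leI)
  with var_boundD[OF assms(1) *] show "ennreal \<bar>\<psi> t - \<psi> s\<bar> \<le> seg_integral k s t"
    by (rule order_trans[rotated])
qed

text \<open>Between the first point \<open>a\<close> and the last point \<open>b\<close> of
  \<open>F\<close> in \<open>{s..t}\<close> nothing has to be paid, as \<open>\<phi>\<close> is 0 at
  both. The outer pieces meet \<open>F\<close> only in these endpoints, which are null.\<close>

lemma var_bound_vanish:
  assumes [measurable]: "k \<in> borel_measurable borel"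
    and vb: "var_bound \<phi> k l" and F: "closed F" and z: "\<And>x. \<lbrakk>x \<in> F; x \<in> {0..l}\<rbrakk> \<Longrightarrow> \<phi> x = 0"
  shows "var_bound \<phi> (\<lambda>x. if x \<in> F then 0 else k x) l"
  unfolding var_bound_def
proof (intro allI impI)
  fix s t :: real assume *: "0 \<le> s" "s \<le> t" "t \<le> l"
  have [measurable]: "F \<in> sets borel" using F by auto
  let ?k = "\<lambda>x. if x \<in> F then 0 else k x"
  have km: "?k \<in> borel_measurable borel" by measurable
  show "ennreal \<bar>\<phi> t - \<phi> s\<bar> \<le> seg_integral ?k s t"
  proof (cases "F \<inter> {s..t} = {}")
    case True
    then have "seg_integral ?k s t = seg_integral k s t"
      by (intro nn_integral_cong) (auto split: split_indicator)
    then show ?thesis using var_boundD[OF vb *] by simp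
  next
    case False
    have c: "compact (F \<inter> {s..t})" using F by (simp add: closed_Int_compact)
    obtain b where b: "b \<in> F \<inter> {s..t}" "\<And>x. x \<in> F \<inter> {s..t} \<Longrightarrow> x \<le> b"
      using compact_attains_sup[OF c False] by auto
    obtain a where a: "a \<in> F \<inter> {s..t}" "\<And>x. x \<in> F \<inter> {s..t} \<Longrightarrow> a \<le> x"
      using compact_attains_inf[OF c False] by auto
    have ab: "a \<le> b" using a b by auto
    have z': "\<phi> a = 0" "\<phi> b = 0" using z a b * by auto
    have nea: "AE x in lborel. x \<noteq> a" and neb: "AE x in lborel. x \<noteq> b" by (rule AE_lborel_singleton)+
    have e1: "seg_integral ?k s a = seg_integral k s a"
      by (intro nn_integral_cong_AE, use nea in eventually_elim)
         (use a ab b in "force split: split_indicator")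
    have e2: "seg_integral ?k b t = seg_integral k b t"
      by (intro nn_integral_cong_AE, use neb in eventually_elim)
         (use a ab b in "force split: split_indicator")
    have "ennreal \<bar>\<phi> t - \<phi> s\<bar> \<le> ennreal \<bar>\<phi> t - \<phi> b\<bar> + ennreal \<bar>\<phi> a - \<phi> s\<bar>"
      using z' by (simp flip: ennreal_plus)
    also have "\<dots> \<le> seg_integral k b t + seg_integral k s a"
      by (intro add_mono var_boundD[OF vb]) (use a b * in auto)
    also have "\<dots> = seg_integral ?k b t + seg_integral ?k s a"
      using e1 e2 by simp
    also have "\<dots> \<le> seg_integral ?k b t + ((seg_integral ?k s a) + seg_integral ?k a b)"
      by (intro add_mono) auto
    also have "\<dots> = seg_integral ?k s t"
    proof -
      have s1: "seg_integral ?k s t = seg_integral ?k s b + seg_integral ?k b t"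
        by (rule nn_integral_Icc_split[OF km]) (use b in auto)
      have s2: "seg_integral ?k s b = seg_integral ?k s a + seg_integral ?k a b"
        by (rule nn_integral_Icc_split[OF km]) (use a ab in auto)
      show ?thesis unfolding s1 s2 by (simp only: add_ac)
    qed
    finally show ?thesis .
  qed
qed

text \<open>Integrals of \<open>k\<close> over shrinking intervals tend to 0. Continuity makes the
  comparison sets in \<open>var_bound_max\<close> closed.\<close>

lemma var_bound_continuous:
  assumes [measurable]: "k \<in> borel_measurable borel" and fin: "seg_integral k 0 l < \<infinity>"
    and vb: "var_bound \<phi> k l"
  shows "continuous_on {0..l} \<phi>"
  unfolding continuous_on_sequentially
proof safe
  fix X :: "nat \<Rightarrow> real" and a assume a: "a \<in> {0..l}" and X: "\<forall>n. X n \<in> {0..l}" "X \<longlonglongrightarrow> a"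
  let ?I = "\<lambda>n. {min (X n) a..max (X n) a}"
  have ne: "AE x in lborel. x \<noteq> a" by (rule AE_lborel_singleton)
  have "(\<lambda>n. \<integral>\<^sup>+x. k x * indicator (?I n) x \<partial>lborel) \<longlonglongrightarrow> (\<integral>\<^sup>+x. 0 \<partial>(lborel::real measure))"
  proof (rule nn_integral_dominated_convergence[where w="\<lambda>x. k x * indicator {0..l} x"])
    show "AE x in lborel. k x * indicator (?I n) x \<le> k x * indicator {0..l} x" for n
      by (intro AE_I2) (use X(1)[rule_format, of n] a in "auto split: split_indicator")
    show "AE x in lborel. (\<lambda>n. k x * indicator (?I n) x) \<longlonglongrightarrow> 0"
    proof (use ne in eventually_elim)
      fix x assume "x \<noteq> a"
      then consider "x < a" | "a < x" by linarith
      then have "eventually (\<lambda>n. x \<notin> ?I n) sequentially"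
      proof cases
        case 1 show ?thesis using order_tendstoD(1)[OF X(2) 1] by eventually_elim (use 1 in auto)
      next
        case 2 show ?thesis using order_tendstoD(2)[OF X(2) 2] by eventually_elim (use 2 in auto)
      qed
      then have "eventually (\<lambda>n. k x * indicator (?I n) x = 0) sequentially"
        by eventually_elim auto
      then show "(\<lambda>n. k x * indicator (?I n) x) \<longlonglongrightarrow> 0" by (rule tendsto_eventually)
    qed
  qed (use fin in auto)
  then have lim: "(\<lambda>n. \<integral>\<^sup>+x\<in>?I n. k x \<partial>lborel) \<longlonglongrightarrow> 0" by simp
  have le: "ennreal \<bar>\<phi> (X n) - \<phi> a\<bar> \<le> (\<integral>\<^sup>+x\<in>?I n. k x \<partial>lborel)" for n
  proof (cases "X n \<le> a")
    case True
    then show ?thesis using var_boundD[OF vb, of "X n" a] X(1)[rule_format, of n] a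
      by (simp add: abs_minus_commute)
  next
    case False
    then show ?thesis using var_boundD[OF vb, of a "X n"] X(1)[rule_format, of n] a
      by simp
  qed
  have "(\<lambda>n. ennreal \<bar>\<phi> (X n) - \<phi> a\<bar>) \<longlonglongrightarrow> 0"
    by (rule tendsto_sandwich[OF _ _ tendsto_const lim]) (use le in auto)
  then have "(\<lambda>n. \<bar>\<phi> (X n) - \<phi> a\<bar>) \<longlonglongrightarrow> 0"
    by (simp add: tendsto_ennreal_iff[where x=0, simplified])
  then show "(\<phi> \<circ> X) \<longlonglongrightarrow> \<phi> a"
    by (simp add: LIM_zero_iff tendsto_rabs_zero_iff o_def)
qed

text \<open>The maximum minus \<open>a\<close> vanishes on the closed set where
  \<open>b \<le> a\<close>, so \<open>var_bound_vanish\<close> erases its bound there, and adding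
  \<open>a\<close> back leaves exactly \<open>g\<close> on that set. The same with \<open>b\<close>
  leaves \<open>h\<close> where \<open>a \<le> b\<close>. Finally \<open>var_bound_if\<close> glues
  the two and discards their wasteful parts.\<close>

lemma var_bound_max:
  assumes [measurable]: "g \<in> borel_measurable borel" "h \<in> borel_measurable borel"
    and gf: "seg_integral g 0 l < \<infinity>" and hf: "seg_integral h 0 l < \<infinity>"
    and va: "var_bound a g l" and vb: "var_bound b h l"
  shows "var_bound (\<lambda>x. max (a x) (b x)) (\<lambda>x. if b x \<le> a x then g x else h x) l"
proof -
  have ca: "continuous_on {0..l} a" and cb: "continuous_on {0..l} b"
    using var_bound_continuous assms by blast+
  define F where "F = {x\<in>{0..l}. b x \<le> a x}"
  define G where "G = {x\<in>{0..l}. a x \<le> b x}"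
  have cF: "closed F" and cG: "closed G"
    unfolding F_def G_def using continuous_on_closed_Collect_le ca cb closed_atLeastAtMost by blast+
  have [measurable]: "F \<in> sets borel" "G \<in> sets borel" using cF cG by auto
  let ?m = "\<lambda>x. max (a x) (b x)"
  have m: "var_bound ?m (\<lambda>x. g x + h x) l"
    by (rule var_bound_add[OF _ _ va vb]) (auto simp: max_def)
  define kF where "kF x = g x + (if x \<in> F then 0 else (g x + h x) + g x)" for x
  define kG where "kG x = h x + (if x \<in> G then 0 else (g x + h x) + h x)" for x
  have mm[measurable]: "kF \<in> borel_measurable borel" "kG \<in> borel_measurable borel"
    unfolding kF_def kG_def by measurable
  have mF: "var_bound ?m kF l"
  proof -
    have "var_bound (\<lambda>x. ?m x - a x) (\<lambda>x. (g x + h x) + g x) l"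
      by (rule var_bound_add[OF _ _ m va]) auto
    then have v: "var_bound (\<lambda>x. ?m x - a x) (\<lambda>x. if x \<in> F then 0 else (g x + h x) + g x) l"
      by (rule var_bound_vanish[rotated]) (use cF in "auto simp: F_def")
    show ?thesis unfolding kF_def
      by (rule var_bound_add[OF _ _ va v]) auto
  qed
  have mG: "var_bound ?m kG l"
  proof -
    have "var_bound (\<lambda>x. ?m x - b x) (\<lambda>x. (g x + h x) + h x) l"
      by (rule var_bound_add[OF _ _ m vb]) auto
    then have v: "var_bound (\<lambda>x. ?m x - b x) (\<lambda>x. if x \<in> G then 0 else (g x + h x) + h x) l"
      by (rule var_bound_vanish[rotated]) (use cG in "auto simp: G_def")
    show ?thesis unfolding kG_def
      by (rule var_bound_add[OF _ _ vb v]) auto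
  qed
  \<comment> \<open>Off \<open>F\<close> the bound \<open>kF\<close> is
    \<open>g + ((g + h) + g)\<close>, and \<open>kG\<close> off \<open>G\<close> is symmetric: at
    most three copies of each.\<close>
  let ?K = "\<lambda>x. 3 * (g x + h x)"
  have "seg_integral ?K 0 l = (\<integral>\<^sup>+x. 3 * (g x * indicator {0..l} x + h x * indicator {0..l} x) \<partial>lborel)"
    by (intro nn_integral_cong) (simp add: distrib_right mult.assoc)
  also have "\<dots> = 3 * ((seg_integral g 0 l) + seg_integral h 0 l)"
    by (simp add: nn_integral_add nn_integral_cmult)
  also have "\<dots> < \<infinity>" using gf hf by (simp add: ennreal_mult_less_top)
  finally have Kf: "seg_integral ?K 0 l < \<infinity>" .
  have three: "3 * y = y + (y + y)" for y :: ennreal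
    using distrib_right[of 1 2 y] by (simp add: mult_2)
  have le: "kF x \<le> ?K x" "kG x \<le> ?K x" for x
    unfolding kF_def kG_def three by (intro add_mono; auto simp: add_increasing add_increasing2)+
  have "var_bound ?m (\<lambda>x. if x \<in> F then kF x else kG x) l"
    by (rule var_bound_if[OF _ Kf _ mm le mF mG]) auto
  then show ?thesis
    by (rule var_bound_mono) (auto simp: F_def G_def kF_def kG_def)
qed

lemma var_bound_min:
  assumes "g \<in> borel_measurable borel" "h \<in> borel_measurable borel"
    and "seg_integral g 0 l < \<infinity>" and "seg_integral h 0 l < \<infinity>"
    and va: "var_bound a g l" and vb: "var_bound b h l"
  shows "var_bound (\<lambda>x. min (a x) (b x)) (\<lambda>x. if a x \<le> b x then g x else h x) l"
proof -
  have "var_bound (\<lambda>x. - a x) g l" "var_bound (\<lambda>x. - b x) h l"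
    by (rule var_bound_compress[OF va] var_bound_compress[OF vb]; simp)+
  from var_bound_max[OF assms(1-4) this]
  have "var_bound (\<lambda>x. max (- a x) (- b x)) (\<lambda>x. if a x \<le> b x then g x else h x) l" by simp
  then show ?thesis by (rule var_bound_compress) (auto simp: max_def min_def)
qed

section \<open>Weak upper gradients with Borel representatives\<close>

lemma ennpowr_ennreal: "0 \<le> r \<Longrightarrow> ennpowr (ennreal r) p = ennreal (r powr p)"
  by (simp add: ennpowr_def)

lemma ennpowr_top [simp]: "ennpowr top p = top"
  by (simp add: ennpowr_def)

lemma ennpowr_zero [simp]: "ennpowr 0 p = 0"
  by (simp add: ennpowr_def)

lemma ennpowr_one [simp]: "ennpowr 1 p = 1"
  by (simp add: ennpowr_def)

lemma ennpowr_mono: "0 < p \<Longrightarrow> a \<le> b \<Longrightarrow> ennpowr a p \<le> ennpowr b p"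
  by (cases a; cases b) (auto simp: ennpowr_ennreal powr_mono2 top_unique)

lemma ennpowr_less_top_iff [simp]: "ennpowr a p < top \<longleftrightarrow> a < top"
  by (cases a) (auto simp: ennpowr_ennreal)

lemma ennpowr_eq_zero_iff [simp]: "ennpowr a p = 0 \<longleftrightarrow> a = 0"
  by (cases a) (auto simp: ennpowr_ennreal)

lemma ennpowr_measurable [measurable]:
  assumes [measurable]: "f \<in> borel_measurable M"
  shows "(\<lambda>x. ennpowr (f x) p) \<in> borel_measurable M"
  unfolding ennpowr_def by measurable

lemma ennpowr_inverse: "0 < p \<Longrightarrow> ennpowr (ennpowr a p) (1 / p) = a"
  by (cases a) (auto simp: ennpowr_ennreal powr_powr)

lemma ennpowr_inverse': "0 < p \<Longrightarrow> ennpowr (ennpowr a (1 / p)) p = a"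
  using ennpowr_inverse[of "1/p" a] by simp

lemma ennpowr_mult: "ennpowr (a * b) p = ennpowr a p * ennpowr b p"
proof (cases "a = top \<or> b = top")
  case True
  then show ?thesis by (auto simp: ennreal_top_mult ennreal_mult_top)
next
  case False
  then obtain x y where "0 \<le> x" "0 \<le> y" "a = ennreal x" "b = ennreal y"
    by (cases a; cases b) auto
  then show ?thesis
    by (simp add: ennpowr_ennreal ennreal_mult[symmetric] powr_mult)
qed

lemma ennpowr_max: "0 < p \<Longrightarrow> ennpowr (max a b) p = max (ennpowr a p) (ennpowr b p)"
  using ennpowr_mono[of p a b] ennpowr_mono[of p b a] by (auto simp: max_def)

lemma ennpowr_max_le: "0 < p \<Longrightarrow> ennpowr (max a b) p \<le> ennpowr a p + ennpowr b p"
  by (simp add: ennpowr_max add_increasing add_increasing2)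

text \<open>The factor comes from \<open>a + b \<le> 2 * max a b\<close>. The lemma only supplies
  integrable majorants, so the size of the factor does not matter.\<close>

lemma ennpowr_add_le:
  assumes "0 < p"
  shows "ennpowr (a + b) p \<le> ennreal (2 powr p) * (ennpowr a p + ennpowr b p)"
proof -
  have "ennpowr (a + b) p \<le> ennpowr (ennreal 2 * max a b) p"
  proof (rule ennpowr_mono[OF assms])
    have "a + b \<le> max a b + max a b" by (intro add_mono) auto
    then show "a + b \<le> ennreal 2 * max a b" by (simp add: mult_2)
  qed
  also have "\<dots> = ennreal (2 powr p) * ennpowr (max a b) p"
    unfolding ennpowr_mult by (subst ennpowr_ennreal) auto
  also have "\<dots> \<le> ennreal (2 powr p) * (ennpowr a p + ennpowr b p)"
    by (intro mult_left_mono ennpowr_max_le assms) auto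
  finally show ?thesis .
qed

lemma ennpowr_tendsto:
  assumes p: "0 < p" and X: "X \<longlonglongrightarrow> a" and a: "a < top"
  shows "(\<lambda>n::nat. ennpowr (X n) p) \<longlonglongrightarrow> ennpowr a p"
proof -
  have "eventually (\<lambda>n. X n < top) sequentially" using order_tendstoD(2)[OF X a] .
  then have ev: "eventually (\<lambda>n. ennpowr (X n) p = ennreal (enn2real (X n) powr p)) sequentially"
    by eventually_elim (auto simp: ennpowr_def)
  have "(\<lambda>n. enn2real (X n)) \<longlonglongrightarrow> enn2real a" using X a by (auto intro: tendsto_enn2real)
  then have "(\<lambda>n. ennreal (enn2real (X n) powr p)) \<longlonglongrightarrow> ennreal (enn2real a powr p)"
    by (intro tendsto_ennrealI tendsto_powr'[OF _ tendsto_const]) (use p in auto)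
  moreover have "ennpowr a p = ennreal (enn2real a powr p)" using a by (auto simp: ennpowr_def)
  ultimately show ?thesis using tendsto_cong[OF ev] by simp
qed

section \<open>Arc-length curves, subcurves and curve integrals\<close>

lemma curve_length_shift: "curve_length (\<lambda>x. \<gamma> (s + x)) a b = curve_length \<gamma> (s + a) (s + b)"
proof -
  have *: "curve_length (\<lambda>x. \<gamma> (s + x)) a b \<le> curve_length \<gamma> (s + a) (s + b)" for \<gamma> :: "real \<Rightarrow> 'b::metric_space" and s a b
    unfolding curve_length_def
  proof (rule SUP_least)
    fix ts assume ts: "ts \<in> {ts. sorted ts \<and> set ts \<subseteq> {a..b}}"
    have "sorted (map ((+) s) ts)" using ts by (simp add: sorted_iff_nth_mono)
    then have m: "map ((+) s) ts \<in> {ts. sorted ts \<and> set ts \<subseteq> {s + a..s + b}}" using ts by auto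
    show "(\<Sum>i<length ts - 1. ennreal (dist (\<gamma> (s + ts ! i)) (\<gamma> (s + ts ! Suc i))))
      \<le> (SUP ts\<in>{ts. sorted ts \<and> set ts \<subseteq> {s + a..s + b}}.
            \<Sum>i<length ts - 1. ennreal (dist (\<gamma> (ts ! i)) (\<gamma> (ts ! Suc i))))"
      by (rule SUP_upper2[OF m]) (auto intro!: sum_mono)
  qed
  show ?thesis
    using *[of \<gamma> s a b] *[of "\<lambda>x. \<gamma> (s + x)" "-s" "s + a" "s + b"] by (intro antisym) auto
qed

lemma dist_le_curve_length:
  assumes "s \<le> t" shows "ennreal (dist (\<gamma> s) (\<gamma> t)) \<le> curve_length \<gamma> s t"
  unfolding curve_length_def by (rule SUP_upper2[of "[s, t]"]) (use assms in auto)

lemma arclength_curve_subcurve: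
  assumes "arclength_curve A \<gamma> l" "0 \<le> s" "s < t" "t \<le> l"
  shows "arclength_curve A (\<lambda>x. \<gamma> (s + x)) (t - s)"
proof -
  have "\<gamma> (s + x) \<in> A" if "x \<in> {0..t - s}" for x
    using assms that by (auto simp: arclength_curve_def image_subset_iff)
  moreover have "curve_length (\<lambda>x. \<gamma> (s + x)) a b = ennreal (b - a)" if "0 \<le> a" "a \<le> b" "b \<le> t - s" for a b
  proof -
    have "curve_length \<gamma> (s + a) (s + b) = ennreal ((s + b) - (s + a))"
      using assms that unfolding arclength_curve_def by (metis add_increasing add_left_mono le_diff_eq add.commute order_trans)
    then show ?thesis unfolding curve_length_shift by simp
  qed
  ultimately show ?thesis using assms by (auto simp: arclength_curve_def)
qed

lemma arclength_curve_dist_le: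
  assumes "arclength_curve A \<gamma> l" "s \<in> {0..l}" "t \<in> {0..l}"
  shows "dist (\<gamma> s) (\<gamma> t) \<le> \<bar>s - t\<bar>"
proof -
  have *: "dist (\<gamma> s) (\<gamma> t) \<le> t - s" if "0 \<le> s" "s \<le> t" "t \<le> l" for s t
  proof -
    have "ennreal (dist (\<gamma> s) (\<gamma> t)) \<le> ennreal (t - s)"
      using dist_le_curve_length[OF that(2), of \<gamma>] assms(1) that by (auto simp: arclength_curve_def)
    then show ?thesis using that by (simp add: ennreal_le_iff)
  qed
  show ?thesis using *[of s t] *[of t s] assms by (cases "s \<le> t") (auto simp: dist_commute)
qed

lemma arclength_curve_lipschitz: "arclength_curve A \<gamma> l \<Longrightarrow> 1-lipschitz_on {0..l} \<gamma>"
  by (rule lipschitz_onI) (auto simp: dist_real_def intro: arclength_curve_dist_le)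

lemma arclength_curve_continuous: "arclength_curve A \<gamma> l \<Longrightarrow> continuous_on {0..l} \<gamma>"
  using arclength_curve_lipschitz lipschitz_on_continuous_on by blast

text \<open>Clamping the parameter extends a curve that is continuous on \<open>{0..l}\<close> only
  to a continuous map on the line. Compositions with Borel functions become Borel, while bounds and
  integrals over \<open>[0,l]\<close> stay the same.\<close>

lemma clamp_curve_measurable:
  fixes \<gamma> :: "real \<Rightarrow> 'a::metric_space"
  assumes "continuous_on {0..l} \<gamma>" "0 \<le> l"
  shows "(\<lambda>x. \<gamma> (max 0 (min l x))) \<in> borel_measurable borel"
proof -
  have "continuous_on UNIV (\<lambda>x. \<gamma> (max 0 (min l x)))"
    by (rule continuous_on_compose2[OF assms(1)]) (use assms(2) in "auto intro!: continuous_intros")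
  then show ?thesis by (rule borel_measurable_continuous_onI)
qed

lemma curve_integrand_measurable:
  fixes \<gamma> :: "real \<Rightarrow> 'a::metric_space" and g :: "'a \<Rightarrow> ennreal"
  assumes "continuous_on {0..l} \<gamma>" and [measurable]: "g \<in> borel_measurable borel" and "0 \<le> s" "t \<le> l"
  shows "(\<lambda>x. g (\<gamma> x) * indicator {s..t} x) \<in> borel_measurable borel"
proof (cases "0 \<le> l")
  case True
  note [measurable] = clamp_curve_measurable[OF assms(1) True]
  have "(\<lambda>x. g (\<gamma> (max 0 (min l x))) * indicator {s..t} x) \<in> borel_measurable borel" by measurable
  moreover have "(\<lambda>x. g (\<gamma> (max 0 (min l x))) * indicator {s..t} x) = (\<lambda>x. g (\<gamma> x) * indicator {s..t} x)"
    using assms(3,4) by (auto split: split_indicator)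
  ultimately show ?thesis by simp
next
  case False
  then have "(\<lambda>x. g (\<gamma> x) * indicator {s..t} x) = (\<lambda>x. 0)"
    using assms(3,4) by (auto split: split_indicator)
  then show ?thesis by simp
qed

lemma curve_integral_lborel: "curve_integral g \<gamma> l = seg_integral (\<lambda>x. g (\<gamma> x)) 0 l"
  unfolding curve_integral_def nn_integral_completion ..

lemma curve_integral_mono: "(\<And>x. g x \<le> h x) \<Longrightarrow> curve_integral g \<gamma> l \<le> curve_integral h \<gamma> l"
  unfolding curve_integral_def by (intro nn_integral_mono mult_right_mono) auto

lemma curve_integral_subcurve:
  fixes \<gamma> :: "real \<Rightarrow> 'a::metric_space"
  assumes "continuous_on {0..l} \<gamma>" "g \<in> borel_measurable borel" "0 \<le> s" "t \<le> l"
  shows "curve_integral g (\<lambda>x. \<gamma> (s + x)) (t - s) = seg_integral (\<lambda>x. g (\<gamma> x)) s t"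
proof -
  have "seg_integral (\<lambda>x. g (\<gamma> x)) s t =
      ennreal \<bar>1\<bar> * (\<integral>\<^sup>+x. g (\<gamma> (s + 1 * x)) * indicator {s..t} (s + 1 * x) \<partial>lborel)"
    by (rule nn_integral_real_affine[OF curve_integrand_measurable[OF assms]]) auto
  also have "\<dots> = curve_integral g (\<lambda>x. \<gamma> (s + x)) (t - s)"
    unfolding curve_integral_lborel by (auto intro!: nn_integral_cong split: split_indicator)
  finally show ?thesis ..
qed

lemma ext_diff_ereal [simp]: "ext_diff (ereal a) (ereal b) = ennreal \<bar>a - b\<bar>"
  by (simp add: ext_diff_def e2ennreal_ereal)

abbreviation curve_bound ::
  "('a \<Rightarrow> real) \<Rightarrow> ('a \<Rightarrow> ennreal) \<Rightarrow> (real \<Rightarrow> 'a) \<Rightarrow> real \<Rightarrow> bool" where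
  "curve_bound u g \<gamma> l \<equiv> var_bound (\<lambda>x. u (\<gamma> x)) (\<lambda>x. g (\<gamma> x)) l"

text \<open>For real-valued functions and Borel \<open>g\<close>, \<open>wug\<close> is equivalent to the notion of weak upper gradient:
  the subcurves of almost every curve inherit the inequality, and every measurable \<open>g\<close> has an
  almost everywhere equal Borel majorant.\<close>

definition wug :: "real \<Rightarrow> 'a::metric_space measure \<Rightarrow> ('a \<Rightarrow> real) \<Rightarrow> ('a \<Rightarrow> ennreal) \<Rightarrow> bool" where
  "wug p M u g \<longleftrightarrow> g \<in> borel_measurable borel \<and>
     ae_curve p M (curve_bound u g)"

abbreviation energy :: "real \<Rightarrow> 'a measure \<Rightarrow> ('a \<Rightarrow> ennreal) \<Rightarrow> ennreal" where
  "energy p M g \<equiv> (\<integral>\<^sup>+x. ennpowr (g x) p \<partial>M)"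

lemma energy_mono: "0 < p \<Longrightarrow> (\<And>x. g x \<le> h x) \<Longrightarrow> energy p M g \<le> energy p M h"
  by (intro nn_integral_mono ennpowr_mono) auto

section \<open>Proper metric measure spaces and properties of almost every curve\<close>

locale proper_mm_space =
  fixes p :: real and M :: "'a::metric_space measure"
  assumes p_gt_1: "1 < p" and mm_space: "metric_measure_space M"
    and proper: "\<And>S::'a set. closed S \<Longrightarrow> bounded S \<Longrightarrow> compact S"
begin

lemma p_pos: "0 < p" using p_gt_1 by simp

lemma space_M [simp]: "space M = UNIV"
  using mm_space unfolding metric_measure_space_def
  by (metis sets_eq_imp_space_eq space_borel space_completion)

lemma borel_sets_M: "A \<in> sets borel \<Longrightarrow> A \<in> sets M"
  using mm_space unfolding metric_measure_space_def by auto

lemma borel_measurable_M: "f \<in> measurable borel N \<Longrightarrow> f \<in> measurable M N"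
  using borel_sets_M by (auto simp: measurable_def)

lemma ball_finite: "emeasure M (ball x r) < \<infinity>"
  using mm_space unfolding metric_measure_space_def by (cases "0 < r") (auto simp: ball_empty)

text \<open>Domination has to hold everywhere because a curve may run inside a null set; raising
  \<open>\<rho>\<close> or a gradient pointwise never spoils a statement along curves. The value
  \<open>top\<close> on a Borel null set achieves this without changing energies.\<close>

lemma borel_majorant:
  fixes f :: "'a \<Rightarrow> ennreal"
  assumes "f \<in> borel_measurable M"
  obtains f' where "f' \<in> borel_measurable borel" "\<And>x. f x \<le> f' x" "AE x in M. f' x = f x"
proof -
  obtain N where N: "sets N = sets borel" "M = completion N"
    using mm_space unfolding metric_measure_space_def by auto
  obtain h where h: "h \<in> borel_measurable N" "AE x in N. f x = h x"
    using completion_ex_borel_measurable assms unfolding N(2) by blast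
  obtain Z where Z: "{x\<in>space N. f x \<noteq> h x} \<subseteq> Z" "emeasure N Z = 0" "Z \<in> sets N"
    using h(2) by (rule AE_E)
  have spN: "space N = UNIV" using sets_eq_imp_space_eq[OF N(1)] by simp
  have hb[measurable]: "h \<in> borel_measurable borel" using h(1) N(1) measurable_cong_sets by blast
  have [measurable]: "Z \<in> sets borel" using Z N by simp
  have AE: "AE x in M. x \<notin> Z"
    unfolding N(2) by (intro AE_completion AE_not_in) (use Z in auto)
  show thesis
  proof
    show "(\<lambda>x. if x \<in> Z then top else h x) \<in> borel_measurable borel" by measurable
    show "f x \<le> (if x \<in> Z then top else h x)" for x
      using Z(1) spN by (cases "f x = h x") auto
    show "AE x in M. (if x \<in> Z then top else h x) = f x"
      using AE
    proof eventually_elim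
      fix x assume "x \<notin> Z"
      then show "(if x \<in> Z then top else h x) = f x" using Z(1) spN by (cases "f x = h x") auto
    qed
  qed
qed

lemma ae_curveE:
  assumes "ae_curve p M P"
  obtains \<rho> where "\<rho> \<in> borel_measurable borel" "energy p M \<rho> < \<infinity>"
    "\<And>\<gamma> l. \<lbrakk>arclength_curve UNIV \<gamma> l; curve_integral \<rho> \<gamma> l < \<infinity>\<rbrakk> \<Longrightarrow> P \<gamma> l"
proof -
  obtain \<rho> where r: "\<rho> \<in> borel_measurable M" "energy p M \<rho> < \<infinity>"
    "\<And>\<gamma> l. \<lbrakk>arclength_curve UNIV \<gamma> l; \<not> P \<gamma> l\<rbrakk> \<Longrightarrow> curve_integral \<rho> \<gamma> l = \<infinity>"
    using assms unfolding ae_curve_def by auto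
  obtain \<rho>' where r': "\<rho>' \<in> borel_measurable borel" "\<And>x. \<rho> x \<le> \<rho>' x" "AE x in M. \<rho>' x = \<rho> x"
    using borel_majorant[OF r(1)] by blast
  have "energy p M \<rho>' = energy p M \<rho>"
    by (rule nn_integral_cong_AE) (use r'(3) in eventually_elim, simp)
  with r r' show thesis
    by (intro that[of \<rho>']) (auto, metis curve_integral_mono less_irrefl top.not_eq_extremum top.extremum_unique)
qed

lemma ae_curveI:
  assumes "\<rho> \<in> borel_measurable borel" "energy p M \<rho> < \<infinity>"
    "\<And>\<gamma> l. \<lbrakk>arclength_curve UNIV \<gamma> l; curve_integral \<rho> \<gamma> l < \<infinity>\<rbrakk> \<Longrightarrow> P \<gamma> l"
  shows "ae_curve p M P"
  unfolding ae_curve_def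
proof (rule bexI[of _ \<rho>], intro conjI allI impI)
  fix \<gamma> :: "real \<Rightarrow> 'a" and l assume "arclength_curve (space M) \<gamma> l \<and> \<not> P \<gamma> l"
  then have "\<not> curve_integral \<rho> \<gamma> l < \<infinity>" using assms(3) by auto
  then show "curve_integral \<rho> \<gamma> l = \<infinity>" using less_top by fastforce
qed (use assms borel_measurable_M in auto)

lemma ae_curve_mono:
  assumes "ae_curve p M P" "\<And>\<gamma> l. arclength_curve UNIV \<gamma> l \<Longrightarrow> P \<gamma> l \<Longrightarrow> Q \<gamma> l"
  shows "ae_curve p M Q"
  using assms unfolding ae_curve_def by (metis space_M)

text \<open>Weighted p-th powers are summed and the root is taken at the end, so that the energy of
  \<open>\<rho>'\<close> is a plain series. Each \<open>\<rho> n\<close> is at most a constant times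
  \<open>\<rho>'\<close>, so a finite integral of \<open>\<rho>'\<close> clears a curve for all
  \<open>n\<close> at once.\<close>

lemma ae_curve_all:
  assumes "\<And>n::nat. ae_curve p M (P n)"
  shows "ae_curve p M (\<lambda>\<gamma> l. \<forall>n. P n \<gamma> l)"
proof -
  have "\<exists>\<rho>. \<rho> \<in> borel_measurable borel \<and> energy p M \<rho> < \<infinity> \<and>
    (\<forall>\<gamma> l. arclength_curve UNIV \<gamma> l \<and> curve_integral \<rho> \<gamma> l < \<infinity> \<longrightarrow> P n \<gamma> l)" for n
    by (rule ae_curveE[OF assms[of n]]) blast
  then obtain \<rho> where r: "\<And>n. \<rho> n \<in> borel_measurable borel" "\<And>n. energy p M (\<rho> n) < \<infinity>"
    "\<And>n \<gamma> l. arclength_curve UNIV \<gamma> l \<Longrightarrow> curve_integral (\<rho> n) \<gamma> l < \<infinity> \<Longrightarrow> P n \<gamma> l"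
    by metis
  note [measurable] = r(1) borel_measurable_M[OF r(1)]
  \<comment> \<open>The weight makes the n-th term of the energy at most \<open>(1/2) ^ n\<close>;
    the 1 in the denominator guards against zero energy.\<close>
  define c :: "nat \<Rightarrow> real" where "c n = (1/2) ^ n / (1 + enn2real (energy p M (\<rho> n)))" for n
  have c0: "0 < c n" for n by (auto simp: c_def add_pos_nonneg)
  have cE: "ennreal (c n) * energy p M (\<rho> n) \<le> ennreal ((1/2) ^ n)" for n
  proof -
    obtain e where e: "0 \<le> e" "energy p M (\<rho> n) = ennreal e"
      using r(2)[of n] by (cases "energy p M (\<rho> n)") auto
    have "c n * e = (1/2) ^ n * (e / (1 + e))" using e by (simp add: c_def)
    also have "\<dots> \<le> (1/2) ^ n * 1" by (intro mult_left_mono) (use e in auto)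
    finally show ?thesis unfolding e(2) using e(1) c0[of n] by (simp flip: ennreal_mult')
  qed
  define s where "s x = (\<Sum>n. ennreal (c n) * ennpowr (\<rho> n x) p)" for x
  have [measurable]: "s \<in> borel_measurable borel" unfolding s_def by measurable
  define \<rho>' where "\<rho>' x = ennpowr (s x) (1 / p)" for x
  have rm[measurable]: "\<rho>' \<in> borel_measurable borel" unfolding \<rho>'_def by measurable
  have "energy p M \<rho>' = (\<integral>\<^sup>+x. s x \<partial>M)"
    by (simp add: \<rho>'_def ennpowr_inverse' p_pos)
  also have "\<dots> = (\<Sum>n. \<integral>\<^sup>+x. ennreal (c n) * ennpowr (\<rho> n x) p \<partial>M)"
    unfolding s_def by (rule nn_integral_suminf) measurable
  also have "\<dots> = (\<Sum>n. ennreal (c n) * energy p M (\<rho> n))"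
    by (intro suminf_cong nn_integral_cmult) measurable
  also have "\<dots> \<le> (\<Sum>n. ennreal ((1/2) ^ n))"
    by (intro suminf_le cE) auto
  also have "\<dots> < \<infinity>"
    by (subst suminf_ennreal2) auto
  finally have fin: "energy p M \<rho>' < \<infinity>" .
  have le: "\<rho> n x \<le> ennreal (c n powr (- 1 / p)) * \<rho>' x" for n x
  proof -
    have "ennreal (c n) * ennpowr (\<rho> n x) p \<le> s x"
      unfolding s_def
      by (rule sum_le_suminf[of _ "{n}", simplified]) auto
    from ennpowr_mono[OF _ this, of "1/p"] p_pos
    have "ennpowr (ennreal (c n)) (1/p) * \<rho> n x \<le> \<rho>' x"
      by (simp add: \<rho>'_def ennpowr_mult ennpowr_inverse)
    then have "ennreal (c n powr (- 1 / p)) * (ennpowr (ennreal (c n)) (1/p) * \<rho> n x) \<le> ennreal (c n powr (- 1 / p)) * \<rho>' x"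
      by (rule mult_left_mono) auto
    moreover have "ennreal (c n powr (- 1 / p)) * ennpowr (ennreal (c n)) (1/p) = 1"
      using c0[of n] by (simp add: ennpowr_ennreal flip: ennreal_mult powr_add)
    ultimately show ?thesis by (metis mult.assoc mult_1)
  qed
  show ?thesis
  proof (rule ae_curveI[OF rm fin], intro allI r(3))
    fix \<gamma> :: "real \<Rightarrow> 'a" and l n assume g: "arclength_curve UNIV \<gamma> l" and f: "curve_integral \<rho>' \<gamma> l < \<infinity>"
    have "curve_integral (\<rho> n) \<gamma> l \<le> curve_integral (\<lambda>x. ennreal (c n powr (- 1 / p)) * \<rho>' x) \<gamma> l"
      by (intro curve_integral_mono le)
    also have "\<dots> = ennreal (c n powr (- 1 / p)) * curve_integral \<rho>' \<gamma> l"
      unfolding curve_integral_lborel mult.assoc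
      by (intro nn_integral_cmult)
        (use curve_integrand_measurable[OF arclength_curve_continuous[OF g] rm, of 0 l] in simp)
    also have "\<dots> < \<infinity>" using f by (simp add: ennreal_mult_less_top)
    finally show "curve_integral (\<rho> n) \<gamma> l < \<infinity>" .
  qed
qed

lemma ae_curve_conj:
  assumes "ae_curve p M P" "ae_curve p M Q"
  shows "ae_curve p M (\<lambda>\<gamma> l. P \<gamma> l \<and> Q \<gamma> l)"
proof -
  have "ae_curve p M (\<lambda>\<gamma> l. \<forall>n::nat. (if n = 0 then P else Q) \<gamma> l)"
    by (rule ae_curve_all) (use assms in auto)
  then show ?thesis by (rule ae_curve_mono) (metis zero_neq_one)
qed

lemma ae_curve_finite:
  assumes "g \<in> borel_measurable borel" "energy p M g < \<infinity>"
  shows "ae_curve p M (\<lambda>\<gamma> l. curve_integral g \<gamma> l < \<infinity>)"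
  by (rule ae_curveI[OF assms])

text \<open>The same \<open>\<rho>\<close> works, since its integral over a subcurve is at most the
  one over the whole curve.\<close>

lemma ae_curve_subcurves:
  assumes "ae_curve p M P"
  shows "ae_curve p M (\<lambda>\<gamma> l. \<forall>s t. 0 \<le> s \<longrightarrow> s < t \<longrightarrow> t \<le> l \<longrightarrow> P (\<lambda>x. \<gamma> (s + x)) (t - s))"
proof -
  obtain \<rho> where r: "\<rho> \<in> borel_measurable borel" "energy p M \<rho> < \<infinity>"
    "\<And>\<gamma> l. \<lbrakk>arclength_curve UNIV \<gamma> l; curve_integral \<rho> \<gamma> l < \<infinity>\<rbrakk> \<Longrightarrow> P \<gamma> l"
    using ae_curveE[OF assms] by blast
  show ?thesis
  proof (rule ae_curveI[OF r(1,2)], intro allI impI r(3))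
    fix \<gamma> :: "real \<Rightarrow> 'a" and l s t
    assume g: "arclength_curve UNIV \<gamma> l" "curve_integral \<rho> \<gamma> l < \<infinity>" and st: "0 \<le> s" "s < t" "t \<le> l"
    show "arclength_curve UNIV (\<lambda>x. \<gamma> (s + x)) (t - s)"
      by (rule arclength_curve_subcurve[OF g(1) st])
    have "curve_integral \<rho> (\<lambda>x. \<gamma> (s + x)) (t - s) = seg_integral (\<lambda>x. \<rho> (\<gamma> x)) s t"
      by (rule curve_integral_subcurve[OF arclength_curve_continuous[OF g(1)] r(1)]) (use st in auto)
    also have "\<dots> \<le> curve_integral \<rho> \<gamma> l"
      unfolding curve_integral_lborel by (intro nn_integral_mono) (use st in "auto split: split_indicator")
    finally show "curve_integral \<rho> (\<lambda>x. \<gamma> (s + x)) (t - s) < \<infinity>" using g(2) by (rule le_less_trans)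
  qed
qed

lemma wug_of_weak_upper_gradient:
  assumes "weak_upper_gradient p M (\<lambda>x. ereal (u x)) g"
  obtains g' where "wug p M u g'" "AE x in M. g' x = g x"
proof -
  have gm: "g \<in> borel_measurable M" and
    ae: "ae_curve p M (\<lambda>\<gamma> l. ext_diff (ereal (u (\<gamma> 0))) (ereal (u (\<gamma> l))) \<le> curve_integral g \<gamma> l)"
    using assms unfolding weak_upper_gradient_def by auto
  obtain g' where g': "g' \<in> borel_measurable borel" "\<And>x. g x \<le> g' x" "AE x in M. g' x = g x"
    using borel_majorant[OF gm] by blast
  have "ae_curve p M (curve_bound u g')"
  proof (rule ae_curve_mono[OF ae_curve_subcurves[OF ae]])
    fix \<gamma> :: "real \<Rightarrow> 'a" and l
    assume g: "arclength_curve UNIV \<gamma> l" and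
      H: "\<forall>s t. 0 \<le> s \<longrightarrow> s < t \<longrightarrow> t \<le> l \<longrightarrow>
           ext_diff (ereal (u (\<gamma> (s + 0)))) (ereal (u (\<gamma> (s + (t - s))))) \<le> curve_integral g (\<lambda>x. \<gamma> (s + x)) (t - s)"
    show "curve_bound u g' \<gamma> l"
      unfolding var_bound_def
    proof (intro allI impI)
      fix s t :: real assume *: "0 \<le> s" "s \<le> t" "t \<le> l"
      show "ennreal \<bar>u (\<gamma> t) - u (\<gamma> s)\<bar> \<le> seg_integral (\<lambda>x. g' (\<gamma> x)) s t"
      proof (cases "s = t")
        \<comment> \<open>There is no subcurve here, because arc-length curves have positive
          length.\<close>
        case True then show ?thesis by simp
      next
        case False
        have "ennreal \<bar>u (\<gamma> t) - u (\<gamma> s)\<bar> \<le> curve_integral g (\<lambda>x. \<gamma> (s + x)) (t - s)"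
          using H[rule_format, of s t] * False by (simp add: abs_minus_commute)
        also have "\<dots> \<le> curve_integral g' (\<lambda>x. \<gamma> (s + x)) (t - s)"
          by (intro curve_integral_mono g')
        also have "\<dots> = seg_integral (\<lambda>x. g' (\<gamma> x)) s t"
          by (rule curve_integral_subcurve[OF arclength_curve_continuous[OF g] g'(1)]) (use * in auto)
        finally show ?thesis .
      qed
    qed
  qed
  with g' show thesis by (intro that[of g']) (auto simp: wug_def)
qed

lemma weak_upper_gradient_of_wug:
  assumes "wug p M u g" shows "weak_upper_gradient p M (\<lambda>x. ereal (u x)) g"
proof -
  have "ae_curve p M (\<lambda>\<gamma> l. ext_diff (ereal (u (\<gamma> 0))) (ereal (u (\<gamma> l))) \<le> curve_integral g \<gamma> l)"
  proof (rule ae_curve_mono[OF assms[unfolded wug_def, THEN conjunct2]])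
    fix \<gamma> :: "real \<Rightarrow> 'a" and l
    assume "arclength_curve UNIV \<gamma> l" and vb: "curve_bound u g \<gamma> l"
    then have "0 \<le> l" by (auto simp: arclength_curve_def)
    from var_boundD[OF vb order_refl this order_refl]
    show "ext_diff (ereal (u (\<gamma> 0))) (ereal (u (\<gamma> l))) \<le> curve_integral g \<gamma> l"
      by (simp add: curve_integral_lborel abs_minus_commute)
  qed
  then show ?thesis using assms borel_measurable_M by (auto simp: weak_upper_gradient_def wug_def)
qed

end

section \<open>Weak upper gradients: exchange, lattice operations, minimality\<close>

lemma clamp_var_bound:
  "var_bound (\<lambda>x. u (\<gamma> (max 0 (min l x)))) (\<lambda>x. k (\<gamma> (max 0 (min l x)))) l \<longleftrightarrow>
   curve_bound u k \<gamma> l"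
  by (rule var_bound_cong) auto

lemma clamp_integral:
  "(seg_integral (\<lambda>x. k (\<gamma> (max 0 (min l x)))) 0 l) = curve_integral k \<gamma> l"
  unfolding curve_integral_lborel by (intro nn_integral_cong) (auto split: split_indicator)

lemma curve_integral_add:
  fixes \<gamma> :: "real \<Rightarrow> 'a::metric_space"
  assumes "continuous_on {0..l} \<gamma>" "g \<in> borel_measurable borel" "h \<in> borel_measurable borel"
  shows "curve_integral (\<lambda>x. g x + h x) \<gamma> l = curve_integral g \<gamma> l + curve_integral h \<gamma> l"
  unfolding curve_integral_lborel distrib_right
  by (intro nn_integral_add) (use assms in "auto intro: curve_integrand_measurable")

lemma wug_borel: "wug p M u g \<Longrightarrow> g \<in> borel_measurable borel"
  by (simp add: wug_def)

lemma wug_ae: "wug p M u g \<Longrightarrow> ae_curve p M (curve_bound u g)"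
  by (simp add: wug_def)

text \<open>Weaker than finite energy on purpose: constants and locally p-integrable functions
  qualify as well, and finite integrals along almost every curve are what the exchange of bounds
  asks for.\<close>

definition curve_finite :: "real \<Rightarrow> 'a::metric_space measure \<Rightarrow> ('a \<Rightarrow> ennreal) \<Rightarrow> bool" where
  "curve_finite p M g \<longleftrightarrow> ae_curve p M (\<lambda>\<gamma> l. curve_integral g \<gamma> l < \<infinity>)"

context proper_mm_space
begin

lemma curve_finite_energy:
  "g \<in> borel_measurable borel \<Longrightarrow> energy p M g < \<infinity> \<Longrightarrow> curve_finite p M g"
  unfolding curve_finite_def by (rule ae_curve_finite)

text \<open>Closed balls are compact in a proper space, so finitely many of the small balls given by
  local integrability cover one.\<close>

lemma Lp_loc_ball:
  assumes "h \<in> Lp_loc p M" shows "(\<integral>\<^sup>+y\<in>ball x R. ennpowr (h y) p \<partial>M) < \<infinity>"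
proof -
  have hm[measurable]: "h \<in> borel_measurable M" using assms by (auto simp: Lp_loc_def)
  obtain r where r: "\<And>z. 0 < r z" "\<And>z. (\<integral>\<^sup>+y\<in>ball z (r z). ennpowr (h y) p \<partial>M) < \<infinity>"
    using assms by (simp add: Lp_loc_def) metis
  have "compact (cball x R)" by (rule proper) auto
  then obtain C where C: "finite C" "cball x R \<subseteq> (\<Union>z\<in>C. ball z (r z))"
  proof (rule compactE_image[of _ UNIV "\<lambda>z. ball z (r z)"])
    show "cball x R \<subseteq> (\<Union>z. ball z (r z))" using r(1) centre_in_ball by blast
  qed auto
  have [measurable]: "ball z s \<in> sets M" for z s by (rule borel_sets_M) auto
  have "(\<integral>\<^sup>+y\<in>ball x R. ennpowr (h y) p \<partial>M) \<le> (\<integral>\<^sup>+y. (\<Sum>z\<in>C. ennpowr (h y) p * indicator (ball z (r z)) y) \<partial>M)"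
  proof (rule nn_integral_mono)
    fix y show "ennpowr (h y) p * indicator (ball x R) y \<le> (\<Sum>z\<in>C. ennpowr (h y) p * indicator (ball z (r z)) y)"
    proof (cases "y \<in> ball x R")
      case True
      then obtain z where z: "z \<in> C" "y \<in> ball z (r z)" using C(2) ball_subset_cball by blast
      have "ennpowr (h y) p * indicator (ball x R) y = ennpowr (h y) p * indicator (ball z (r z)) y"
        using True z by simp
      also have "\<dots> \<le> (\<Sum>z\<in>C. ennpowr (h y) p * indicator (ball z (r z)) y)"
        by (rule member_le_sum) (use z C in auto)
      finally show ?thesis .
    qed simp
  qed
  also have "\<dots> = (\<Sum>z\<in>C. \<integral>\<^sup>+y\<in>ball z (r z). ennpowr (h y) p \<partial>M)"
    by (intro nn_integral_sum) measurable
  also have "\<dots> < \<infinity>" using r(2) C(1) by (simp add: less_top sum_Inf)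
  finally show ?thesis .
qed

text \<open>Each curve is compact and stays in a ball of integer radius, where \<open>h\<close>
  agrees with a truncation of finite energy. Countably many truncations serve all curves.\<close>

lemma curve_finite_Lp_loc:
  assumes hm[measurable]: "h \<in> borel_measurable borel" and h: "h \<in> Lp_loc p M"
  shows "curve_finite p M h"
proof -
  fix x0 :: 'a
  note [measurable] = borel_measurable_M[OF hm]
  have [measurable]: "ball x0 r \<in> sets borel" for r by simp
  define k where "k n x = h x * indicator (ball x0 (real n)) x" for n x
  have km[measurable]: "k n \<in> borel_measurable borel" for n unfolding k_def by measurable
  have "energy p M (k n) = (\<integral>\<^sup>+y\<in>ball x0 (real n). ennpowr (h y) p \<partial>M)" for n
    unfolding k_def by (intro nn_integral_cong) (auto split: split_indicator)
  then have "energy p M (k n) < \<infinity>" for n using Lp_loc_ball[OF h] by simp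
  then have "ae_curve p M (\<lambda>\<gamma> l. \<forall>n. curve_integral (k n) \<gamma> l < \<infinity>)"
    by (intro ae_curve_all ae_curve_finite km)
  then show ?thesis unfolding curve_finite_def
  proof (rule ae_curve_mono)
    fix \<gamma> :: "real \<Rightarrow> 'a" and l
    assume g: "arclength_curve UNIV \<gamma> l" and fin: "\<forall>n. curve_integral (k n) \<gamma> l < \<infinity>"
    have "compact (\<gamma> ` {0..l})"
      by (rule compact_continuous_image[OF arclength_curve_continuous[OF g]]) auto
    then obtain R where R: "\<gamma> ` {0..l} \<subseteq> ball x0 R"
      using bounded_subset_ballD[OF compact_imp_bounded] by blast
    obtain n where "R \<le> real n" using real_arch_simple by blast
    with R have R: "\<gamma> x \<in> ball x0 (real n)" if "x \<in> {0..l}" for x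
      using that subset_ball by blast
    have "curve_integral h \<gamma> l = curve_integral (k n) \<gamma> l"
      unfolding curve_integral_lborel k_def
      by (intro nn_integral_cong) (use R in "auto split: split_indicator")
    then show "curve_integral h \<gamma> l < \<infinity>" using fin by simp
  qed
qed

text \<open>Along a curve the preimage of \<open>A\<close> is a Borel set of parameters, so
  \<open>var_bound_if\<close> applies with \<open>g + h\<close> as the common majorant.\<close>

lemma wug_if:
  assumes "wug p M u g" "wug p M u h" "curve_finite p M g" "curve_finite p M h" and A: "A \<in> sets borel"
  shows "wug p M u (\<lambda>x. if x \<in> A then g x else h x)"
proof -
  note [measurable] = wug_borel[OF assms(1)] wug_borel[OF assms(2)] A
  have "ae_curve p M (curve_bound u (\<lambda>x. if x \<in> A then g x else h x))"
  proof (rule ae_curve_mono[OF ae_curve_conj[OF ae_curve_conj[OF wug_ae[OF assms(1)] wug_ae[OF assms(2)]]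
        ae_curve_conj[OF assms(3)[unfolded curve_finite_def] assms(4)[unfolded curve_finite_def]]]], elim conjE)
    fix \<gamma> :: "real \<Rightarrow> 'a" and l
    assume c: "arclength_curve UNIV \<gamma> l"
      and v: "curve_bound u g \<gamma> l" "curve_bound u h \<gamma> l"
      and f: "curve_integral g \<gamma> l < \<infinity>" "curve_integral h \<gamma> l < \<infinity>"
    let ?\<gamma> = "\<lambda>x. \<gamma> (max 0 (min l x))"
    have cont: "continuous_on {0..l} \<gamma>" by (rule arclength_curve_continuous[OF c])
    have [measurable]: "?\<gamma> \<in> borel_measurable borel"
      by (rule clamp_curve_measurable[OF cont]) (use c in "auto simp: arclength_curve_def")
    have fin: "seg_integral (\<lambda>x. (g (?\<gamma> x) + h (?\<gamma> x))) 0 l < \<infinity>"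
      using f unfolding clamp_integral[where k="\<lambda>x. g x + h x"]
      by (subst curve_integral_add[OF cont]) auto
    have "var_bound (\<lambda>x. u (?\<gamma> x)) (\<lambda>x. if x \<in> ?\<gamma> -` A then g (?\<gamma> x) else h (?\<gamma> x)) l"
    proof (rule var_bound_if[OF _ fin])
      show "?\<gamma> -` A \<in> sets borel" by (rule measurable_sets_borel[OF _ A]) measurable
      show "curve_bound u g ?\<gamma> l" "curve_bound u h ?\<gamma> l"
        using v by (simp_all add: clamp_var_bound)
    qed (auto simp: add_increasing add_increasing2)
    then show "curve_bound u (\<lambda>x. if x \<in> A then g x else h x) \<gamma> l"
      using clamp_var_bound[of u \<gamma> l "\<lambda>x. if x \<in> A then g x else h x"] by simp
  qed
  then show ?thesis by (simp add: wug_def)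
qed

lemma wug_inf:
  assumes "wug p M u g" "wug p M u h" "curve_finite p M g" "curve_finite p M h"
  shows "wug p M u (\<lambda>x. min (g x) (h x))"
proof -
  note [measurable] = wug_borel[OF assms(1)] wug_borel[OF assms(2)]
  have "wug p M u (\<lambda>x. if x \<in> {x. g x \<le> h x} then g x else h x)"
    by (rule wug_if[OF assms]) measurable
  then show ?thesis by (simp add: min_def)
qed

text \<open>Monotone convergence from above along each good curve; the hypothesis on
  \<open>g 0\<close> supplies the finite integral from which the decrease starts.\<close>

lemma wug_INF:
  assumes w: "\<And>n::nat. wug p M u (g n)" and dec: "decseq g" and fin: "curve_finite p M (g 0)"
  shows "wug p M u (\<lambda>x. INF n. g n x)"
proof -
  note gm[measurable] = wug_borel[OF w]
  have ae: "ae_curve p M (\<lambda>\<gamma> l. \<forall>n. curve_bound u (g n) \<gamma> l)"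
    by (rule ae_curve_all) (use w in "simp add: wug_def")
  have "ae_curve p M (curve_bound u (\<lambda>x. INF n. g n x))"
  proof (rule ae_curve_mono[OF ae_curve_conj[OF ae fin[unfolded curve_finite_def]]], elim conjE)
    fix \<gamma> :: "real \<Rightarrow> 'a" and l
    assume c: "arclength_curve UNIV \<gamma> l" and v: "\<forall>n. curve_bound u (g n) \<gamma> l"
      and f: "curve_integral (g 0) \<gamma> l < \<infinity>"
    show "curve_bound u (\<lambda>x. INF n. g n x) \<gamma> l"
      unfolding var_bound_def
    proof (intro allI impI)
      fix s t :: real assume *: "0 \<le> s" "s \<le> t" "t \<le> l"
      have m: "(\<lambda>x. g n (\<gamma> x) * indicator {s..t} x) \<in> borel_measurable lborel" for n
        using curve_integrand_measurable[OF arclength_curve_continuous[OF c] gm * (1,3)] by simp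
      have ptw: "(INF n. g n (\<gamma> x)) * indicator {s..t} x = (INF n. g n (\<gamma> x) * indicator {s..t} x)" for x
        by (cases "x \<in> {s..t}") auto
      have "seg_integral (\<lambda>x. g 0 (\<gamma> x)) s t \<le> curve_integral (g 0) \<gamma> l"
        unfolding curve_integral_lborel by (intro nn_integral_mono) (use * in "auto split: split_indicator")
      then have f': "seg_integral (\<lambda>x. g 0 (\<gamma> x)) s t < \<infinity>" using f by (rule le_less_trans)
      have "seg_integral (\<lambda>x. (INF n. g n (\<gamma> x))) s t = (INF n. \<integral>\<^sup>+x\<in>{s..t}. g n (\<gamma> x) \<partial>lborel)"
        unfolding ptw
      proof (rule nn_integral_monotone_convergence_INF_decseq[where i=0])
        show "decseq (\<lambda>n x. g n (\<gamma> x) * indicator {s..t} x)"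
          by (rule decseq_SucI) (use decseqD[OF dec, of n "Suc n" for n] in "auto simp: le_fun_def intro!: mult_right_mono")
      qed (use m f' in auto)
      also have "\<dots> \<ge> ennreal \<bar>u (\<gamma> t) - u (\<gamma> s)\<bar>"
        by (rule INF_greatest) (use var_boundD[OF v[rule_format] *] in auto)
      finally show "ennreal \<bar>u (\<gamma> t) - u (\<gamma> s)\<bar> \<le> seg_integral (\<lambda>x. (INF n. g n (\<gamma> x))) s t" .
    qed
  qed
  moreover have "(\<lambda>x. INF n. g n x) \<in> borel_measurable borel" by measurable
  ultimately show ?thesis by (simp add: wug_def)
qed

lemma energy_eq_AE:
  assumes [measurable]: "g \<in> borel_measurable M" "h \<in> borel_measurable M"
    and le: "\<And>x. g x \<le> h x" and fin: "energy p M h < \<infinity>" and E: "energy p M h \<le> energy p M g"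
  shows "AE x in M. h x = g x"
proof -
  have leE: "energy p M g \<le> energy p M h" by (rule energy_mono[OF p_pos le])
  have lep: "ennpowr (g x) p \<le> ennpowr (h x) p" for x by (rule ennpowr_mono[OF p_pos le])
  have "(\<integral>\<^sup>+x. ennpowr (h x) p - ennpowr (g x) p \<partial>M) = energy p M h - energy p M g"
    by (rule nn_integral_diff) (use leE fin lep in "auto simp: less_top dest: le_less_trans")
  also have "\<dots> = 0" using E fin by (simp add: diff_eq_0_iff_ennreal)
  finally have "AE x in M. ennpowr (h x) p - ennpowr (g x) p = 0"
    by (subst (asm) nn_integral_0_iff_AE) auto
  moreover have "AE x in M. ennpowr (h x) p \<noteq> \<infinity>"
    by (rule nn_integral_PInf_AE) (use fin in auto)
  ultimately show ?thesis
  proof eventually_elim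
    case (elim x)
    then have "ennpowr (h x) p \<le> ennpowr (g x) p" by (auto simp: diff_eq_0_iff_ennreal top.not_eq_extremum)
    with lep[of x] have "ennpowr (h x) p = ennpowr (g x) p" by (rule antisym[rotated])
    then show ?case using ennpowr_inverse[OF p_pos] by metis
  qed
qed

lemma Lp_loc_energy: "g \<in> borel_measurable M \<Longrightarrow> energy p M g < \<infinity> \<Longrightarrow> g \<in> Lp_loc p M"
  unfolding Lp_loc_def
proof (intro CollectI conjI ballI)
  fix x assume fin: "energy p M g < \<infinity>"
  have "(\<integral>\<^sup>+y\<in>ball x 1. ennpowr (g y) p \<partial>M) \<le> energy p M g"
    by (intro nn_integral_mono) (auto split: split_indicator)
  with fin show "\<exists>r>0. (\<integral>\<^sup>+y\<in>ball x r. ennpowr (g y) p \<partial>M) < \<infinity>"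
    by (intro exI[of _ 1]) (auto dest: le_less_trans)
qed

text \<open>Minima of weak upper gradients are weak upper gradients, so running minima of a
  minimizing sequence decrease to some \<open>G\<close> of least energy. The minimum of
  \<open>G\<close> with a competitor cannot have less energy and hence equals \<open>G\<close>
  almost everywhere. Existence is what gives the choice in
  \<open>minimal_weak_upper_gradient\<close> a meaning.\<close>

lemma minimal_wug_exists:
  assumes "wug p M u g0" "energy p M g0 < \<infinity>"
  shows "\<exists>g. is_minimal_weak_upper_gradient p M (\<lambda>x. ereal (u x)) g"
proof -
  let ?W = "{g. wug p M u g \<and> energy p M g < \<infinity>}"
  define I where "I = (INF g\<in>?W. energy p M g)"
  have ne: "?W \<noteq> {}" using assms by auto
  obtain h where h0: "\<forall>n. h n \<in> energy p M ` ?W" and hlim: "h \<longlonglongrightarrow> I"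
  proof -
    have "energy p M ` ?W \<noteq> {}" using ne by (rule contrapos_nn) (simp only: image_is_empty)
    from Inf_as_limit[OF this] show thesis using that unfolding I_def by (elim exE conjE)
  qed
  have "\<forall>n. \<exists>k. k \<in> ?W \<and> h n = energy p M k" using h0 by blast
  then obtain f where "\<forall>n. f n \<in> ?W \<and> h n = energy p M (f n)" by (rule choice[THEN exE])
  then have f: "\<And>n. f n \<in> ?W" "\<And>n. h n = energy p M (f n)" by auto
  define g where "g = rec_nat (f 0) (\<lambda>n k x. min (k x) (f (Suc n) x))"
  have g0: "g 0 = f 0" and gS: "g (Suc n) = (\<lambda>x. min (g n x) (f (Suc n) x))" for n
    by (simp_all add: g_def)
  have gf: "g n x \<le> f n x" for n x by (cases n) (auto simp: g0 gS)
  have gW: "g n \<in> ?W" for n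
  proof (induction n)
    case 0 then show ?case using f by (simp add: g0)
  next
    case (Suc n)
    have "wug p M u (g (Suc n))" unfolding gS
      by (rule wug_inf) (use Suc f(1)[of "Suc n"] in "auto intro: curve_finite_energy wug_borel")
    moreover have "energy p M (g (Suc n)) \<le> energy p M (g n)"
      by (rule energy_mono[OF p_pos]) (auto simp: gS)
    ultimately show ?case using Suc by (auto dest: le_less_trans)
  qed
  have dec: "decseq g" by (rule decseq_SucI) (auto simp: gS le_fun_def)
  define G where "G x = (INF n. g n x)" for x
  have wG: "wug p M u G" unfolding G_def
  proof (rule wug_INF[OF _ dec])
    show "wug p M u (g n)" for n using gW by blast
    show "curve_finite p M (g 0)" using gW[of 0] by (auto intro: curve_finite_energy wug_borel)
  qed
  have "energy p M G \<le> energy p M (f n)" for n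
    by (rule energy_mono[OF p_pos]) (auto simp: G_def intro: INF_lower2 gf)
  then have GI: "energy p M G \<le> I"
    by (intro LIMSEQ_le_const[OF hlim]) (auto simp: f(2))
  have "I < \<infinity>" unfolding I_def using assms by (auto simp: INF_less_iff)
  with GI have Gfin: "energy p M G < \<infinity>" by (rule le_less_trans)
  note Gm = wug_borel[OF wG]
  have "is_minimal_weak_upper_gradient p M (\<lambda>x. ereal (u x)) G"
    unfolding is_minimal_weak_upper_gradient_def
  proof (intro conjI allI impI)
    show "weak_upper_gradient p M (\<lambda>x. ereal (u x)) G" by (rule weak_upper_gradient_of_wug[OF wG])
    show "G \<in> Lp_loc p M" by (rule Lp_loc_energy[OF borel_measurable_M[OF Gm] Gfin])
    fix k assume k: "weak_upper_gradient p M (\<lambda>x. ereal (u x)) k \<and> k \<in> Lp_loc p M"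
    obtain k' where k': "wug p M u k'" "AE x in M. k' x = k x"
      using wug_of_weak_upper_gradient k by blast
    note km = wug_borel[OF k'(1)]
    \<comment> \<open>The competitor is only locally p-integrable, so its finiteness along curves
      has to come from \<open>curve_finite_Lp_loc\<close>.\<close>
    have "k' \<in> Lp_loc p M"
    proof -
      have "(\<integral>\<^sup>+y\<in>ball x r. ennpowr (k' y) p \<partial>M) = (\<integral>\<^sup>+y\<in>ball x r. ennpowr (k y) p \<partial>M)" for x r
        by (rule nn_integral_cong_AE) (use k'(2) in eventually_elim, simp)
      then show ?thesis using k borel_measurable_M[OF km] by (simp add: Lp_loc_def)
    qed
    then have cf: "curve_finite p M k'" by (rule curve_finite_Lp_loc[OF km])
    have wm: "wug p M u (\<lambda>x. min (G x) (k' x))"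
      by (rule wug_inf[OF wG k'(1) curve_finite_energy[OF Gm Gfin] cf])
    have le: "energy p M (\<lambda>x. min (G x) (k' x)) \<le> energy p M G"
      by (rule energy_mono[OF p_pos]) auto
    have "I \<le> energy p M (\<lambda>x. min (G x) (k' x))"
      unfolding I_def using wm le Gfin by (intro INF_lower) (auto dest: le_less_trans)
    with GI have "energy p M G \<le> energy p M (\<lambda>x. min (G x) (k' x))" by (rule order_trans)
    then have "AE x in M. G x = min (G x) (k' x)"
      by (intro energy_eq_AE[OF _ _ _ Gfin])
         (use borel_measurable_M[OF wug_borel[OF wm]] borel_measurable_M[OF Gm] in auto)
    then show "AE x in M. G x \<le> k x" using k'(2) by eventually_elim (simp add: min_def split: if_splits)
  qed
  from exI[of "is_minimal_weak_upper_gradient p M (\<lambda>x. ereal (u x))", OF this] show ?thesis .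
qed

text \<open>Along a curve the parameters outside \<open>\<Omega>\<close> form a closed set on which
  \<open>u\<close> is 0. This reconciles the capacity, which integrates over
  \<open>\<Omega>\<close>, with energies over the whole space.\<close>

lemma wug_vanish:
  assumes w: "wug p M u g" and Om: "open \<Omega>" and z: "\<And>x. x \<notin> \<Omega> \<Longrightarrow> u x = 0"
  shows "wug p M u (\<lambda>x. g x * indicator \<Omega> x)"
proof -
  note [measurable] = wug_borel[OF w]
  have [measurable]: "\<Omega> \<in> sets borel" using Om by simp
  have "ae_curve p M (curve_bound u (\<lambda>x. g x * indicator \<Omega> x))"
  proof (rule ae_curve_mono[OF wug_ae[OF w]])
    fix \<gamma> :: "real \<Rightarrow> 'a" and l
    assume c: "arclength_curve UNIV \<gamma> l"
      and v: "curve_bound u g \<gamma> l"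
    let ?\<gamma> = "\<lambda>x. \<gamma> (max 0 (min l x))"
    have cont: "continuous_on {0..l} \<gamma>" by (rule arclength_curve_continuous[OF c])
    have l: "0 \<le> l" using c by (auto simp: arclength_curve_def)
    have [measurable]: "?\<gamma> \<in> borel_measurable borel"
      by (rule clamp_curve_measurable[OF cont l])
    have cc: "continuous_on UNIV ?\<gamma>"
      by (rule continuous_on_compose2[OF cont]) (use l in "auto intro!: continuous_intros")
    have cl: "closed (?\<gamma> -` (- \<Omega>))"
      using continuous_closed_vimage[of "- \<Omega>" ?\<gamma>] cc Om by (simp add: continuous_on_eq_continuous_within closed_def)
    have v': "curve_bound u g ?\<gamma> l" using v by (simp add: clamp_var_bound)
    have "var_bound (\<lambda>x. u (?\<gamma> x)) (\<lambda>x. if x \<in> ?\<gamma> -` (- \<Omega>) then 0 else g (?\<gamma> x)) l"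
      by (rule var_bound_vanish[OF _ v' cl]) (use z in auto)
    then have "curve_bound u (\<lambda>x. g x * indicator \<Omega> x) ?\<gamma> l"
      by (rule var_bound_mono) auto
    then show "curve_bound u (\<lambda>x. g x * indicator \<Omega> x) \<gamma> l"
      using clamp_var_bound[of u \<gamma> l "\<lambda>x. g x * indicator \<Omega> x"] by simp
  qed
  then show ?thesis by (simp add: wug_def)
qed

text \<open>Along a curve with finite integrals both functions are continuous, so the one-variable
  results apply. On the space nothing makes the switched gradient Borel, hence the free Borel
  majorant \<open>k\<close>.\<close>

lemma wug_max_min:
  assumes w1: "wug p M u g" and w2: "wug p M v h" and f1: "curve_finite p M g" and f2: "curve_finite p M h"
    and k: "k \<in> borel_measurable borel"
  shows "(\<And>x. (if v x \<le> u x then g x else h x) \<le> k x) \<Longrightarrow> wug p M (\<lambda>x. max (u x) (v x)) k"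
    and "(\<And>x. (if u x \<le> v x then g x else h x) \<le> k x) \<Longrightarrow> wug p M (\<lambda>x. min (u x) (v x)) k"
proof -
  let ?Max = "curve_bound (\<lambda>x. max (u x) (v x)) (\<lambda>x. if v x \<le> u x then g x else h x)"
  let ?Min = "curve_bound (\<lambda>x. min (u x) (v x)) (\<lambda>x. if u x \<le> v x then g x else h x)"
  note [measurable] = wug_borel[OF w1] wug_borel[OF w2]
  have "ae_curve p M (\<lambda>\<gamma> l.
     ?Max \<gamma> l \<and>
     ?Min \<gamma> l)"
  proof (rule ae_curve_mono[OF ae_curve_conj[OF ae_curve_conj[OF wug_ae[OF w1] wug_ae[OF w2]]
        ae_curve_conj[OF f1[unfolded curve_finite_def] f2[unfolded curve_finite_def]]]], elim conjE)
    fix \<gamma> :: "real \<Rightarrow> 'a" and l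
    assume c: "arclength_curve UNIV \<gamma> l"
      and vb: "curve_bound u g \<gamma> l" "curve_bound v h \<gamma> l"
      and f: "curve_integral g \<gamma> l < \<infinity>" "curve_integral h \<gamma> l < \<infinity>"
    let ?\<gamma> = "\<lambda>x. \<gamma> (max 0 (min l x))"
    have [measurable]: "?\<gamma> \<in> borel_measurable borel"
      by (rule clamp_curve_measurable[OF arclength_curve_continuous[OF c]]) (use c in "auto simp: arclength_curve_def")
    have vb': "curve_bound u g ?\<gamma> l" "curve_bound v h ?\<gamma> l"
      using vb by (simp_all add: clamp_var_bound)
    have f': "seg_integral (\<lambda>x. g (?\<gamma> x)) 0 l < \<infinity>" "seg_integral (\<lambda>x. h (?\<gamma> x)) 0 l < \<infinity>"
      using f unfolding clamp_integral by auto
    have "?Max ?\<gamma> l"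
      by (rule var_bound_max[OF _ _ f' vb']) measurable
    moreover have "?Min ?\<gamma> l"
      by (rule var_bound_min[OF _ _ f' vb']) measurable
    ultimately show "?Max \<gamma> l \<and>
      ?Min \<gamma> l"
      using clamp_var_bound[of "\<lambda>x. max (u x) (v x)" \<gamma> l "\<lambda>x. if v x \<le> u x then g x else h x"]
        clamp_var_bound[of "\<lambda>x. min (u x) (v x)" \<gamma> l "\<lambda>x. if u x \<le> v x then g x else h x"] by simp
  qed
  note ae = this
  show "wug p M (\<lambda>x. max (u x) (v x)) k" if le: "\<And>x. (if v x \<le> u x then g x else h x) \<le> k x"
    unfolding wug_def
    by (rule conjI[OF k ae_curve_mono[OF ae]], elim conjE, rule var_bound_mono, assumption, rule le)
  show "wug p M (\<lambda>x. min (u x) (v x)) k" if le: "\<And>x. (if u x \<le> v x then g x else h x) \<le> k x"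
    unfolding wug_def
    by (rule conjI[OF k ae_curve_mono[OF ae]], elim conjE, rule var_bound_mono, assumption, rule le)
qed

lemma wug_lipschitz_compose:
  assumes w: "wug p M u g" and L: "0 \<le> L" "\<And>a b. \<bar>F a - F b\<bar> \<le> L * \<bar>a - b\<bar>"
  shows "wug p M (\<lambda>x. F (u x)) (\<lambda>x. ennreal L * g x)"
proof -
  note gm[measurable] = wug_borel[OF w]
  have "ae_curve p M (curve_bound (\<lambda>x. F (u x)) (\<lambda>x. ennreal L * g x))"
  proof (rule ae_curve_mono[OF wug_ae[OF w]])
    fix \<gamma> :: "real \<Rightarrow> 'a" and l
    assume c: "arclength_curve UNIV \<gamma> l"
      and v: "curve_bound u g \<gamma> l"
    show "curve_bound (\<lambda>x. F (u x)) (\<lambda>x. ennreal L * g x) \<gamma> l"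
      unfolding var_bound_def
    proof (intro allI impI)
      fix s t :: real assume *: "0 \<le> s" "s \<le> t" "t \<le> l"
      have "ennreal \<bar>F (u (\<gamma> t)) - F (u (\<gamma> s))\<bar> \<le> ennreal (L * \<bar>u (\<gamma> t) - u (\<gamma> s)\<bar>)"
        by (intro ennreal_leI L)
      also have "\<dots> = ennreal L * ennreal \<bar>u (\<gamma> t) - u (\<gamma> s)\<bar>" using L(1) by (simp add: ennreal_mult)
      also have "\<dots> \<le> ennreal L * (seg_integral (\<lambda>x. g (\<gamma> x)) s t)"
        by (intro mult_left_mono var_boundD[OF v *]) auto
      also have "\<dots> = seg_integral (\<lambda>x. (ennreal L * g (\<gamma> x))) s t"
        unfolding mult.assoc
        by (intro nn_integral_cmult[symmetric])
           (use curve_integrand_measurable[OF arclength_curve_continuous[OF c] gm *(1,3)] in simp)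
      finally show "ennreal \<bar>F (u (\<gamma> t)) - F (u (\<gamma> s))\<bar> \<le> seg_integral (\<lambda>x. (ennreal L * g (\<gamma> x))) s t" .
    qed
  qed
  then show ?thesis by (simp add: wug_def)
qed

lemma wug_lipschitz:
  assumes L: "0 \<le> L" "\<And>x y. \<bar>u x - u y\<bar> \<le> L * dist x y"
  shows "wug p M u (\<lambda>_. ennreal L)"
proof -
  have "ae_curve p M (curve_bound u (\<lambda>x. ennreal L))"
  \<comment> \<open>The choice \<open>\<rho> = 0\<close> means that the bound holds along every
    curve.\<close>
  proof (rule ae_curveI[of "\<lambda>_. 0"])
    fix \<gamma> :: "real \<Rightarrow> 'a" and l
    assume c: "arclength_curve UNIV \<gamma> l"
    show "curve_bound u (\<lambda>x. ennreal L) \<gamma> l"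
      unfolding var_bound_def
    proof (intro allI impI)
      fix s t :: real assume *: "0 \<le> s" "s \<le> t" "t \<le> l"
      have "\<bar>u (\<gamma> t) - u (\<gamma> s)\<bar> \<le> L * dist (\<gamma> t) (\<gamma> s)" by (rule L)
      also have "\<dots> \<le> L * (t - s)"
        using arclength_curve_dist_le[OF c, of t s] * by (intro mult_left_mono L) auto
      finally have "ennreal \<bar>u (\<gamma> t) - u (\<gamma> s)\<bar> \<le> ennreal (L * (t - s))" by (rule ennreal_leI)
      also have "\<dots> = seg_integral (\<lambda>x. ennreal L) s t"
        using * L(1) by (simp add: nn_integral_cmult_indicator ennreal_mult)
      finally show "ennreal \<bar>u (\<gamma> t) - u (\<gamma> s)\<bar> \<le> seg_integral (\<lambda>x. ennreal L) s t" .
    qed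
  qed auto
  then show ?thesis by (simp add: wug_def)
qed

text \<open>A competitor for \<open>cap_bounded\<close> in real-valued form, bundled with a Borel
  gradient and with the energy taken over the whole space. For open \<open>\<Omega>\<close> the
  infimum of these energies is \<open>cap_bounded\<close>, by the two lemmas that follow.\<close>

definition admissible :: "'a set \<Rightarrow> 'a set \<Rightarrow> ('a \<Rightarrow> real) \<Rightarrow> ('a \<Rightarrow> ennreal) \<Rightarrow> bool" where
  "admissible E \<Omega> u g \<longleftrightarrow> u \<in> borel_measurable M \<and> (\<forall>x. 0 \<le> u x \<and> u x \<le> 1) \<and> (\<forall>x\<in>E. u x = 1) \<and>
     (\<forall>x. x \<notin> \<Omega> \<longrightarrow> u x = 0) \<and> (\<integral>\<^sup>+x. ennreal (u x powr p) \<partial>M) < \<infinity> \<and>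
     wug p M u g \<and> energy p M g < \<infinity>"

text \<open>The minimal gradient exists and is at most \<open>g\<close> almost everywhere, so its
  integral over \<open>\<Omega>\<close> is at most the energy of \<open>g\<close>.\<close>

lemma cap_bounded_le_energy:
  assumes "admissible E \<Omega> u g" shows "cap_bounded p M E \<Omega> \<le> energy p M g"
proof -
  let ?f = "\<lambda>x. ereal (u x)"
  have u: "u \<in> borel_measurable M" "\<And>x. 0 \<le> u x" "\<And>x. u x \<le> 1" "\<And>x. x \<in> E \<Longrightarrow> u x = 1"
    "\<And>x. x \<notin> \<Omega> \<Longrightarrow> u x = 0" "(\<integral>\<^sup>+x. ennreal (u x powr p) \<partial>M) < \<infinity>" and
    g: "wug p M u g" "energy p M g < \<infinity>"
    using assms unfolding admissible_def by auto
  note gm = borel_measurable_M[OF wug_borel[OF g(1)]]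
  have wg: "weak_upper_gradient p M ?f g" by (rule weak_upper_gradient_of_wug[OF g(1)])
  have eq: "ennpowr (e2ennreal \<bar>?f x\<bar>) p = ennreal (u x powr p)" for x
    using u(2)[of x] by (simp add: e2ennreal_ereal ennpowr_ennreal)
  have "(INF g \<in> {g. weak_upper_gradient p M ?f g}. energy p M g) < \<infinity>"
    using wg g(2) by (auto simp: INF_less_iff)
  then have "newtonian_energy p M ?f < \<infinity>"
    using u(6) unfolding newtonian_energy_def eq by simp
  then have N: "?f \<in> newtonian_space p M"
    using u(1) by (simp add: newtonian_space_def)
  have bd: "\<forall>x. indicator E x \<le> ?f x \<and> ?f x \<le> indicator \<Omega> x"
  proof
    fix x have "x \<in> E \<Longrightarrow> x \<in> \<Omega>" using u(4,5)[of x] by auto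
    then show "indicator E x \<le> ?f x \<and> ?f x \<le> indicator \<Omega> x"
      using u(2-5)[of x] by (auto split: split_indicator simp: zero_ereal_def one_ereal_def)
  qed
  let ?m = "minimal_weak_upper_gradient p M ?f"
  have "is_minimal_weak_upper_gradient p M ?f ?m"
    unfolding minimal_weak_upper_gradient_def by (rule someI_ex[OF minimal_wug_exists[OF g]])
  then have "AE x in M. ?m x \<le> g x"
    using wg Lp_loc_energy[OF gm g(2)] unfolding is_minimal_weak_upper_gradient_def by auto
  then have "(\<integral>\<^sup>+x\<in>\<Omega>. ennpowr (?m x) p \<partial>M) \<le> energy p M g"
    by (intro nn_integral_mono_AE, eventually_elim)
       (auto split: split_indicator intro: ennpowr_mono p_pos)
  then show ?thesis
    unfolding cap_bounded_def by (rule INF_lower2[rotated, where i="?f"]) (use N bd in auto)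
qed

text \<open>The bounds by indicators make the extended-valued competitor real-valued. Its minimal
  gradient may be set to zero outside the open set \<open>\<Omega>\<close>, which turns the integral
  over \<open>\<Omega>\<close> into an energy.\<close>

lemma cap_bounded_lessE:
  assumes "cap_bounded p M E \<Omega> < c" "open \<Omega>"
  obtains u g where "admissible E \<Omega> u g" "energy p M g < c"
proof -
  obtain f where f: "f \<in> newtonian_space p M" "\<And>x. indicator E x \<le> f x" "\<And>x. f x \<le> indicator \<Omega> x"
    and fc: "(\<integral>\<^sup>+x\<in>\<Omega>. ennpowr (minimal_weak_upper_gradient p M f x) p \<partial>M) < c"
    using assms(1) unfolding cap_bounded_def by (auto simp: INF_less_iff)
  define u where "u x = real_of_ereal (f x)" for x
  have fb: "0 \<le> f x" "f x \<le> 1" for x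
    by (rule order_trans[OF _ f(2)] order_trans[OF f(3)]; simp split: split_indicator)+
  have fu: "f = (\<lambda>x. ereal (u x))"
  proof
    fix x show "f x = ereal (u x)" using fb[of x] by (cases "f x") (auto simp: u_def)
  qed
  have ub: "0 \<le> u x" "u x \<le> 1" for x using fb[of x] by (auto simp: fu)
  have uE: "u x = 1" if "x \<in> E" for x using f(2)[of x] ub[of x] that by (simp add: fu)
  have uO: "u x = 0" if "x \<notin> \<Omega>" for x using f(3)[of x] ub[of x] that by (simp add: fu)
  have um: "u \<in> borel_measurable M" using f(1) unfolding u_def newtonian_space_def
    by (intro borel_measurable_real_of_ereal) simp
  have eq: "ennpowr (e2ennreal \<bar>f x\<bar>) p = ennreal (u x powr p)" for x
    using ub[of x] by (simp add: fu e2ennreal_ereal ennpowr_ennreal)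
  have ne: "newtonian_energy p M f < \<infinity>" using f(1) by (simp add: newtonian_space_def)
  then have uL: "(\<integral>\<^sup>+x. ennreal (u x powr p) \<partial>M) < \<infinity>"
    unfolding newtonian_energy_def eq by simp
  obtain g0 where "weak_upper_gradient p M f g0" "energy p M g0 < \<infinity>"
    using ne unfolding newtonian_energy_def by (auto simp: INF_less_iff)
  then obtain g1 where "wug p M u g1" "AE x in M. g1 x = g0 x"
    unfolding fu using wug_of_weak_upper_gradient by blast
  moreover then have "energy p M g1 = energy p M g0"
    by (intro nn_integral_cong_AE) (auto elim: eventually_mono)
  ultimately have "\<exists>g. is_minimal_weak_upper_gradient p M f g"
    unfolding fu using \<open>energy p M g0 < \<infinity>\<close> by (intro minimal_wug_exists[of _ g1]) auto
  then have "is_minimal_weak_upper_gradient p M f (minimal_weak_upper_gradient p M f)"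
    unfolding minimal_weak_upper_gradient_def by (rule someI_ex)
  then have "weak_upper_gradient p M f (minimal_weak_upper_gradient p M f)"
    by (simp add: is_minimal_weak_upper_gradient_def)
  then obtain m where m: "wug p M u m" "AE x in M. m x = minimal_weak_upper_gradient p M f x"
    using wug_of_weak_upper_gradient[of u "minimal_weak_upper_gradient p M f"] unfolding fu by blast
  have w: "wug p M u (\<lambda>x. m x * indicator \<Omega> x)"
    by (rule wug_vanish[OF m(1) assms(2) uO])
  have "energy p M (\<lambda>x. m x * indicator \<Omega> x) = (\<integral>\<^sup>+x\<in>\<Omega>. ennpowr (minimal_weak_upper_gradient p M f x) p \<partial>M)"
    by (rule nn_integral_cong_AE) (use m(2) in eventually_elim, auto split: split_indicator)
  with fc have e: "energy p M (\<lambda>x. m x * indicator \<Omega> x) < c" by simp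
  show thesis
  proof (rule that)
    show "admissible E \<Omega> u (\<lambda>x. m x * indicator \<Omega> x)"
      unfolding admissible_def using um ub uE uO uL w e by (auto intro: less_le_trans)
  qed (rule e)
qed

end

section \<open>Lower semicontinuous majorants\<close>

definition lsc :: "('a::topological_space \<Rightarrow> ennreal) \<Rightarrow> bool" where
  "lsc g \<longleftrightarrow> (\<forall>c. open {x. c < g x})"

lemma lsc_borel: "lsc g \<Longrightarrow> g \<in> borel_measurable borel"
  by (rule borel_measurableI_greater) (auto simp: lsc_def)

lemma lsc_liminf:
  assumes "lsc g" "X \<longlonglongrightarrow> x" shows "g x \<le> liminf (\<lambda>n. g (X n))"
  unfolding le_Liminf_iff
proof (intro allI impI)
  fix c assume "c < g x"
  then have "x \<in> {x. c < g x}" "open {x. c < g x}" using assms(1) by (auto simp: lsc_def)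
  with assms(2) have "eventually (\<lambda>n. X n \<in> {x. c < g x}) sequentially" by (metis topological_tendstoD)
  then show "eventually (\<lambda>n. c < g (X n)) sequentially" by simp
qed

lemma suminf_geometric_half: "0 \<le> a \<Longrightarrow> (\<Sum>i. ennreal (a * (1/2) ^ i)) = ennreal (2 * a)"
  by (subst suminf_ennreal2) (auto intro!: summable_mult simp: suminf_mult suminf_geometric)

lemma ennreal_less_add:
  assumes "(a::ennreal) < c" obtains e where "0 < (e::real)" "a + ennreal e < c"
proof -
  obtain z where z: "a < z" "z < c" using dense[OF assms] by blast
  then obtain x y where xy: "0 \<le> x" "a = ennreal x" "0 \<le> y" "z = ennreal y"
    by (cases a; cases z) auto
  have "x < y" using z xy by (simp add: ennreal_less_iff)
  then show thesis using z xy by (intro that[of "y - x"]) (auto simp flip: ennreal_plus)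
qed

context proper_mm_space
begin

text \<open>Approximating from inside and outside at once is symmetric under complements, so the
  approximable sets form a sigma-algebra containing the open sets. The finite measure of
  \<open>B\<close> permits continuity from above.\<close>

lemma borel_approx:
  assumes A: "A \<in> sets borel" and B: "B \<in> sets borel" "emeasure M B < \<infinity>" and e: "0 < (e::real)"
  shows "\<exists>U C. open U \<and> closed C \<and> C \<subseteq> A \<and> A \<subseteq> U \<and> emeasure M ((U - C) \<inter> B) < ennreal e"
proof -
  have lim: "\<exists>n. emeasure M (D n) < ennreal e"
    if D: "\<And>n::nat. D n \<in> sets borel" "\<And>n. D n \<subseteq> B" "decseq D" "emeasure M (\<Inter>n. D n) < ennreal e" for D e
  proof -
    have "emeasure M (D n) \<le> emeasure M B" for n
      by (intro emeasure_mono borel_sets_M B D)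
    then have "emeasure M (D n) \<noteq> \<infinity>" for n using B(2) by (metis infinity_ennreal_def not_le)
    then have "(\<lambda>n. emeasure M (D n)) \<longlonglongrightarrow> emeasure M (\<Inter>n. D n)"
      by (intro Lim_emeasure_decseq) (use D borel_sets_M in auto)
    from order_tendstoD(2)[OF this D(4)] show ?thesis by (auto simp: eventually_sequentially)
  qed
  have "A \<in> sigma_sets UNIV {S. open S}"
    using A by (simp add: borel_def)
  then show ?thesis using e
  proof (induction A arbitrary: e rule: sigma_sets.induct)
    case (Basic A)
    then have A: "open A" by simp
    show ?case
    \<comment> \<open>By convention \<open>infdist\<close> to the empty set is 0, so the whole space
      is treated apart. Any other open set is exhausted by the closed sets of points at distance at
      least \<open>1 / real (Suc n)\<close> from its complement.\<close>
    proof (cases "A = UNIV")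
      case True
      then show ?thesis using Basic by (intro exI[of _ UNIV]) auto
    next
      case False
      then have ne: "- A \<noteq> {}" by auto
      define C where "C n = {x. 1 / real (Suc n) \<le> infdist x (- A)}" for n
      have cC: "closed (C n)" for n
        unfolding C_def by (intro closed_Collect_le continuous_intros)
      have CA: "C n \<subseteq> A" for n
      proof
        fix x assume x: "x \<in> C n"
        have "0 < 1 / real (Suc n)" by simp
        then have "0 < infdist x (- A)" using x unfolding C_def mem_Collect_eq by (rule less_le_trans)
        then show "x \<in> A" by (metis ComplI infdist_zero less_irrefl)
      qed
      have "(\<Inter>n. (A - C n) \<inter> B) = {}"
      proof -
        have "\<exists>n. x \<in> C n" if "x \<in> A" for x
        proof -
          have "closed (- A)" using A by auto
          then have "infdist x (- A) \<noteq> 0" using in_closed_iff_infdist_zero[OF _ ne] that by auto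
          then have "0 < infdist x (- A)" using infdist_nonneg[of x "- A"] by linarith
          then obtain n where "1 / real (Suc n) < infdist x (- A)"
            by (metis inverse_eq_divide reals_Archimedean)
          then show ?thesis by (auto simp: C_def intro: less_imp_le)
        qed
        then show ?thesis by blast
      qed
      moreover have "decseq (\<lambda>n. (A - C n) \<inter> B)"
      proof (rule decseq_SucI)
        fix n
        have "1 / real (Suc (Suc n)) \<le> 1 / real (Suc n)" by (simp add: field_simps)
        then have "C n \<subseteq> C (Suc n)" unfolding C_def by (auto intro: order_trans)
        then show "(A - C (Suc n)) \<inter> B \<subseteq> (A - C n) \<inter> B" by auto
      qed
      ultimately have "\<exists>n. emeasure M ((A - C n) \<inter> B) < ennreal e"
        by (intro lim) (use A cC B Basic in auto)
      then show ?thesis using A cC CA by blast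
    qed
  next
    case Empty
    then show ?case by (intro exI[of _ "{}"]) auto
  next
    case (Compl A)
    obtain U C where UC: "open U" "closed C" "C \<subseteq> A" "A \<subseteq> U" "emeasure M ((U - C) \<inter> B) < ennreal e"
      using Compl.IH[OF Compl.prems] by (elim exE conjE)
    have "(- C) - (- U) = U - C" by auto
    then show ?case using UC
      by (intro exI[of _ "- C"] exI[of _ "- U"]) auto
  next
    case (Union A)
    \<comment> \<open>An infinite union of closed sets need not be closed, so only finitely many
      \<open>C i\<close> will be kept. The tolerances add up to \<open>e / 2\<close>, which leaves
      room for that cut.\<close>
    have "\<exists>U C. open U \<and> closed C \<and> C \<subseteq> A i \<and> A i \<subseteq> U \<and> emeasure M ((U - C) \<inter> B) < ennreal (e / 4 * (1/2) ^ i)" for i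
      by (rule Union.IH) (use Union.prems in auto)
    then obtain U C where UC: "\<And>i. open (U i)" "\<And>i. closed (C i)" "\<And>i. C i \<subseteq> A i" "\<And>i. A i \<subseteq> U i"
      "\<And>i. emeasure M ((U i - C i) \<inter> B) < ennreal (e / 4 * (1/2) ^ i)" by metis
    let ?U = "\<Union>i. U i"
    let ?C = "\<lambda>n. \<Union>i<n. C i"
    have Ub[measurable]: "U i \<in> sets borel" "C i \<in> sets borel" "B \<in> sets borel" for i using UC B by auto
    have "(\<Inter>n. (?U - ?C n) \<inter> B) \<subseteq> (\<Union>i. (U i - C i) \<inter> B)"
    proof
      fix x assume x: "x \<in> (\<Inter>n. (?U - ?C n) \<inter> B)"
      then obtain i where "x \<in> U i" "x \<in> B" by blast
      moreover have "x \<notin> C i" using x by (auto dest!: spec[of _ "Suc i"])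
      ultimately show "x \<in> (\<Union>i. (U i - C i) \<inter> B)" by blast
    qed
    then have "emeasure M (\<Inter>n. (?U - ?C n) \<inter> B) \<le> emeasure M (\<Union>i. (U i - C i) \<inter> B)"
      by (intro emeasure_mono borel_sets_M) measurable
    also have "\<dots> \<le> (\<Sum>i. emeasure M ((U i - C i) \<inter> B))"
      by (rule emeasure_subadditive_countably) (auto intro!: borel_sets_M)
    also have "\<dots> \<le> (\<Sum>i. ennreal (e / 4 * (1/2) ^ i))"
      by (intro suminf_le less_imp_le UC(5)) auto
    also have "\<dots> = ennreal (e / 2)" by (subst suminf_geometric_half) (use Union.prems in auto)
    also have "ennreal (e / 2) < ennreal e" using Union.prems by (simp add: ennreal_less_iff)
    finally have "\<exists>n. emeasure M ((?U - ?C n) \<inter> B) < ennreal e"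
      by (intro lim) (auto intro!: decseq_SucI)
    then obtain n where n: "emeasure M ((?U - ?C n) \<inter> B) < ennreal e" ..
    show ?case
    proof (intro exI conjI)
      show "open ?U" using UC(1) by blast
      show "closed (?C n)" using UC(2) by (intro closed_UN) auto
      show "?C n \<subseteq> (\<Union>i. A i)" "(\<Union>i. A i) \<subseteq> ?U" using UC(3,4) by blast+
    qed (rule n)
  qed
qed

text \<open>Only balls are known to have finite measure, so the n-th neighbourhood is used inside
  the n-th ball; the errors \<open>e / 2 * (1/2) ^ n\<close> add up to \<open>e\<close>.\<close>

lemma outer_regular:
  assumes A: "A \<in> sets borel" and e: "0 < (e::real)"
  obtains U where "open U" "A \<subseteq> U" "emeasure M (U - A) \<le> ennreal e"
proof -
  fix x0 :: 'a
  let ?B = "\<lambda>n. ball x0 (real (Suc n))"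
  have "\<exists>U C. open U \<and> closed C \<and> C \<subseteq> A \<and> A \<subseteq> U \<and> emeasure M ((U - C) \<inter> ?B n) < ennreal (e / 2 * (1/2) ^ n)" for n
    by (rule borel_approx[OF A]) (use ball_finite e in auto)
  then obtain U C where UC: "\<And>i. open (U i)" "\<And>i. closed (C i)" "\<And>i. C i \<subseteq> A" "\<And>i. A \<subseteq> U i"
      "\<And>i. emeasure M ((U i - C i) \<inter> ?B i) < ennreal (e / 2 * (1/2) ^ i)" by metis
  have [measurable]: "U i \<in> sets borel" "C i \<in> sets borel" "?B i \<in> sets borel" "A \<in> sets borel" for i using UC A by auto
  let ?U = "\<Union>n. U n \<inter> ?B n"
  show thesis
  proof (rule that)
    show "open ?U" using UC(1) by (intro open_UN) auto
    show "A \<subseteq> ?U"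
    proof
      fix x assume "x \<in> A"
      obtain n where "dist x0 x < real n" using reals_Archimedean2 by blast
      then have "x \<in> ?B n" by auto
      with \<open>x \<in> A\<close> show "x \<in> ?U" using UC(4) by blast
    qed
    have "emeasure M (?U - A) \<le> emeasure M (\<Union>i. (U i - C i) \<inter> ?B i)"
      by (intro emeasure_mono borel_sets_M, use UC(3) in blast) measurable
    also have "\<dots> \<le> (\<Sum>i. emeasure M ((U i - C i) \<inter> ?B i))"
      by (rule emeasure_subadditive_countably) (auto intro!: borel_sets_M)
    also have "\<dots> \<le> (\<Sum>i. ennreal (e / 2 * (1/2) ^ i))"
      by (intro suminf_le less_imp_le UC(5)) auto
    also have "\<dots> = ennreal (e)" by (subst suminf_geometric_half) (use e in auto)
    finally show "emeasure M (?U - A) \<le> ennreal e" .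
  qed
qed

text \<open>The Vitali--Caratheodory theorem, from \<open>f = sup\<^sub>q q \<cdot> \<chi>\<^bsub>{f > q}\<^esub>\<close> over the rationals \<open>q\<close>.\<close>

lemma lsc_majorant:
  fixes f :: "'a \<Rightarrow> ennreal"
  assumes fm[measurable]: "f \<in> borel_measurable borel" and e: "0 < (e::real)"
  obtains G where "lsc G" "\<And>x. f x \<le> G x" "(\<integral>\<^sup>+x. G x \<partial>M) \<le> (\<integral>\<^sup>+x. f x \<partial>M) + ennreal e"
proof -
  \<comment> \<open>An enumeration of the nonnegative rationals, the negative ones being sent to
    0.\<close>
  define q :: "nat \<Rightarrow> real" where "q n = max 0 (real_of_rat (from_nat n))" for n
  have q0: "0 \<le> q n" for n by (simp add: q_def)
  define A where "A n = {x. ennreal (q n) < f x}" for n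
  have Am[measurable]: "A n \<in> sets borel" for n unfolding A_def by measurable
  \<comment> \<open>Dividing by \<open>1 + q n\<close> keeps \<open>q n\<close> times the excess
    measure summable although \<open>q\<close> is unbounded.\<close>
  have "\<exists>U. open U \<and> A n \<subseteq> U \<and> emeasure M (U - A n) \<le> ennreal (e / 2 * (1/2) ^ n / (1 + q n))" for n
  proof -
    have pos: "0 < e / 2 * (1/2) ^ n / (1 + q n)"
      using e q0[of n] by (intro divide_pos_pos) auto
    show ?thesis by (rule outer_regular[OF Am[of n] pos]) blast
  qed
  then obtain U where U: "\<And>n. open (U n)" "\<And>n. A n \<subseteq> U n"
    "\<And>n. emeasure M (U n - A n) \<le> ennreal (e / 2 * (1/2) ^ n / (1 + q n))" by metis
  have Um[measurable]: "U n \<in> sets borel" for n using U(1) by auto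
  define G where "G x = (SUP n. ennreal (q n) * indicator (U n) x)" for x
  \<comment> \<open>The cost of enlarging every \<open>A n\<close> to \<open>U n\<close>:
    \<open>G\<close> exceeds \<open>f\<close> by at most \<open>h\<close>.\<close>
  define h where "h x = (\<Sum>n. ennreal (q n) * indicator (U n - A n) x)" for x
  have [measurable]: "f \<in> borel_measurable M" "h \<in> borel_measurable M"
    unfolding h_def using fm by (auto intro!: borel_measurable_M)
  have lG: "lsc G" unfolding lsc_def
  proof
    fix c
    have "{x. c < G x} = (\<Union>n\<in>{n. c < ennreal (q n)}. U n)"
    proof (intro equalityI subsetI)
      fix x assume "x \<in> {x. c < G x}"
      then obtain n where n: "c < ennreal (q n) * indicator (U n) x" by (auto simp: G_def less_SUP_iff)
      then have "x \<in> U n" by (cases "x \<in> U n") auto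
      with n show "x \<in> (\<Union>n\<in>{n. c < ennreal (q n)}. U n)" by auto
    next
      fix x assume "x \<in> (\<Union>n\<in>{n. c < ennreal (q n)}. U n)"
      then obtain n where "c < ennreal (q n)" "x \<in> U n" by blast
      then have "c < ennreal (q n) * indicator (U n) x" by simp
      then show "x \<in> {x. c < G x}" unfolding G_def mem_Collect_eq less_SUP_iff by blast
    qed
    then show "open {x. c < G x}" using U(1) by auto
  qed
  have fG: "f x \<le> G x" for x
  proof (rule dense_le)
    fix y assume y: "y < f x"
    then obtain z where z: "y < z" "z < f x" using dense by blast
    then obtain a where a: "0 \<le> a" "y = ennreal a" by (cases y) auto
    obtain b where b: "0 \<le> b" "z = ennreal b" using z by (cases z) auto
    have "a < b" using z a b by (simp add: ennreal_less_iff)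
    then obtain r where r: "a < real_of_rat r" "real_of_rat r < b" using of_rat_dense by blast
    define n where "n = to_nat r"
    have qn: "q n = real_of_rat r" using r a by (simp add: q_def n_def)
    have "ennreal (q n) < f x"
      by (rule order.strict_trans[OF _ z(2)]) (use b r qn q0[of n] in "simp add: ennreal_less_iff")
    then have "x \<in> U n" using U(2) by (auto simp: A_def)
    then have "y \<le> ennreal (q n) * indicator (U n) x"
      using r a qn by (simp add: ennreal_leI)
    also have "\<dots> \<le> G x" unfolding G_def by (rule SUP_upper) simp
    finally show "y \<le> G x" .
  qed
  have Gh: "G x \<le> f x + h x" for x
    unfolding G_def
  proof (rule SUP_least)
    fix n
    show "ennreal (q n) * indicator (U n) x \<le> f x + h x"
    proof (cases "x \<in> U n - A n")
      case True
      then have "ennreal (q n) * indicator (U n) x = (\<Sum>n\<in>{n}. ennreal (q n) * indicator (U n - A n) x)" by simp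
      also have "\<dots> \<le> h x" unfolding h_def by (rule sum_le_suminf) auto
      finally show ?thesis by (simp add: add_increasing)
    next
      case False
      then have "ennreal (q n) * indicator (U n) x \<le> f x"
        by (cases "x \<in> U n") (auto simp: A_def)
      then show ?thesis by (simp add: add_increasing2)
    qed
  qed
  have "(\<integral>\<^sup>+x. h x \<partial>M) = (\<Sum>n. \<integral>\<^sup>+x. ennreal (q n) * indicator (U n - A n) x \<partial>M)"
    unfolding h_def by (rule nn_integral_suminf) (auto intro!: borel_measurable_M)
  also have "\<dots> = (\<Sum>n. ennreal (q n) * emeasure M (U n - A n))"
    by (intro suminf_cong nn_integral_cmult_indicator borel_sets_M) measurable
  also have "\<dots> \<le> (\<Sum>n. ennreal (e / 2 * (1/2) ^ n))"
  proof (rule suminf_le)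
    fix n
    have "ennreal (q n) * emeasure M (U n - A n) \<le> ennreal (q n) * ennreal (e / 2 * (1/2) ^ n / (1 + q n))"
      by (intro mult_left_mono U(3)) auto
    also have "\<dots> = ennreal (e / 2 * (1/2) ^ n * (q n / (1 + q n)))"
      using q0[of n] e by (simp flip: ennreal_mult add: mult_ac)
    also have "\<dots> \<le> ennreal (e / 2 * (1/2) ^ n * 1)"
      using q0[of n] e by (intro ennreal_leI mult_left_mono) auto
    finally show "ennreal (q n) * emeasure M (U n - A n) \<le> ennreal (e / 2 * (1/2) ^ n)" by simp
  qed auto
  also have "\<dots> = ennreal (e)" by (subst suminf_geometric_half) (use e in auto)
  finally have he: "(\<integral>\<^sup>+x. h x \<partial>M) \<le> ennreal e" .
  have "(\<integral>\<^sup>+x. G x \<partial>M) \<le> (\<integral>\<^sup>+x. f x + h x \<partial>M)" by (intro nn_integral_mono Gh)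
  also have "\<dots> = (\<integral>\<^sup>+x. f x \<partial>M) + (\<integral>\<^sup>+x. h x \<partial>M)" by (intro nn_integral_add) measurable
  also have "\<dots> \<le> (\<integral>\<^sup>+x. f x \<partial>M) + ennreal e" by (intro add_left_mono he)
  finally show thesis using that lG fG by blast
qed

text \<open>Majorize the p-th power and take the root; the root is an increasing bijection, so
  superlevel sets remain open.\<close>

lemma lsc_majorant_energy:
  fixes g :: "'a \<Rightarrow> ennreal"
  assumes [measurable]: "g \<in> borel_measurable borel" and e: "0 < (e::real)"
  obtains G where "lsc G" "\<And>x. g x \<le> G x" "energy p M G \<le> energy p M g + ennreal e"
proof -
  have "(\<lambda>x. ennpowr (g x) p) \<in> borel_measurable borel" by measurable
  from lsc_majorant[OF this e] obtain H where H: "lsc H" "\<And>x. ennpowr (g x) p \<le> H x"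
    "(\<integral>\<^sup>+x. H x \<partial>M) \<le> energy p M g + ennreal e" by blast
  have pinv: "0 < 1 / p" using p_pos by simp
  show thesis
  proof (rule that)
    show "energy p M (\<lambda>x. ennpowr (H x) (1 / p)) \<le> energy p M g + ennreal e"
      using H(3) p_pos by (simp add: ennpowr_inverse')
    show "g x \<le> ennpowr (H x) (1 / p)" for x
      using ennpowr_mono[OF pinv H(2)[of x]] p_pos by (simp add: ennpowr_inverse)
    have iff: "c < ennpowr (H x) (1 / p) \<longleftrightarrow> ennpowr c p < H x" for c x
      using ennpowr_mono[OF pinv, of "H x" "ennpowr c p"] ennpowr_mono[OF p_pos, of "ennpowr (H x) (1 / p)" c] p_pos
      by (auto simp: ennpowr_inverse ennpowr_inverse' not_le[symmetric])
    show "lsc (\<lambda>x. ennpowr (H x) (1 / p))"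
      using H(1) unfolding lsc_def iff by blast
  qed
qed

text \<open>Dominated convergence along \<open>1 / real (Suc n)\<close>, at the almost all points
  where \<open>f\<close> and \<open>h\<close> are finite. It lets a strict energy bound absorb an
  additional gradient term.\<close>

lemma energy_perturb:
  fixes f h :: "'a \<Rightarrow> ennreal"
  assumes [measurable]: "f \<in> borel_measurable borel" "h \<in> borel_measurable borel"
    and f: "energy p M f < \<infinity>" and h: "energy p M h < \<infinity>" and c: "energy p M f < c"
  obtains \<epsilon> where "0 < (\<epsilon>::real)" "energy p M (\<lambda>x. f x + ennreal \<epsilon> * h x) < c"
proof -
  note [measurable] = borel_measurable_M[OF assms(1)] borel_measurable_M[OF assms(2)]
  let ?w = "\<lambda>x. ennreal (2 powr p) * (ennpowr (f x) p + ennpowr (h x) p)"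
  let ?e = "\<lambda>n. 1 / real (Suc n)"
  let ?F = "\<lambda>n x. ennpowr (f x + ennreal (?e n) * h x) p"
  have fin: "AE x in M. f x < top \<and> h x < top"
  proof -
    have "AE x in M. ennpowr (f x) p \<noteq> \<infinity>" "AE x in M. ennpowr (h x) p \<noteq> \<infinity>"
      by (rule nn_integral_PInf_AE; use f h in auto)+
    then show ?thesis by eventually_elim (auto simp: top.not_eq_extremum)
  qed
  have "(\<lambda>n. energy p M (\<lambda>x. f x + ennreal (?e n) * h x)) \<longlonglongrightarrow> energy p M f"
  proof (rule nn_integral_dominated_convergence[where w="?w"])
    have "(\<integral>\<^sup>+x. ?w x \<partial>M)
        = ennreal (2 powr p) * (energy p M f + energy p M h)"
      by (simp add: nn_integral_cmult nn_integral_add)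
    also have "\<dots> < \<infinity>" using f h by (simp add: ennreal_mult_less_top)
    finally show "(\<integral>\<^sup>+x. ?w x \<partial>M) < \<infinity>" .
    show "AE x in M. ?F n x \<le> ?w x" for n
    proof (rule AE_I2)
      fix x
      have "ennreal (?e n) * h x \<le> 1 * h x" by (intro mult_right_mono) (auto simp: ennreal_le_1)
      then have "?F n x \<le> ennpowr (f x + h x) p"
        by (intro ennpowr_mono p_pos add_left_mono) simp
      also have "\<dots> \<le> ?w x"
        by (rule ennpowr_add_le[OF p_pos])
      finally show "?F n x \<le> ?w x" .
    qed
    show "AE x in M. (\<lambda>n. ?F n x) \<longlonglongrightarrow> ennpowr (f x) p"
      using fin
    proof eventually_elim
      fix x assume x: "f x < top \<and> h x < top"
      have "(\<lambda>n. ennreal (?e n)) \<longlonglongrightarrow> ennreal 0"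
        by (intro tendsto_ennrealI LIMSEQ_Suc[OF lim_1_over_n])
      then have "(\<lambda>n. ennreal (?e n) * h x) \<longlonglongrightarrow> 0 * h x"
        unfolding mult.commute[of _ "h x"] by (intro ennreal_tendsto_cmult) (use x in auto)
      then have "(\<lambda>n. f x + ennreal (?e n) * h x) \<longlonglongrightarrow> f x + 0"
        by (intro tendsto_add tendsto_const) simp
      then show "(\<lambda>n. ?F n x) \<longlonglongrightarrow> ennpowr (f x) p"
        by (intro ennpowr_tendsto p_pos) (use x in auto)
    qed
  qed auto
  from order_tendstoD(2)[OF this c] obtain n where "energy p M (\<lambda>x. f x + ennreal (?e n) * h x) < c"
    by (auto simp: eventually_sequentially)
  then show thesis by (intro that[of "?e n"]) auto
qed

end

section \<open>Arc-length reparametrization\<close>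

text \<open>A recursive form of the sum in \<open>curve_length\<close>, suited to list induction and
  to the insertion of points.\<close>

fun polygon_length :: "(real \<Rightarrow> 'a::metric_space) \<Rightarrow> real list \<Rightarrow> ennreal" where
  "polygon_length \<gamma> (x # y # r) = ennreal (dist (\<gamma> x) (\<gamma> y)) + polygon_length \<gamma> (y # r)"
| "polygon_length \<gamma> _ = 0"

abbreviation partitions :: "real \<Rightarrow> real \<Rightarrow> real list set" where
  "partitions a b \<equiv> {ts. sorted ts \<and> set ts \<subseteq> {a..b}}"

lemma polygon_length_eq:
  "polygon_length \<gamma> ts = (\<Sum>i<length ts - 1. ennreal (dist (\<gamma> (ts ! i)) (\<gamma> (ts ! Suc i))))"
proof (induction \<gamma> ts rule: polygon_length.induct)
  case (1 \<gamma> x y r)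
  then show ?case by (simp add: sum.lessThan_Suc_shift del: sum.lessThan_Suc)
qed auto

lemma curve_length_eq:
  "curve_length \<gamma> a b = (SUP ts\<in>partitions a b. polygon_length \<gamma> ts)"
  unfolding curve_length_def polygon_length_eq ..

lemma polygon_length_le_curve_length:
  "sorted ts \<Longrightarrow> set ts \<subseteq> {a..b} \<Longrightarrow> polygon_length \<gamma> ts \<le> curve_length \<gamma> a b"
  unfolding curve_length_eq by (rule SUP_upper) auto

lemma polygon_length_append:
  "polygon_length \<gamma> (xs @ b # ys) = polygon_length \<gamma> (xs @ [b]) + polygon_length \<gamma> (b # ys)"
  by (induction \<gamma> xs rule: polygon_length.induct) (auto simp: add.assoc neq_Nil_conv)

lemma polygon_length_Cons_le:
  "polygon_length \<gamma> (x # ys) \<le> ennreal (dist (\<gamma> x) (\<gamma> b)) + polygon_length \<gamma> (b # ys)"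
proof (cases ys)
  case (Cons y zs)
  have "ennreal (dist (\<gamma> x) (\<gamma> y)) \<le> ennreal (dist (\<gamma> x) (\<gamma> b)) + ennreal (dist (\<gamma> b) (\<gamma> y))"
    by (simp add: dist_triangle flip: ennreal_plus)
  then show ?thesis using Cons by (auto simp: add.assoc[symmetric] intro: add_right_mono)
qed simp

lemma polygon_length_insert: "polygon_length \<gamma> (xs @ ys) \<le> polygon_length \<gamma> (xs @ b # ys)"
proof (induction \<gamma> xs rule: polygon_length.induct)
  case (1 \<gamma> x y r) then show ?case by (auto intro: add_left_mono)
next
  case ("2_1" \<gamma>)
  then show ?case by (cases ys) (auto simp: add_increasing)
next
  case ("2_2" \<gamma> x)
  then show ?case using polygon_length_Cons_le by auto
qed

lemma polygon_length_map: "polygon_length \<gamma> (map f ts) = polygon_length (\<lambda>t. \<gamma> (f t)) ts"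
  by (induction \<gamma> ts rule: polygon_length.induct) auto

lemma polygon_length_cong:
  "(\<And>t. t \<in> set ts \<Longrightarrow> \<gamma> t = \<eta> t) \<Longrightarrow> polygon_length \<gamma> ts = polygon_length \<eta> ts"
  by (induction \<gamma> ts rule: polygon_length.induct) auto

text \<open>Inserting \<open>b\<close> into a partition never shortens the polygon, and a partition
  containing \<open>b\<close> splits there.\<close>

lemma curve_length_additive:
  assumes "a \<le> b" "b \<le> c"
  shows "curve_length \<gamma> a c = curve_length \<gamma> a b + curve_length \<gamma> b c"
proof (rule antisym)
  show "curve_length \<gamma> a c \<le> curve_length \<gamma> a b + curve_length \<gamma> b c"
    unfolding curve_length_eq[of \<gamma> a c]
  proof (rule SUP_least)
    fix ts assume ts: "ts \<in> partitions a c"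
    define xs where "xs = takeWhile (\<lambda>t. t \<le> b) ts"
    define ys where "ys = dropWhile (\<lambda>t. t \<le> b) ts"
    have tsx: "ts = xs @ ys" by (simp add: xs_def ys_def)
    have s: "sorted xs" "sorted ys" "set xs \<subseteq> {a..c}" "set ys \<subseteq> {a..c}"
      using ts unfolding tsx by (auto simp: sorted_append)
    have x: "\<forall>t\<in>set xs. t \<le> b" unfolding xs_def by (auto dest: set_takeWhileD)
    have y: "\<forall>t\<in>set ys. b \<le> t"
    proof (cases ys)
      case (Cons z zs)
      then have "\<not> z \<le> b" using hd_dropWhile[of "\<lambda>t. t \<le> b" ts] unfolding ys_def by auto
      then show ?thesis using s(2) Cons by auto
    qed simp
    have "polygon_length \<gamma> ts \<le> polygon_length \<gamma> (xs @ b # ys)"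
      unfolding tsx by (rule polygon_length_insert)
    also have "\<dots> = polygon_length \<gamma> (xs @ [b]) + polygon_length \<gamma> (b # ys)" by (rule polygon_length_append)
    also have "\<dots> \<le> curve_length \<gamma> a b + curve_length \<gamma> b c"
      by (intro add_mono polygon_length_le_curve_length) (use s x y assms in "auto simp: sorted_append")
    finally show "polygon_length \<gamma> ts \<le> curve_length \<gamma> a b + curve_length \<gamma> b c" .
  qed
  have ne: "partitions u v \<noteq> {}" for u v :: real
    by (rule ex_in_conv[THEN iffD1], rule exI[of _ "[]"]) simp
  show "curve_length \<gamma> a b + curve_length \<gamma> b c \<le> curve_length \<gamma> a c"
    unfolding curve_length_eq[of \<gamma> a b] curve_length_eq[of \<gamma> b c]
    unfolding ennreal_SUP_add_left[OF ne, symmetric] ennreal_SUP_add_right[OF ne]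
  proof (intro SUP_least)
    fix xs ys assume xs: "xs \<in> partitions a b" and ys: "ys \<in> partitions b c"
    have "polygon_length \<gamma> xs + polygon_length \<gamma> ys \<le> polygon_length \<gamma> (xs @ [b]) + polygon_length \<gamma> (b # ys)"
      using polygon_length_insert[of \<gamma> xs "[]" b] polygon_length_insert[of \<gamma> "[]" ys b]
      by (intro add_mono) auto
    also have "\<dots> = polygon_length \<gamma> (xs @ b # ys)" by (rule polygon_length_append[symmetric])
    also have "\<dots> \<le> curve_length \<gamma> a c"
      by (intro polygon_length_le_curve_length) (use xs ys assms in "fastforce simp: sorted_append")+
    finally show "polygon_length \<gamma> xs + polygon_length \<gamma> ys \<le> curve_length \<gamma> a c" .
  qed
qed

lemma curve_length_lipschitz:
  assumes "1-lipschitz_on {0..T} \<gamma>" "0 \<le> a" "a \<le> b" "b \<le> T"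
  shows "curve_length \<gamma> a b \<le> ennreal (b - a)"
  unfolding curve_length_eq
proof (rule SUP_least)
  fix ts assume ts: "ts \<in> partitions a b"
  have *: "polygon_length \<gamma> ts \<le> ennreal (b - hd ts)" if "sorted ts" "set ts \<subseteq> {a..b}" "ts \<noteq> []"
    using that assms(1)
  proof (induction \<gamma> ts rule: polygon_length.induct)
    case (1 \<gamma> x y r)
    have "dist (\<gamma> x) (\<gamma> y) \<le> 1 * dist x y"
      by (rule lipschitz_onD[OF 1(5)]) (use 1(3) assms in auto)
    then have "ennreal (dist (\<gamma> x) (\<gamma> y)) \<le> ennreal (y - x)"
      using 1(2) by (intro ennreal_leI) (auto simp: dist_real_def)
    moreover have "polygon_length \<gamma> (y # r) \<le> ennreal (b - y)"
      using 1(1)[OF _ _ _ 1(5)] 1(2,3) by simp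
    ultimately have "polygon_length \<gamma> (x # y # r) \<le> ennreal (y - x) + ennreal (b - y)"
      by (auto intro: add_mono)
    also have "\<dots> = ennreal (b - x)" using 1(2,3) by (subst ennreal_plus[symmetric]) auto
    finally show ?case by simp
  qed auto
  show "polygon_length \<gamma> ts \<le> ennreal (b - a)"
  proof (cases "ts = []")
    case False
    then have "hd ts \<in> {a..b}" using ts hd_in_set[of ts] by blast
    then have "ennreal (b - hd ts) \<le> ennreal (b - a)" by (intro ennreal_leI) auto
    with * ts False show ?thesis by (auto intro: order_trans)
  qed simp
qed

lemma continuous_on_1_lipschitz_mono:
  fixes \<sigma> :: "real \<Rightarrow> real"
  assumes "\<And>s t. \<lbrakk>0 \<le> s; s \<le> t; t \<le> T\<rbrakk> \<Longrightarrow> \<sigma> s \<le> \<sigma> t \<and> \<sigma> t - \<sigma> s \<le> t - s"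
  shows "continuous_on {0..T} \<sigma>"
proof (rule lipschitz_on_continuous_on[of 1], rule lipschitz_onI)
  fix x y assume "x \<in> {0..T}" "y \<in> {0..T}"
  then show "dist (\<sigma> x) (\<sigma> y) \<le> 1 * dist x y"
    using assms[of x y] assms[of y x] by (cases "x \<le> y") (simp_all add: dist_real_def)
qed simp

text \<open>Here \<open>\<sigma>\<close> is the arc-length function of \<open>\<gamma>\<close>.\<close>

lemma arclength_reparametrization:
  fixes \<gamma> :: "real \<Rightarrow> 'a::metric_space"
  assumes lip: "1-lipschitz_on {0..T} \<gamma>" and T: "0 \<le> T" and ne: "\<gamma> 0 \<noteq> \<gamma> T"
  obtains \<eta> \<sigma> where "arclength_curve UNIV \<eta> (\<sigma> T)" "\<sigma> 0 = 0"
    "\<And>s t. \<lbrakk>0 \<le> s; s \<le> t; t \<le> T\<rbrakk> \<Longrightarrow> \<sigma> s \<le> \<sigma> t \<and> \<sigma> t - \<sigma> s \<le> t - s"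
    "\<And>t. t \<in> {0..T} \<Longrightarrow> \<eta> (\<sigma> t) = \<gamma> t"
proof -
  define \<sigma> where "\<sigma> t = enn2real (curve_length \<gamma> 0 t)" for t
  have len: "curve_length \<gamma> a b = ennreal (\<sigma> b - \<sigma> a) \<and> 0 \<le> \<sigma> b - \<sigma> a" if "0 \<le> a" "a \<le> b" "b \<le> T" for a b
  proof -
    have f: "curve_length \<gamma> 0 b \<le> ennreal (b - 0)" "curve_length \<gamma> 0 a \<le> ennreal (a - 0)" "curve_length \<gamma> a b \<le> ennreal (b - a)"
      by (rule curve_length_lipschitz[OF lip]; use that in simp)+
    have fb: "curve_length \<gamma> 0 b < top" "curve_length \<gamma> 0 a < top" "curve_length \<gamma> a b < top"
      using f by (auto intro: le_less_trans)
    have "curve_length \<gamma> 0 b = curve_length \<gamma> 0 a + curve_length \<gamma> a b"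
      by (rule curve_length_additive) (use that in auto)
    then have "\<sigma> b = \<sigma> a + enn2real (curve_length \<gamma> a b)"
      unfolding \<sigma>_def using fb by (simp add: enn2real_plus)
    then show ?thesis using fb by simp
  qed
  have step: "\<sigma> s \<le> \<sigma> t \<and> \<sigma> t - \<sigma> s \<le> t - s" if "0 \<le> s" "s \<le> t" "t \<le> T" for s t
    using len[OF that] curve_length_lipschitz[OF lip that] that by (auto simp: ennreal_le_iff)
  have s0: "\<sigma> 0 = 0"
    using len[of 0 0] curve_length_lipschitz[OF lip, of 0 0] T by (auto simp: \<sigma>_def)
  have contS: "continuous_on {0..T} \<sigma>" by (rule continuous_on_1_lipschitz_mono) (rule step)
  have ex: "\<exists>t\<in>{0..T}. \<sigma> t = s" if "s \<in> {0..\<sigma> T}" for s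
    using IVT'[of \<sigma> 0 s T] that s0 T contS by auto
  \<comment> \<open>Any right inverse of \<open>\<sigma>\<close> will do: the curve is constant on
    the level sets of \<open>\<sigma>\<close>, as \<open>eqg\<close> shows below.\<close>
  define \<tau> where "\<tau> s = (SOME t. t \<in> {0..T} \<and> \<sigma> t = s)" for s
  have tau: "\<tau> s \<in> {0..T} \<and> \<sigma> (\<tau> s) = s" if "s \<in> {0..\<sigma> T}" for s
    unfolding \<tau>_def by (rule someI_ex) (use ex[OF that] in blast)
  have eqg: "\<gamma> s = \<gamma> t" if "s \<in> {0..T}" "t \<in> {0..T}" "\<sigma> s = \<sigma> t" for s t
  proof -
    have *: "\<gamma> s = \<gamma> t" if "0 \<le> s" "s \<le> t" "t \<le> T" "\<sigma> s = \<sigma> t" for s t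
    proof -
      have "curve_length \<gamma> s t = 0" using conjunct1[OF len[OF that(1-3)]] that(4) by simp
      with dist_le_curve_length[OF that(2), of \<gamma>] show ?thesis by simp
    qed
    show ?thesis
    proof (cases "s \<le> t")
      case True
      then show ?thesis by (intro *) (use that in auto)
    next
      case False
      then have "\<gamma> t = \<gamma> s" by (intro *) (use that in auto)
      then show ?thesis by simp
    qed
  qed
  define \<eta> where "\<eta> s = \<gamma> (\<tau> s)" for s
  have es: "\<eta> (\<sigma> t) = \<gamma> t" if "t \<in> {0..T}" for t
  proof -
    have "\<sigma> t \<in> {0..\<sigma> T}" using step[of 0 t] step[of t T] that s0 by auto
    from tau[OF this] show ?thesis unfolding \<eta>_def using eqg that by blast
  qed
  have tmono: "\<tau> s \<le> \<tau> s'" if "s \<in> {0..\<sigma> T}" "s' \<in> {0..\<sigma> T}" "s \<le> s'" for s s'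
  proof (cases "s = s'")
    case False
    show ?thesis
    proof (rule ccontr)
      assume "\<not> \<tau> s \<le> \<tau> s'"
      then have "\<sigma> (\<tau> s') \<le> \<sigma> (\<tau> s)" using step[of "\<tau> s'" "\<tau> s"] tau[OF that(1)] tau[OF that(2)] by auto
      then show False using tau[OF that(1)] tau[OF that(2)] that(3) False by auto
    qed
  qed simp
  have arc: "curve_length \<eta> s s' = ennreal (s' - s)" if "0 \<le> s" "s \<le> s'" "s' \<le> \<sigma> T" for s s'
  proof -
    let ?a = "\<tau> s" and ?b = "\<tau> s'"
    have a: "?a \<in> {0..T}" "\<sigma> ?a = s" and b: "?b \<in> {0..T}" "\<sigma> ?b = s'" using tau that by auto
    have ab: "?a \<le> ?b" using tmono that by auto
    \<comment> \<open>Polygons are carried over in both directions, by \<open>\<tau>\<close> and by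
      \<open>\<sigma>\<close>, since both preserve order.\<close>
    have "curve_length \<eta> s s' = curve_length \<gamma> ?a ?b"
    proof (rule antisym)
      show "curve_length \<eta> s s' \<le> curve_length \<gamma> ?a ?b"
        unfolding curve_length_eq[of \<eta>]
      proof (rule SUP_least)
        fix ts assume ts: "ts \<in> partitions s s'"
        have "polygon_length \<eta> ts = polygon_length \<gamma> (map \<tau> ts)"
          unfolding polygon_length_map \<eta>_def ..
        also have "\<dots> \<le> curve_length \<gamma> ?a ?b"
        proof (rule polygon_length_le_curve_length)
          have in0: "t \<in> {0..\<sigma> T}" if "t \<in> set ts" for t using ts that \<open>0 \<le> s\<close> \<open>s' \<le> \<sigma> T\<close> by auto
          show "sorted (map \<tau> ts)"
            using ts in0 by (auto simp: sorted_iff_nth_mono intro!: tmono)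
          show "set (map \<tau> ts) \<subseteq> {?a..?b}" using ts in0 that by (fastforce intro!: tmono)
        qed
        finally show "polygon_length \<eta> ts \<le> curve_length \<gamma> ?a ?b" .
      qed
      show "curve_length \<gamma> ?a ?b \<le> curve_length \<eta> s s'"
        unfolding curve_length_eq[of \<gamma>]
      proof (rule SUP_least)
        fix ts assume ts: "ts \<in> partitions ?a ?b"
        have in0: "t \<in> {0..T}" if "t \<in> set ts" for t using ts that a b by auto
        have "polygon_length \<gamma> ts = polygon_length (\<lambda>t. \<eta> (\<sigma> t)) ts"
          by (rule polygon_length_cong) (use es in0 in auto)
        also have "\<dots> = polygon_length \<eta> (map \<sigma> ts)" by (rule polygon_length_map[symmetric])
        also have "\<dots> \<le> curve_length \<eta> s s'"
        proof (rule polygon_length_le_curve_length)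
          have sm: "\<sigma> t \<le> \<sigma> t'" if "t \<in> {0..T}" "t' \<in> {0..T}" "t \<le> t'" for t t'
            using step[of t t'] that by auto
          show "sorted (map \<sigma> ts)" using ts in0 by (auto simp: sorted_iff_nth_mono intro!: sm)
          show "set (map \<sigma> ts) \<subseteq> {s..s'}"
          proof
            fix x assume "x \<in> set (map \<sigma> ts)"
            then obtain t where t: "t \<in> set ts" "x = \<sigma> t" by auto
            then have "?a \<le> t" "t \<le> ?b" using ts by auto
            then show "x \<in> {s..s'}" using sm[of ?a t] sm[of t ?b] a b in0 t by auto
          qed
        qed
        finally show "polygon_length \<gamma> ts \<le> curve_length \<eta> s s'" .
      qed
    qed
    also have "\<dots> = ennreal (s' - s)" using len[of ?a ?b] a b ab by auto
    finally show ?thesis .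
  qed
  have "0 < \<sigma> T"
    using step[of 0 T] T s0 eqg[of 0 T] ne by (cases "\<sigma> T = 0") auto
  then have "arclength_curve UNIV \<eta> (\<sigma> T)" using arc by (auto simp: arclength_curve_def)
  then show thesis using s0 step es by (rule that) auto
qed

lemma nn_integral_Icc_sum:
  fixes k :: "real \<Rightarrow> ennreal" and t :: "nat \<Rightarrow> real"
  assumes "k \<in> borel_measurable borel" "\<And>i. i < n \<Longrightarrow> t i \<le> t (Suc i)"
  shows "(\<Sum>i<n. \<integral>\<^sup>+x\<in>{t i..t (Suc i)}. k x \<partial>lborel) = seg_integral k (t 0) (t n)"
  using assms(2)
proof (induction n)
  case 0
  have "seg_integral k (t 0) (t 0) = (\<integral>\<^sup>+x. 0 \<partial>(lborel :: real measure))"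
    by (intro nn_integral_cong_AE, use AE_lborel_singleton[of "t 0"] in eventually_elim) auto
  then show ?case by simp
next
  case (Suc n)
  have "t 0 \<le> t m" if "m \<le> n" for m
    using that
  proof (induction m)
    case (Suc m)
    then have "t 0 \<le> t m" "t m \<le> t (Suc m)" using Suc.prems \<open>\<And>i. i < Suc n \<Longrightarrow> t i \<le> t (Suc i)\<close> by auto
    then show ?case by (rule order_trans)
  qed simp
  then show ?case
    using Suc nn_integral_Icc_split[OF assms(1), of "t 0" "t n" "t (Suc n)"] by simp
qed

text \<open>Lower Riemann sums of \<open>f\<close> converge since \<open>f\<close> is lower semicontinuous.\<close>

lemma nn_integral_reparametrization_le:
  fixes f :: "real \<Rightarrow> ennreal"
  assumes f: "lsc f" and L: "0 < L" and T: "0 \<le> T" and s0: "\<sigma> 0 = 0" and sT: "\<sigma> T = L"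
    and step: "\<And>s t. \<lbrakk>0 \<le> s; s \<le> t; t \<le> T\<rbrakk> \<Longrightarrow> \<sigma> s \<le> \<sigma> t \<and> \<sigma> t - \<sigma> s \<le> t - s"
    and k: "k \<in> borel_measurable borel" "\<And>t. t \<in> {0..T} \<Longrightarrow> k t = f (\<sigma> t)"
  shows "seg_integral f 0 L \<le> seg_integral k 0 T"
proof -
  have fm[measurable]: "f \<in> borel_measurable borel" by (rule lsc_borel[OF f])
  have contS: "continuous_on {0..T} \<sigma>" by (rule continuous_on_1_lipschitz_mono) (rule step)
  define s where "s n i = L * real i / real (Suc n)" for n i :: nat
  define m where "m n i = (INF x\<in>{s n i..s n (Suc i)}. f x)" for n i
  \<comment> \<open>Half-open cells are disjoint, so each point sees the infimum
    \<open>m n i\<close> of a single cell.\<close>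
  define F where "F n x = (\<Sum>i<Suc n. m n i * indicator {s n i..<s n (Suc i)} x)" for n x
  have smono: "s n i \<le> s n j" if "i \<le> j" for n i j
    unfolding s_def using that L by (intro divide_right_mono mult_left_mono) auto
  have sd: "s n (Suc i) - s n i = L / real (Suc n)" for n i
    unfolding s_def by (simp add: diff_divide_distrib[symmetric] right_diff_distrib[symmetric])
  have int_F: "(\<integral>\<^sup>+x. F n x \<partial>lborel) \<le> seg_integral k 0 T" for n
  proof -
    have in0L: "s n i \<in> {0..L}" if "i \<le> Suc n" for i
      using that L mult_left_mono[of "real i" "real (Suc n)" L] by (auto simp: s_def field_simps)
    \<comment> \<open>The cell ends are pulled back through \<open>\<sigma>\<close>, which attains
      all values in \<open>[0,L]\<close>.\<close>
    have "\<exists>t\<in>{0..T}. \<sigma> t = s n i" if "i \<le> Suc n" for i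
      using IVT'[of \<sigma> 0 "s n i" T] in0L[OF that] s0 sT T contS by auto
    then obtain t where t: "\<And>i. i \<le> Suc n \<Longrightarrow> t i \<in> {0..T} \<and> \<sigma> (t i) = s n i" by metis
    have tm: "t i \<le> t (Suc i)" if "i < Suc n" for i
    proof (rule ccontr)
      assume "\<not> t i \<le> t (Suc i)"
      then have "\<sigma> (t (Suc i)) \<le> \<sigma> (t i)" using step[of "t (Suc i)" "t i"] t[of i] t[of "Suc i"] that by auto
      moreover have "0 < L / real (Suc n)" using L by simp
      ultimately show False using t[of i] t[of "Suc i"] that sd[of n i] by auto
    qed
    have "(\<integral>\<^sup>+x. F n x \<partial>lborel) = (\<Sum>i<Suc n. \<integral>\<^sup>+x. m n i * indicator {s n i..<s n (Suc i)} x \<partial>lborel)"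
      unfolding F_def by (rule nn_integral_sum) measurable
    also have "\<dots> = (\<Sum>i<Suc n. m n i * ennreal (s n (Suc i) - s n i))"
      by (intro sum.cong refl) (use smono in "simp add: nn_integral_cmult_indicator")
    also have "\<dots> \<le> (\<Sum>i<Suc n. \<integral>\<^sup>+x\<in>{t i..t (Suc i)}. k x \<partial>lborel)"
    proof (rule sum_mono)
      fix i assume i: "i \<in> {..<Suc n}"
      then have ti: "t i \<in> {0..T}" "\<sigma> (t i) = s n i" "t (Suc i) \<in> {0..T}" "\<sigma> (t (Suc i)) = s n (Suc i)" "t i \<le> t (Suc i)"
        using t[of i] t[of "Suc i"] tm by auto
      \<comment> \<open>Since \<open>\<sigma>\<close> is 1-Lipschitz, the pulled-back cell is at
        least as long as the original one.\<close>
      have "m n i * ennreal (s n (Suc i) - s n i) \<le> m n i * ennreal (t (Suc i) - t i)"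
        using step[of "t i" "t (Suc i)"] ti by (intro mult_left_mono ennreal_leI) auto
      also have "\<dots> = (\<integral>\<^sup>+x. m n i * indicator {t i..t (Suc i)} x \<partial>lborel)"
        using ti by (simp add: nn_integral_cmult_indicator)
      also have "\<dots> \<le> seg_integral k (t i) (t (Suc i))"
      proof (rule nn_integral_mono)
        fix x
        show "m n i * indicator {t i..t (Suc i)} x \<le> k x * indicator {t i..t (Suc i)} x"
        proof (cases "x \<in> {t i..t (Suc i)}")
          case True
          then have "\<sigma> x \<in> {s n i..s n (Suc i)}" "x \<in> {0..T}"
            using step[of "t i" x] step[of x "t (Suc i)"] ti by auto
          then have "m n i \<le> k x" unfolding m_def using k(2) by (auto intro: INF_lower)
          then show ?thesis by (intro mult_right_mono) auto
        qed simp
      qed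
      finally show "m n i * ennreal (s n (Suc i) - s n i) \<le> seg_integral k (t i) (t (Suc i))" .
    qed
    also have "\<dots> = seg_integral k (t 0) (t (Suc n))"
      by (rule nn_integral_Icc_sum[OF k(1)]) (rule tm)
    also have "\<dots> \<le> seg_integral k 0 T"
      by (intro nn_integral_mono) (use t[of 0] t[of "Suc n"] in "auto split: split_indicator")
    finally show ?thesis .
  qed
  have ptw: "f x * indicator {0..<L} x \<le> liminf (\<lambda>n. F n x)" for x
  proof (cases "x \<in> {0..<L}")
    case True
    have "f x \<le> liminf (\<lambda>n. F n x)"
      unfolding le_Liminf_iff
    proof (intro allI impI)
      fix c assume "c < f x"
      then obtain c' where c': "c < c'" "c' < f x" using dense by blast
      have "open {x. c' < f x}" using f by (simp add: lsc_def)
      then obtain d where d: "0 < d" "ball x d \<subseteq> {x. c' < f x}"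
        using c'(2) by (metis mem_Collect_eq openE)
      have "(\<lambda>n. L / real (Suc n)) \<longlonglongrightarrow> 0" by (rule LIMSEQ_Suc[OF lim_const_over_n])
      from order_tendstoD(2)[OF this d(1)]
      show "eventually (\<lambda>n. c < F n x) sequentially"
      proof eventually_elim
        fix n assume n: "L / real (Suc n) < d"
        define i where "i = nat \<lfloor>x * real (Suc n) / L\<rfloor>"
        have fl: "real i \<le> x * real (Suc n) / L" "x * real (Suc n) / L < real i + 1"
          unfolding i_def using True L by (auto simp: of_nat_nat)
        have "x * real (Suc n) < L * real (Suc n)" using True by (intro mult_strict_right_mono) auto
        then have "x * real (Suc n) / L < real (Suc n)" using L by (simp add: pos_divide_less_eq mult.commute del: of_nat_Suc)
        then have "real i < real (Suc n)" using fl by linarith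
        then have i: "i < Suc n" by simp
        have xi: "x \<in> {s n i..<s n (Suc i)}" using fl L by (auto simp: s_def field_simps)
        have "c' \<le> m n i" unfolding m_def
        proof (rule INF_greatest)
          fix y assume "y \<in> {s n i..s n (Suc i)}"
          then have "\<bar>x - y\<bar> \<le> L / real (Suc n)" using xi sd[of n i] by auto
          then have "y \<in> ball x d" using n by (auto simp: dist_real_def)
          then show "c' \<le> f y" using d(2) by (auto intro: less_imp_le)
        qed
        also have "m n i = m n i * indicator {s n i..<s n (Suc i)} x" using xi by simp
        also have "\<dots> \<le> F n x" unfolding F_def by (rule member_le_sum) (use i in auto)
        finally show "c < F n x" using c'(1) by (rule less_le_trans[rotated])
      qed
    qed
    then show ?thesis using True by simp
  qed simp
  have "seg_integral f 0 L = (\<integral>\<^sup>+x\<in>{0..<L}. f x \<partial>lborel)"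
    by (intro nn_integral_cong_AE, use AE_lborel_singleton[of L] in eventually_elim)
       (auto split: split_indicator)
  also have "\<dots> \<le> (\<integral>\<^sup>+x. liminf (\<lambda>n. F n x) \<partial>lborel)" by (intro nn_integral_mono ptw)
  also have "\<dots> \<le> liminf (\<lambda>n. \<integral>\<^sup>+x. F n x \<partial>lborel)"
    by (rule nn_integral_liminf, unfold F_def) measurable
  also have "\<dots> \<le> liminf (\<lambda>n. \<integral>\<^sup>+x\<in>{0..T}. k x \<partial>lborel)"
    by (rule Liminf_mono) (use int_F in auto)
  also have "\<dots> = seg_integral k 0 T" by (simp add: Liminf_const)
  finally show ?thesis .
qed

text \<open>Limits of arc-length curves are only 1-Lipschitz, so the inequality is needed along
  these. Reparametrize by arc length and compare the integrals; a curve with equal endpoints,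
  possibly constant, has nothing to prove.\<close>

lemma upper_gradient_lipschitz_curve:
  fixes u :: "'a::metric_space \<Rightarrow> real"
  assumes ug: "\<And>\<eta> l. arclength_curve UNIV \<eta> l \<Longrightarrow> ennreal \<bar>u (\<eta> l) - u (\<eta> 0)\<bar> \<le> curve_integral g \<eta> l"
    and g: "lsc g" and lip: "1-lipschitz_on {0..T} \<gamma>" and T: "0 \<le> T"
  shows "ennreal \<bar>u (\<gamma> T) - u (\<gamma> 0)\<bar> \<le> curve_integral g \<gamma> T"
proof (cases "\<gamma> 0 = \<gamma> T")
  case False
  obtain \<eta> \<sigma> where e: "arclength_curve UNIV \<eta> (\<sigma> T)" "\<sigma> 0 = 0"
    "\<And>s t. \<lbrakk>0 \<le> s; s \<le> t; t \<le> T\<rbrakk> \<Longrightarrow> \<sigma> s \<le> \<sigma> t \<and> \<sigma> t - \<sigma> s \<le> t - s"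
    "\<And>t. t \<in> {0..T} \<Longrightarrow> \<eta> (\<sigma> t) = \<gamma> t"
    using arclength_reparametrization[OF lip T False] by blast
  let ?L = "\<sigma> T"
  have L: "0 < ?L" using e(1) by (auto simp: arclength_curve_def)
  let ?\<eta> = "\<lambda>x. \<eta> (max 0 (min ?L x))"
  have cont: "continuous_on UNIV ?\<eta>"
    by (rule continuous_on_compose2[OF arclength_curve_continuous[OF e(1)]])
       (use L in "auto intro!: continuous_intros")
  have "lsc (\<lambda>x. g (?\<eta> x))" unfolding lsc_def
  proof
    fix c
    have "open {x. c < g x}" using g by (simp add: lsc_def)
    then have "open (?\<eta> -` {x. c < g x})" by (rule open_vimage[OF _ cont])
    then show "open {x. c < g (?\<eta> x)}" by (simp add: vimage_def)
  qed
  note fl = this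
  have gb: "g \<in> borel_measurable borel" by (rule lsc_borel[OF g])
  have lc: "continuous_on {0..T} \<gamma>" using lip by (rule lipschitz_on_continuous_on)
  have "ennreal \<bar>u (\<gamma> T) - u (\<gamma> 0)\<bar> = ennreal \<bar>u (\<eta> ?L) - u (\<eta> 0)\<bar>"
    using e(4)[of T] e(4)[of 0] e(2) T by simp
  also have "\<dots> \<le> curve_integral g \<eta> ?L" by (rule ug[OF e(1)])
  also have "\<dots> = seg_integral (\<lambda>x. g (?\<eta> x)) 0 ?L" by (rule clamp_integral[symmetric])
  also have "\<dots> \<le> (seg_integral (\<lambda>x. g (\<gamma> (max 0 (min T x)))) 0 T)"
  proof (rule nn_integral_reparametrization_le[OF fl L T e(2) refl e(3)])
    show "(\<lambda>x. g (\<gamma> (max 0 (min T x)))) \<in> borel_measurable borel"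
      using clamp_curve_measurable[OF lc T] gb by measurable
    show "g (\<gamma> (max 0 (min T t))) = g (?\<eta> (\<sigma> t))" if "t \<in> {0..T}" for t
      using e(3)[of 0 t] e(3)[of t T] e(4)[OF that] e(2) that by auto
  qed auto
  also have "\<dots> = curve_integral g \<gamma> T" by (rule clamp_integral)
  finally show ?thesis .
qed simp

section \<open>Limits of Lipschitz curves and potentials\<close>

lemma diagonal_convergent:
  fixes x :: "nat \<Rightarrow> nat \<Rightarrow> 'a::metric_space"
  assumes K: "compact K" and xK: "\<And>n i. x n i \<in> K"
  obtains r where "strict_mono r" "\<And>n. convergent (\<lambda>i. x n (r i))"
proof -
  define P where "P n s \<longleftrightarrow> convergent (\<lambda>i. x n (s i))" for n and s :: "nat \<Rightarrow> nat"
  interpret subseqs P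
  proof
    fix n and s :: "nat \<Rightarrow> nat"
    have "\<forall>i. x n (s i) \<in> K" using xK by auto
    then obtain l r where "strict_mono r" "((\<lambda>i. x n (s i)) \<circ> r) \<longlonglongrightarrow> l"
      using compact_imp_seq_compact[OF K, unfolded seq_compact_def, rule_format, of "\<lambda>i. x n (s i)"] xK by auto
    then show "\<exists>r'. strict_mono r' \<and> P n (s \<circ> r')"
      unfolding P_def by (auto simp: o_def convergent_def)
  qed
  have "convergent (\<lambda>i. x n (diagseq i))" for n
  proof -
    have "P n (diagseq \<circ> ((+) (Suc n)))"
    proof (rule diagseq_holds)
      fix r s :: "nat \<Rightarrow> nat" and n assume "strict_mono r" "P n s"
      then show "P n (s \<circ> r)"
        unfolding P_def convergent_def using LIMSEQ_subseq_LIMSEQ[of "\<lambda>i. x n (s i)" _ r] by (auto simp: o_def)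
    qed
    then obtain l where "(\<lambda>i. x n (diagseq (i + Suc n))) \<longlonglongrightarrow> l"
      unfolding P_def convergent_def by (auto simp: add.commute)
    then have "(\<lambda>i. x n (diagseq i)) \<longlonglongrightarrow> l" by (rule LIMSEQ_offset)
    then show ?thesis by (auto simp: convergent_def)
  qed
  then show thesis using subseq_diagseq that by blast
qed

text \<open>The Arzela-Ascoli argument: convergence at a countable dense set of parameters spreads
  to \<open>{0..T}\<close> through the common Lipschitz constant. Semicontinuity and Fatou's lemma
  then control the integral, with the moving endpoints \<open>\<tau> n\<close>.\<close>

lemma lipschitz_curves_limit:
  fixes \<gamma> :: "nat \<Rightarrow> real \<Rightarrow> 'a::metric_space"
  assumes lip: "\<And>n. 1-lipschitz_on {0..T} (\<gamma> n)" and T: "0 \<le> T" and K: "compact K"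
    and inK: "\<And>n t. t \<in> {0..T} \<Longrightarrow> \<gamma> n t \<in> K" and tau: "\<And>n. \<tau> n \<in> {0..T}" and g: "lsc g"
  obtains r \<eta> \<theta> where "strict_mono (r :: nat \<Rightarrow> nat)" "1-lipschitz_on {0..T} \<eta>" "\<theta> \<in> {0..T}"
    "\<And>t. t \<in> {0..T} \<Longrightarrow> (\<lambda>n. \<gamma> (r n) t) \<longlonglongrightarrow> \<eta> t"
    "(\<lambda>n. \<gamma> (r n) (\<tau> (r n))) \<longlonglongrightarrow> \<eta> \<theta>"
    "curve_integral g \<eta> \<theta> \<le> liminf (\<lambda>n. curve_integral g (\<gamma> (r n)) (\<tau> (r n)))"
proof -
  have "seq_compact {0..T}" by (rule compact_imp_seq_compact) auto
  then obtain \<theta> r0 where r0: "\<theta> \<in> {0..T}" "strict_mono r0" "(\<tau> \<circ> r0) \<longlonglongrightarrow> \<theta>"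
    unfolding seq_compact_def using tau by blast
  \<comment> \<open>Rationals clamped into \<open>{0..T}\<close>: a dense sequence, also for
    \<open>T = 0\<close>.\<close>
  define d where "d n = max 0 (min T (real_of_rat (from_nat n)))" for n
  have d0: "d n \<in> {0..T}" for n using T by (auto simp: d_def)
  have dd: "\<exists>n. \<bar>d n - t\<bar> < \<delta>" if t: "t \<in> {0..T}" and delta: "0 < \<delta>" for t \<delta>
  proof -
    obtain q where q: "t - \<delta> < real_of_rat q" "real_of_rat q < t + \<delta>"
    proof -
      have "t - \<delta> < t + \<delta>" using delta by simp
      from of_rat_dense[OF this] show thesis using that by blast
    qed
    have "\<bar>max 0 (min T y) - t\<bar> \<le> \<bar>y - t\<bar>" for y :: real using t by (auto simp: max_def min_def)
    from this[of "real_of_rat q"] have "\<bar>d (to_nat q) - t\<bar> \<le> \<bar>real_of_rat q - t\<bar>" by (simp add: d_def)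
    then show ?thesis using q by (intro exI[of _ "to_nat q"]) auto
  qed
  obtain r1 where r1: "strict_mono r1" "\<And>n. convergent (\<lambda>i. \<gamma> (r0 (r1 i)) (d n))"
    by (rule diagonal_convergent[OF K, of "\<lambda>n i. \<gamma> (r0 i) (d n)"]) (use inK d0 in auto)
  define r where "r = r0 \<circ> r1"
  have sr: "strict_mono r" unfolding r_def using r0(2) r1(1) by (rule strict_mono_o)
  have lipD: "dist (\<gamma> n s) (\<gamma> n t) \<le> \<bar>s - t\<bar>" if "s \<in> {0..T}" "t \<in> {0..T}" for n s t
    using lipschitz_onD[OF lip that] by (simp add: dist_real_def)
  have "\<exists>l. (\<lambda>i. \<gamma> (r i) t) \<longlonglongrightarrow> l" if t: "t \<in> {0..T}" for t
  proof -
    have "Cauchy (\<lambda>i. \<gamma> (r i) t)"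
    proof (rule metric_CauchyI)
      fix e :: real assume e: "0 < e"
      then obtain n where n: "\<bar>d n - t\<bar> < e / 3" using dd[OF t, of "e/3"] by auto
      have "Cauchy (\<lambda>i. \<gamma> (r i) (d n))" using r1(2)[of n] by (simp add: r_def convergent_Cauchy)
      then obtain N where N: "\<And>i j. i \<ge> N \<Longrightarrow> j \<ge> N \<Longrightarrow> dist (\<gamma> (r i) (d n)) (\<gamma> (r j) (d n)) < e / 3"
        using metric_CauchyD[of _ "e/3"] e by (metis divide_pos_pos zero_less_numeral)
      show "\<exists>M. \<forall>m\<ge>M. \<forall>n\<ge>M. dist (\<gamma> (r m) t) (\<gamma> (r n) t) < e"
      proof (intro exI allI impI)
        fix i j assume ij: "N \<le> i" "N \<le> j"
        have "dist (\<gamma> (r i) t) (\<gamma> (r j) t) \<le> dist (\<gamma> (r i) t) (\<gamma> (r i) (d n)) + dist (\<gamma> (r i) (d n)) (\<gamma> (r j) t)"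
          by (rule dist_triangle)
        also have "dist (\<gamma> (r i) (d n)) (\<gamma> (r j) t) \<le> dist (\<gamma> (r i) (d n)) (\<gamma> (r j) (d n)) + dist (\<gamma> (r j) (d n)) (\<gamma> (r j) t)"
          by (rule dist_triangle)
        finally show "dist (\<gamma> (r i) t) (\<gamma> (r j) t) < e"
          using N[OF ij] lipD[OF t d0[of n], of "r i"] lipD[OF d0[of n] t, of "r j"] n by (auto simp: abs_minus_commute)
      qed
    qed
    moreover have "\<forall>i. \<gamma> (r i) t \<in> K" using inK t by auto
    ultimately show ?thesis using completeE[OF compact_imp_complete[OF K]] by metis
  qed
  then obtain \<eta> where eta: "\<And>t. t \<in> {0..T} \<Longrightarrow> (\<lambda>i. \<gamma> (r i) t) \<longlonglongrightarrow> \<eta> t" by metis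
  have elip: "1-lipschitz_on {0..T} \<eta>"
  proof (rule lipschitz_onI)
    fix s t assume st: "s \<in> {0..T}" "t \<in> {0..T}"
    have "(\<lambda>i. dist (\<gamma> (r i) s) (\<gamma> (r i) t)) \<longlonglongrightarrow> dist (\<eta> s) (\<eta> t)"
      by (intro tendsto_dist eta st)
    then show "dist (\<eta> s) (\<eta> t) \<le> 1 * dist s t"
      by (rule LIMSEQ_le_const2) (use lipschitz_onD[OF lip st] in auto)
  qed simp
  have tr: "(\<lambda>i. \<tau> (r i)) \<longlonglongrightarrow> \<theta>"
    using LIMSEQ_subseq_LIMSEQ[OF r0(3) r1(1)] by (simp add: r_def o_def)
  have endp: "(\<lambda>n. \<gamma> (r n) (\<tau> (r n))) \<longlonglongrightarrow> \<eta> \<theta>"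
  proof -
    let ?b = "\<lambda>n. dist (\<gamma> (r n) \<theta>) (\<eta> \<theta>) + \<bar>\<tau> (r n) - \<theta>\<bar>"
    have "(\<lambda>n. ?b n) \<longlonglongrightarrow> 0 + \<bar>\<theta> - \<theta>\<bar>"
      by (intro tendsto_add tendsto_rabs tendsto_diff tendsto_const tr
          tendsto_dist_iff[THEN iffD1, OF eta[OF r0(1)]])
    then have "(\<lambda>n. ?b n) \<longlonglongrightarrow> 0" by simp
    then have "(\<lambda>n. dist (\<gamma> (r n) (\<tau> (r n))) (\<eta> \<theta>)) \<longlonglongrightarrow> 0"
    proof (rule tendsto_sandwich[OF _ _ tendsto_const, rotated 2])
      show "\<forall>\<^sub>F n in sequentially. dist (\<gamma> (r n) (\<tau> (r n))) (\<eta> \<theta>) \<le> ?b n"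
      proof (intro always_eventually allI)
        fix n
        have "dist (\<gamma> (r n) (\<tau> (r n))) (\<eta> \<theta>) \<le> dist (\<gamma> (r n) (\<tau> (r n))) (\<gamma> (r n) \<theta>) + dist (\<gamma> (r n) \<theta>) (\<eta> \<theta>)"
          by (rule dist_triangle)
        with lipD[OF tau r0(1), of "r n" "r n"] show "dist (\<gamma> (r n) (\<tau> (r n))) (\<eta> \<theta>) \<le> ?b n"
          by linarith
      qed
    qed auto
    then show ?thesis by (rule tendsto_dist_iff[THEN iffD2])
  qed
  have gb: "g \<in> borel_measurable borel" by (rule lsc_borel[OF g])
  have fatou: "curve_integral g \<eta> \<theta> \<le> liminf (\<lambda>n. curve_integral g (\<gamma> (r n)) (\<tau> (r n)))"
  proof -
    let ?q = "\<lambda>n x. g (\<gamma> (r n) x) * indicator {0..\<tau> (r n)} x"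
    have "curve_integral g \<eta> \<theta> \<le> (\<integral>\<^sup>+x. liminf (\<lambda>n. ?q n x) \<partial>lborel)"
      unfolding curve_integral_lborel
    proof (intro nn_integral_mono_AE, use AE_lborel_singleton[of \<theta>] in eventually_elim)
      \<comment> \<open>A parameter below \<open>\<theta>\<close> eventually lies in
        \<open>[0, \<tau> (r n)]\<close>; \<open>\<theta>\<close> itself, for which this may fail,
        is null.\<close>
      fix x assume "x \<noteq> \<theta>"
      show "g (\<eta> x) * indicator {0..\<theta>} x \<le> liminf (\<lambda>n. ?q n x)"
      proof (cases "x \<in> {0..\<theta>}")
        case True
        with \<open>x \<noteq> \<theta>\<close> r0(1) have x: "x \<in> {0..T}" "x < \<theta>" by auto
        have ev: "eventually (\<lambda>n. g (\<gamma> (r n) x) = ?q n x) sequentially"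
          using order_tendstoD(1)[OF tr x(2)] by eventually_elim (use x in auto)
        have "g (\<eta> x) \<le> liminf (\<lambda>n. g (\<gamma> (r n) x))" by (rule lsc_liminf[OF g eta[OF x(1)]])
        also have "\<dots> = liminf (\<lambda>n. ?q n x)" by (rule Liminf_eq[OF ev])
        finally show ?thesis using True by simp
      qed simp
    qed
    also have "\<dots> \<le> liminf (\<lambda>n. \<integral>\<^sup>+x. ?q n x \<partial>lborel)"
    proof (rule nn_integral_liminf)
      fix n show "(\<lambda>x. ?q n x) \<in> borel_measurable lborel"
        using curve_integrand_measurable[OF lipschitz_on_continuous_on[OF lip] gb, of 0 "\<tau> (r n)" "r n"] tau[of "r n"] by simp
    qed
    finally show ?thesis unfolding curve_integral_lborel .
  qed
  show thesis using that[OF sr elip r0(1) eta endp fatou] by blast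
qed

text \<open>The class of 1-Lipschitz curves contains constant curves and is closed under
  concatenation, reversal and limits, unlike that of arc-length curves. The infimum is
  \<open>top\<close> if no curve from \<open>x\<close> reaches \<open>C\<close>.\<close>

definition potential :: "('a::metric_space \<Rightarrow> ennreal) \<Rightarrow> 'a set \<Rightarrow> 'a \<Rightarrow> ennreal" where
  "potential g C x =
     (INF (\<gamma>, T) \<in> {(\<gamma>, T). 0 \<le> T \<and> 1-lipschitz_on {0..T} \<gamma> \<and> \<gamma> 0 = x \<and> \<gamma> T \<in> C}. curve_integral g \<gamma> T)"

lemma potential_le:
  assumes "0 \<le> T" "1-lipschitz_on {0..T} \<gamma>" "\<gamma> 0 = x" "\<gamma> T \<in> C"
  shows "potential g C x \<le> curve_integral g \<gamma> T"
  unfolding potential_def by (rule INF_lower2[of "(\<gamma>, T)"]) (use assms in auto)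

lemma potential_greatest:
  assumes "\<And>\<gamma> T. \<lbrakk>0 \<le> T; 1-lipschitz_on {0..T} \<gamma>; \<gamma> 0 = x; \<gamma> T \<in> C\<rbrakk> \<Longrightarrow> c \<le> curve_integral g \<gamma> T"
  shows "c \<le> potential g C x"
  unfolding potential_def by (rule INF_greatest) (use assms in auto)

lemma potential_lessE:
  assumes "potential g C x < c"
  obtains \<gamma> T where "0 \<le> T" "1-lipschitz_on {0..T} \<gamma>" "\<gamma> 0 = x" "\<gamma> T \<in> C" "curve_integral g \<gamma> T < c"
  using assms unfolding potential_def by (auto simp: INF_less_iff)

lemma potential_zero:
  assumes "x \<in> C" shows "potential g C x = 0"
proof -
  have "potential g C x \<le> curve_integral g (\<lambda>_. x) 0"
    by (rule potential_le) (use assms in auto)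
  also have "curve_integral g (\<lambda>_. x) 0 = (\<integral>\<^sup>+x. 0 \<partial>(lborel :: real measure))"
    unfolding curve_integral_lborel
    by (intro nn_integral_cong_AE, use AE_lborel_singleton[of 0] in eventually_elim) auto
  finally show ?thesis by simp
qed

lemma potential_antimono: "C \<subseteq> C' \<Longrightarrow> potential g C' x \<le> potential g C x"
  by (rule potential_greatest) (auto intro: potential_le)

text \<open>Prefix \<open>\<alpha>\<close> to a nearly optimal curve that starts at
  \<open>\<alpha> a\<close>.\<close>

lemma potential_concat:
  fixes \<alpha> :: "real \<Rightarrow> 'a::metric_space"
  assumes g: "g \<in> borel_measurable borel" and a: "0 \<le> a" "1-lipschitz_on {0..a} \<alpha>"
  shows "potential g C (\<alpha> 0) \<le> curve_integral g \<alpha> a + potential g C (\<alpha> a)"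
proof -
  have *: "potential g C (\<alpha> 0) \<le> curve_integral g \<alpha> a + curve_integral g \<gamma> T"
    if T: "0 \<le> T" "1-lipschitz_on {0..T} \<gamma>" "\<gamma> 0 = \<alpha> a" "\<gamma> T \<in> C" for \<gamma> T
  proof -
    let ?c = "\<lambda>x. if x \<le> a then \<alpha> x else \<gamma> (x - a)"
    have l2: "1-lipschitz_on {a..a + T} (\<lambda>x. \<gamma> (x - a))"
    proof (rule lipschitz_onI)
      fix x y assume "x \<in> {a..a + T}" "y \<in> {a..a + T}"
      then show "dist (\<gamma> (x - a)) (\<gamma> (y - a)) \<le> 1 * dist x y"
        using lipschitz_onD[OF T(2), of "x - a" "y - a"] by (auto simp: dist_real_def)
    qed simp
    have l: "1-lipschitz_on {0..a + T} ?c"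
      by (rule lipschitz_on_concat[OF a(2) l2]) (use T(3) in simp)
    have cont: "continuous_on {0..a + T} ?c" by (rule lipschitz_on_continuous_on[OF l])
    have cl: "?c (a + T) \<in> C" using T a by (cases "T = 0") auto
    have "potential g C (\<alpha> 0) \<le> curve_integral g ?c (a + T)"
      by (rule potential_le[OF _ l _ cl]) (use a T in auto)
    also have "\<dots> = seg_integral (\<lambda>x. (g (?c x) * indicator {0..a + T} x)) 0 (a + T)"
      unfolding curve_integral_lborel by (intro nn_integral_cong) (auto split: split_indicator)
    also have "\<dots> = seg_integral (\<lambda>x. (g (?c x) * indicator {0..a + T} x)) 0 a + seg_integral (\<lambda>x. (g (?c x) * indicator {0..a + T} x)) a (a + T)"
      by (rule nn_integral_Icc_split[OF curve_integrand_measurable[OF cont g]]) (use a T in auto)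
    also have "seg_integral (\<lambda>x. (g (?c x) * indicator {0..a + T} x)) 0 a = curve_integral g \<alpha> a"
      unfolding curve_integral_lborel by (intro nn_integral_cong) (use T in "auto split: split_indicator")
    also have "seg_integral (\<lambda>x. (g (?c x) * indicator {0..a + T} x)) a (a + T) = seg_integral (\<lambda>x. g (?c x)) a (a + T)"
      by (intro nn_integral_cong) (use a in "auto split: split_indicator")
    also have "\<dots> = curve_integral g (\<lambda>x. ?c (a + x)) (a + T - a)"
      by (rule curve_integral_subcurve[OF cont g, symmetric]) (use a T in auto)
    also have "\<dots> = curve_integral g \<gamma> T"
      unfolding curve_integral_lborel by (intro nn_integral_cong) (use T(3) in "auto split: split_indicator")
    finally show ?thesis .
  qed
  \<comment> \<open>Written as a set of values in order to take a minimizing sequence. The set is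
    empty if no curve joins \<open>\<alpha> a\<close> to \<open>C\<close>, and then the right-hand
    side is \<open>top\<close>.\<close>
  let ?J = "{curve_integral g \<gamma> T | \<gamma> T. 0 \<le> T \<and> 1-lipschitz_on {0..T} \<gamma> \<and> \<gamma> 0 = \<alpha> a \<and> \<gamma> T \<in> C}"
  have pJ: "potential g C (\<alpha> a) = Inf ?J"
  proof (rule antisym)
    show "potential g C (\<alpha> a) \<le> Inf ?J" by (rule Inf_greatest) (auto intro: potential_le)
    show "Inf ?J \<le> potential g C (\<alpha> a)" by (rule potential_greatest) (auto intro!: Inf_lower)
  qed
  show ?thesis
  proof (cases "?J = {}")
    case True
    then have i: "Inf ?J = top" by (simp only: Inf_empty)
    show ?thesis unfolding pJ i by simp
  next
    case False
    obtain v where v: "\<forall>n. v n \<in> ?J" "v \<longlonglongrightarrow> Inf ?J"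
      using Inf_as_limit[OF False] by (elim exE conjE)
    have "(\<lambda>n. curve_integral g \<alpha> a + v n) \<longlonglongrightarrow> curve_integral g \<alpha> a + Inf ?J"
      by (intro tendsto_add tendsto_const v(2))
    moreover have "potential g C (\<alpha> 0) \<le> curve_integral g \<alpha> a + v n" for n
    proof -
      have "v n \<in> ?J" using v(1) by (rule spec)
      then obtain \<gamma> T where "v n = curve_integral g \<gamma> T" and T: "0 \<le> T" "1-lipschitz_on {0..T} \<gamma>" "\<gamma> 0 = \<alpha> a" "\<gamma> T \<in> C"
        unfolding mem_Collect_eq by (elim exE conjE)
      then show ?thesis using *[OF T] by simp
    qed
    ultimately show ?thesis unfolding pJ by (intro LIMSEQ_le_const) auto
  qed
qed

text \<open>Truncation at 1 keeps the value finite where no curve reaches \<open>C\<close>, and 1 is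
  the largest value that a competitor takes.\<close>

definition truncated_potential :: "('a::metric_space \<Rightarrow> ennreal) \<Rightarrow> 'a set \<Rightarrow> 'a \<Rightarrow> real" where
  "truncated_potential g C x = enn2real (min 1 (potential g C x))"

lemma ennreal_truncated_potential: "ennreal (truncated_potential g C x) = min 1 (potential g C x)"
  unfolding truncated_potential_def by (rule ennreal_enn2real) (simp add: min_less_iff_disj)

lemma truncated_potential_bounds: "0 \<le> truncated_potential g C x" "truncated_potential g C x \<le> 1"
proof -
  show "0 \<le> truncated_potential g C x" by (simp add: truncated_potential_def)
  have "ennreal (truncated_potential g C x) \<le> ennreal 1" by (simp add: ennreal_truncated_potential)
  then show "truncated_potential g C x \<le> 1" by (subst (asm) ennreal_le_iff) auto
qed

lemma truncated_potential_zero: "x \<in> C \<Longrightarrow> truncated_potential g C x = 0"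
  by (simp add: truncated_potential_def potential_zero)

text \<open>Run along the curve forwards or backwards and continue to \<open>C\<close>:
  \<open>potential_concat\<close> then bounds the difference from both sides. There are no
  exceptional curves.\<close>

lemma truncated_potential_var_bound:
  fixes \<gamma> :: "real \<Rightarrow> 'a::metric_space"
  assumes g: "g \<in> borel_measurable borel" and lip: "1-lipschitz_on {0..l} \<gamma>"
  shows "curve_bound (truncated_potential g C) g \<gamma> l"
  unfolding var_bound_def
proof (intro allI impI)
  fix s t :: real assume st: "0 \<le> s" "s \<le> t" "t \<le> l"
  let ?I = "\<integral>\<^sup>+x\<in>{s..t}. g (\<gamma> x) \<partial>lborel"
  let ?u = "truncated_potential g C"
  have cont: "continuous_on {0..l} \<gamma>" by (rule lipschitz_on_continuous_on[OF lip])
  have le: "ennreal (?u y) \<le> ?I + ennreal (?u z)" if "potential g C y \<le> ?I + potential g C z" for y z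
    using that unfolding ennreal_truncated_potential
    by (auto simp: min_def intro: order_trans add_increasing)
  have 1: "potential g C (\<gamma> s) \<le> ?I + potential g C (\<gamma> t)"
  proof -
    have "1-lipschitz_on {0..t - s} (\<lambda>x. \<gamma> (s + x))"
    proof (rule lipschitz_onI)
      fix x y assume "x \<in> {0..t - s}" "y \<in> {0..t - s}"
      then show "dist (\<gamma> (s + x)) (\<gamma> (s + y)) \<le> 1 * dist x y"
        using lipschitz_onD[OF lip, of "s + x" "s + y"] st by (auto simp: dist_real_def)
    qed simp
    from potential_concat[OF g _ this, of C] st
    show ?thesis using curve_integral_subcurve[OF cont g st(1,3)] by simp
  qed
  have 2: "potential g C (\<gamma> t) \<le> ?I + potential g C (\<gamma> s)"
  proof -
    have "1-lipschitz_on {0..t - s} (\<lambda>x. \<gamma> (t - x))"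
    proof (rule lipschitz_onI)
      fix x y assume "x \<in> {0..t - s}" "y \<in> {0..t - s}"
      then show "dist (\<gamma> (t - x)) (\<gamma> (t - y)) \<le> 1 * dist x y"
        using lipschitz_onD[OF lip, of "t - x" "t - y"] st by (auto simp: dist_real_def)
    qed simp
    from potential_concat[OF g _ this, of C] st
    have "potential g C (\<gamma> t) \<le> curve_integral g (\<lambda>x. \<gamma> (t - x)) (t - s) + potential g C (\<gamma> s)" by simp
    also have "curve_integral g (\<lambda>x. \<gamma> (t - x)) (t - s) = ?I"
    proof -
      have "?I = ennreal \<bar>-1\<bar> * (\<integral>\<^sup>+x. g (\<gamma> (t + (-1) * x)) * indicator {s..t} (t + (-1) * x) \<partial>lborel)"
        by (rule nn_integral_real_affine[OF curve_integrand_measurable[OF cont g st(1,3)]]) auto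
      also have "\<dots> = curve_integral g (\<lambda>x. \<gamma> (t - x)) (t - s)"
        unfolding curve_integral_lborel by (auto intro!: nn_integral_cong split: split_indicator)
      finally show ?thesis ..
    qed
    finally show ?thesis .
  qed
  show "ennreal \<bar>?u (\<gamma> t) - ?u (\<gamma> s)\<bar> \<le> ?I"
  proof (cases "?I")
    case (real i)
    have *: "?u y - ?u z \<le> i" if "ennreal (?u y) \<le> ?I + ennreal (?u z)" for y z
      using that real truncated_potential_bounds(1)[of g C z] truncated_potential_bounds(1)[of g C y]
      by (simp flip: ennreal_plus add: ennreal_le_iff)
    have "\<bar>?u (\<gamma> t) - ?u (\<gamma> s)\<bar> \<le> i" using *[OF le[OF 1]] *[OF le[OF 2]] by linarith
    then show ?thesis using real by (simp add: ennreal_leI)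
  qed simp
qed

section \<open>Compactness of potentials and genuine upper gradients\<close>

context proper_mm_space
begin

text \<open>A limit of nearly optimal curves starts at \<open>a\<close> and ends in all
  \<open>C n\<close>. Letting points and targets vary together yields both the measurability
  (\<open>potential_borel\<close>) and the convergence (\<open>potential_SUP\<close>) of
  potentials.\<close>

lemma potential_limit:
  fixes g :: "'a \<Rightarrow> ennreal"
  assumes g: "lsc g" and C: "\<And>n::nat. closed (C n)" and dec: "decseq C"
    and \<epsilon>: "0 < \<epsilon>" "\<And>n y. y \<notin> C n \<Longrightarrow> ennreal \<epsilon> \<le> g y"
    and x: "x \<longlonglongrightarrow> a" and c: "0 \<le> c" "\<And>n. potential g (C n) (x n) < ennreal c"
  shows "potential g (\<Inter>n. C n) a \<le> ennreal c"
proof -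
  have gb: "g \<in> borel_measurable borel" by (rule lsc_borel[OF g])
  define T where "T = c / \<epsilon>"
  have T: "0 \<le> T" using c(1) \<epsilon>(1) by (simp add: T_def)
  text \<open>Curves are stopped when they reach \<open>C n\<close>; up to then \<open>g \<ge> \<epsilon>\<close> bounds their length.\<close>
  have "\<exists>\<gamma> \<tau>. 1-lipschitz_on {0..T} \<gamma> \<and> \<gamma> 0 = x n \<and> \<tau> \<in> {0..T} \<and> \<gamma> \<tau> \<in> C n \<and>
      curve_integral g \<gamma> \<tau> \<le> ennreal c" for n
  proof -
    obtain \<gamma> l where \<gamma>: "0 \<le> l" "1-lipschitz_on {0..l} \<gamma>" "\<gamma> 0 = x n" "\<gamma> l \<in> C n" "curve_integral g \<gamma> l < ennreal c"
      by (rule potential_lessE[OF c(2)[of n]]) auto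
    have cont: "continuous_on {0..l} \<gamma>" by (rule lipschitz_on_continuous_on[OF \<gamma>(2)])
    let ?H = "{0..l} \<inter> \<gamma> -` C n"
    have "closed ?H" by (rule continuous_closed_preimage[OF cont _ C]) auto
    then have "compact ?H" using compact_Int_closed[of "{0..l}" ?H] by (simp add: inf.assoc[symmetric])
    moreover have "?H \<noteq> {}" using \<gamma>(1,4) by auto
    ultimately obtain \<tau> where \<tau>: "\<tau> \<in> ?H" "\<And>t. t \<in> ?H \<Longrightarrow> \<tau> \<le> t"
      using compact_attains_inf[of ?H] by blast
    have tl: "0 \<le> \<tau>" "\<tau> \<le> l" using \<tau>(1) by auto
    have "ennreal \<epsilon> * ennreal \<tau> = (\<integral>\<^sup>+t. ennreal \<epsilon> * indicator {0..\<tau>} t \<partial>lborel)"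
      using tl by (simp add: nn_integral_cmult_indicator)
    also have "\<dots> \<le> curve_integral g \<gamma> l"
      unfolding curve_integral_lborel
    proof (intro nn_integral_mono_AE, use AE_lborel_singleton[of \<tau>] in eventually_elim)
      fix t assume "t \<noteq> \<tau>"
      show "ennreal \<epsilon> * indicator {0..\<tau>} t \<le> g (\<gamma> t) * indicator {0..l} t"
      proof (cases "t \<in> {0..\<tau>}")
        case True
        then have "\<gamma> t \<notin> C n" using \<tau>(2)[of t] \<open>t \<noteq> \<tau>\<close> tl by auto
        then show ?thesis using \<epsilon>(2) True tl by auto
      qed simp
    qed
    also have "\<dots> \<le> ennreal c" using \<gamma>(5) by simp
    finally have "\<epsilon> * \<tau> \<le> c" using \<epsilon>(1) tl c(1) by (simp flip: ennreal_mult add: ennreal_le_iff)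
    then have tT: "\<tau> \<le> T" using \<epsilon>(1) by (simp add: T_def field_simps)
    \<comment> \<open>After time \<open>\<tau>\<close> the curve stands still, so that all curves
      share the interval \<open>{0..T}\<close>.\<close>
    have lip: "1-lipschitz_on {0..T} (\<lambda>t. \<gamma> (min t \<tau>))"
    proof (rule lipschitz_onI)
      fix s t assume "s \<in> {0..T}" "t \<in> {0..T}"
      then have "dist (\<gamma> (min s \<tau>)) (\<gamma> (min t \<tau>)) \<le> 1 * dist (min s \<tau>) (min t \<tau>)"
        by (intro lipschitz_onD[OF \<gamma>(2)]) (use tl in auto)
      also have "\<dots> \<le> 1 * dist s t" by (auto simp: dist_real_def min_def)
      finally show "dist (\<gamma> (min s \<tau>)) (\<gamma> (min t \<tau>)) \<le> 1 * dist s t" .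
    qed simp
    have "curve_integral g (\<lambda>t. \<gamma> (min t \<tau>)) \<tau> \<le> curve_integral g \<gamma> l"
      unfolding curve_integral_lborel by (intro nn_integral_mono) (use tl in "auto split: split_indicator")
    with \<gamma>(5) have "curve_integral g (\<lambda>t. \<gamma> (min t \<tau>)) \<tau> \<le> ennreal c" by (auto intro: order_trans)
    then show ?thesis using lip \<tau>(1) tl tT \<gamma>(3)
      by (intro exI[of _ "\<lambda>t. \<gamma> (min t \<tau>)"] exI[of _ \<tau>]) auto
  qed
  then obtain \<gamma> \<tau> where \<gamma>: "\<And>n. 1-lipschitz_on {0..T} (\<gamma> n)" "\<And>n. \<gamma> n 0 = x n" "\<And>n. \<tau> n \<in> {0..T}"
    "\<And>n. \<gamma> n (\<tau> n) \<in> C n" "\<And>n. curve_integral g (\<gamma> n) (\<tau> n) \<le> ennreal c"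
    by metis
  have "bounded (range x)" by (rule convergent_imp_bounded[OF x])
  then obtain R where R: "\<And>n. dist a (x n) \<le> R"
    using bounded_any_center[of "range x" a] by auto
  have K: "compact (cball a (R + T))" by (rule proper) auto
  have inK: "\<gamma> n t \<in> cball a (R + T)" if "t \<in> {0..T}" for n t
  proof -
    have "dist a (\<gamma> n t) \<le> dist a (x n) + dist (x n) (\<gamma> n t)" by (rule dist_triangle)
    moreover have "dist (\<gamma> n 0) (\<gamma> n t) \<le> 1 * dist 0 t"
      by (rule lipschitz_onD[OF \<gamma>(1)]) (use that T in auto)
    ultimately show ?thesis using R[of n] \<gamma>(2)[of n] that by (auto simp: dist_real_def)
  qed
  obtain r \<eta> \<theta> where r: "strict_mono (r :: nat \<Rightarrow> nat)" "1-lipschitz_on {0..T} \<eta>" "\<theta> \<in> {0..T}"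
    "\<And>t. t \<in> {0..T} \<Longrightarrow> (\<lambda>n. \<gamma> (r n) t) \<longlonglongrightarrow> \<eta> t"
    "(\<lambda>n. \<gamma> (r n) (\<tau> (r n))) \<longlonglongrightarrow> \<eta> \<theta>"
    "curve_integral g \<eta> \<theta> \<le> liminf (\<lambda>n. curve_integral g (\<gamma> (r n)) (\<tau> (r n)))"
    by (rule lipschitz_curves_limit[where \<gamma>=\<gamma> and \<tau>=\<tau>, OF \<gamma>(1) T K inK \<gamma>(3) g], assumption, rule that)
  have "(\<lambda>n. x (r n)) \<longlonglongrightarrow> a" using LIMSEQ_subseq_LIMSEQ[OF x r(1)] by (simp add: o_def)
  moreover have "(\<lambda>n. x (r n)) \<longlonglongrightarrow> \<eta> 0" using r(4)[of 0] T \<gamma>(2) by simp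
  ultimately have e0: "\<eta> 0 = a" by (rule LIMSEQ_unique[rotated])
  \<comment> \<open>As \<open>C\<close> decreases, the endpoints lie in the closed set
    \<open>C i\<close> from the index \<open>i\<close> on.\<close>
  have eC: "\<eta> \<theta> \<in> C i" for i
  proof (rule Lim_in_closed_set[OF C _ _ r(5)])
    show "\<forall>\<^sub>F n in sequentially. \<gamma> (r n) (\<tau> (r n)) \<in> C i"
      using eventually_ge_at_top[of i]
    proof eventually_elim
      fix n assume "i \<le> n"
      also have "n \<le> r n" by (rule seq_suble[OF r(1)])
      finally show "\<gamma> (r n) (\<tau> (r n)) \<in> C i" using decseqD[OF dec] \<gamma>(4) by blast
    qed
  qed simp
  have "potential g (\<Inter>n. C n) a \<le> curve_integral g \<eta> \<theta>"
    by (rule potential_le) (use r(2,3) e0 eC in "auto intro: lipschitz_on_subset")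
  also have "\<dots> \<le> liminf (\<lambda>n. curve_integral g (\<gamma> (r n)) (\<tau> (r n)))" by (rule r(6))
  also have "\<dots> \<le> liminf (\<lambda>n. ennreal c)" by (rule Liminf_mono) (use \<gamma>(5) in auto)
  finally show ?thesis by (simp add: Liminf_const)
qed

text \<open>With the constant target \<open>C\<close>, \<open>potential_limit\<close> says that
  sublevel sets are closed.\<close>

lemma potential_borel:
  fixes g :: "'a \<Rightarrow> ennreal"
  assumes g: "lsc g" and C: "closed C" and \<epsilon>: "0 < \<epsilon>" "\<And>y. y \<notin> C \<Longrightarrow> ennreal \<epsilon> \<le> g y"
  shows "potential g C \<in> borel_measurable borel"
proof (rule borel_measurableI_le)
  fix y :: ennreal
  have "closed {x. potential g C x \<le> y}"
    unfolding closed_sequential_limits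
  proof (intro allI impI, elim conjE)
    fix X l assume X: "\<forall>n. X n \<in> {x. potential g C x \<le> y}" "X \<longlonglongrightarrow> l"
    have "potential g C l \<le> y"
    proof (rule dense_ge)
      fix z assume "y < z"
      then obtain z' where z': "y < z'" "z' < z" using dense by blast
      then obtain c where c: "z' = ennreal c" "0 \<le> c" by (cases z') auto
      have "potential g (\<Inter>n::nat. C) l \<le> ennreal c"
      proof (rule potential_limit[OF g _ _ \<epsilon> X(2) c(2)])
        fix n
        have "potential g C (X n) \<le> y" using X(1) by simp
        also have "\<dots> < ennreal c" using z' c by simp
        finally show "potential g C (X n) < ennreal c" .
      qed (use C in "auto simp: decseq_def")
      then show "potential g C l \<le> z" using z' c by auto
    qed
    then show "l \<in> {x. potential g C x \<le> y}" by simp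
  qed
  then show "{x \<in> space borel. potential g C x \<le> y} \<in> sets borel" by simp
qed

text \<open>With the constant point \<open>x\<close>, \<open>potential_limit\<close> says that every
  \<open>c\<close> above the supremum also bounds the potential of the intersection.\<close>

lemma potential_SUP:
  fixes g :: "'a \<Rightarrow> ennreal"
  assumes g: "lsc g" and C: "\<And>n::nat. closed (C n)" and dec: "decseq C"
    and \<epsilon>: "0 < \<epsilon>" "\<And>n y. y \<notin> C n \<Longrightarrow> ennreal \<epsilon> \<le> g y"
  shows "(SUP n. potential g (C n) x) = potential g (\<Inter>n. C n) x"
proof (rule antisym)
  show "(SUP n. potential g (C n) x) \<le> potential g (\<Inter>n. C n) x"
    by (rule SUP_least) (auto intro: potential_antimono)
  show "potential g (\<Inter>n. C n) x \<le> (SUP n. potential g (C n) x)"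
  proof (rule dense_ge)
    fix z assume "(SUP n. potential g (C n) x) < z"
    then obtain z' where z': "(SUP n. potential g (C n) x) < z'" "z' < z" using dense by blast
    then obtain c where c: "z' = ennreal c" "0 \<le> c" by (cases z') auto
    have "potential g (\<Inter>n. C n) x \<le> ennreal c"
    proof (rule potential_limit[OF g C dec \<epsilon> tendsto_const c(2)])
      fix n
      have "potential g (C n) x \<le> (SUP n. potential g (C n) x)" by (rule SUP_upper) simp
      also have "\<dots> < ennreal c" using z' c by simp
      finally show "potential g (C n) x < ennreal c" .
    qed
    then show "potential g (\<Inter>n. C n) x \<le> z" using z' c by auto
  qed
qed

lemma truncated_potential_wug:
  assumes "g \<in> borel_measurable borel" shows "wug p M (truncated_potential g C) g"
proof -
  have "ae_curve p M (curve_bound (truncated_potential g C) g)"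
    by (rule ae_curveI[of "\<lambda>_. 0"])
       (auto intro: truncated_potential_var_bound assms arclength_curve_lipschitz)
  with assms show ?thesis by (simp add: wug_def)
qed

text \<open>A weak upper gradient becomes, after a small increase of its energy, a lower semicontinuous
  upper gradient along all curves that is bounded from below on a given ball.\<close>

lemma genuine_upper_gradient:
  assumes w: "wug p M u k" and kc: "energy p M k < c"
  obtains G \<epsilon> where "lsc G" "energy p M G < c" "0 < (\<epsilon>::real)" "\<And>y. y \<in> ball z R \<Longrightarrow> ennreal \<epsilon> \<le> G y"
    "\<And>\<gamma> l. arclength_curve UNIV \<gamma> l \<Longrightarrow> ennreal \<bar>u (\<gamma> l) - u (\<gamma> 0)\<bar> \<le> curve_integral G \<gamma> l"
proof -
  obtain \<rho> where \<rho>: "\<rho> \<in> borel_measurable borel" "energy p M \<rho> < \<infinity>"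
    "\<And>\<gamma> l. \<lbrakk>arclength_curve UNIV \<gamma> l; curve_integral \<rho> \<gamma> l < \<infinity>\<rbrakk> \<Longrightarrow> curve_bound u k \<gamma> l"
    using ae_curveE[OF wug_ae[OF w]] by blast
  note km[measurable] = wug_borel[OF w] and [measurable] = \<rho>(1)
  have [measurable]: "ball z R \<in> sets borel" by simp
  \<comment> \<open>The summand \<open>\<rho>\<close> will give every exceptional curve an infinite
    integral, even after scaling by \<open>\<epsilon>\<close>; the indicator yields the lower bound
    on the ball.\<close>
  define h where "h x = max (\<rho> x) (indicator (ball z R) x)" for x
  have hm[measurable]: "h \<in> borel_measurable borel" unfolding h_def by measurable
  have "energy p M h \<le> (\<integral>\<^sup>+x. ennpowr (\<rho> x) p + ennpowr (indicator (ball z R) x) p \<partial>M)"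
    unfolding h_def by (intro nn_integral_mono ennpowr_max_le p_pos)
  also have "\<dots> = energy p M \<rho> + (\<integral>\<^sup>+x. ennpowr (indicator (ball z R) x) p \<partial>M)"
    by (intro nn_integral_add borel_measurable_M) measurable
  also have "(\<integral>\<^sup>+x. ennpowr (indicator (ball z R) x) p \<partial>M) = (\<integral>\<^sup>+x. indicator (ball z R) x \<partial>M)"
    by (intro nn_integral_cong) (auto split: split_indicator)
  also have "\<dots> = emeasure M (ball z R)" by (intro nn_integral_indicator borel_sets_M) measurable
  finally have he: "energy p M h < \<infinity>" using \<rho>(2) ball_finite[of z R] by (auto simp: less_top[symmetric] top_unique)
  have kf: "energy p M k < \<infinity>" using kc by (auto intro: less_le_trans)
  obtain \<epsilon> where \<epsilon>: "0 < \<epsilon>" "energy p M (\<lambda>x. k x + ennreal \<epsilon> * h x) < c"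
    by (rule energy_perturb[OF km hm kf he kc]) auto
  let ?k = "\<lambda>x. k x + ennreal \<epsilon> * h x"
  have m: "?k \<in> borel_measurable borel" by measurable
  obtain e where e: "0 < e" "energy p M ?k + ennreal e < c"
    by (rule ennreal_less_add[OF \<epsilon>(2)])
  obtain G where G: "lsc G" "\<And>x. k x + ennreal \<epsilon> * h x \<le> G x" "energy p M G \<le> energy p M ?k + ennreal e"
    by (rule lsc_majorant_energy[OF m e(1)]) auto
  show thesis
  proof (rule that[OF G(1) _ \<epsilon>(1)])
    show "energy p M G < c" using G(3) e(2) by (rule le_less_trans)
    fix y assume "y \<in> ball z R"
    then have "ennreal \<epsilon> * 1 \<le> ennreal \<epsilon> * h y" unfolding h_def by (intro mult_left_mono) auto
    also have "\<dots> \<le> k y + ennreal \<epsilon> * h y" by (rule add_increasing) auto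
    also note G(2)
    finally show "ennreal \<epsilon> \<le> G y" by simp
  next
    fix \<gamma> :: "real \<Rightarrow> 'a" and l assume c: "arclength_curve UNIV \<gamma> l"
    show "ennreal \<bar>u (\<gamma> l) - u (\<gamma> 0)\<bar> \<le> curve_integral G \<gamma> l"
    proof (cases "curve_integral G \<gamma> l = \<infinity>")
      case False
      \<comment> \<open>A finite integral of \<open>G\<close> forces a finite integral of
        \<open>\<rho>\<close>, so the curve is not exceptional.\<close>
      have "ennreal \<epsilon> * curve_integral \<rho> \<gamma> l = curve_integral (\<lambda>x. ennreal \<epsilon> * \<rho> x) \<gamma> l"
        unfolding curve_integral_lborel mult.assoc
        by (intro nn_integral_cmult[symmetric])
          (use curve_integrand_measurable[OF arclength_curve_continuous[OF c] \<rho>(1), of 0 l] in simp)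
      also have "\<dots> \<le> curve_integral G \<gamma> l"
      proof (rule curve_integral_mono)
        fix x
        have "ennreal \<epsilon> * \<rho> x \<le> ennreal \<epsilon> * h x" unfolding h_def by (intro mult_left_mono) auto
        also have "\<dots> \<le> k x + ennreal \<epsilon> * h x" by (rule add_increasing) auto
        also note G(2)
        finally show "ennreal \<epsilon> * \<rho> x \<le> G x" .
      qed
      finally have "ennreal \<epsilon> * curve_integral \<rho> \<gamma> l < \<infinity>" using False by (auto simp: top.not_eq_extremum)
      then have "curve_integral \<rho> \<gamma> l < \<infinity>" using \<epsilon>(1) by (auto simp: ennreal_mult_less_top)
      from var_boundD[OF \<rho>(3)[OF c this], of 0 l] c
      have "ennreal \<bar>u (\<gamma> l) - u (\<gamma> 0)\<bar> \<le> curve_integral k \<gamma> l"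
        by (auto simp: curve_integral_lborel arclength_curve_def)
      also have "\<dots> \<le> curve_integral G \<gamma> l"
      proof (rule curve_integral_mono)
        fix x
        have "k x \<le> k x + ennreal \<epsilon> * h x" by (rule add_increasing2) auto
        also note G(2)
        finally show "k x \<le> G x" .
      qed
      finally show ?thesis .
    qed simp
  qed
qed

end

section \<open>Exhaustion for bounded sets\<close>

context proper_mm_space
begin

text \<open>A constant may have infinite energy, but curves have finite length. This admits the
  constant gradient of a Lipschitz cut-off function.\<close>

lemma curve_finite_const: "curve_finite p M (\<lambda>_. ennreal c)"
proof -
  have "curve_integral (\<lambda>_. ennreal c) \<gamma> l < \<infinity>" for \<gamma> :: "real \<Rightarrow> 'a" and l
  proof -
    have "curve_integral (\<lambda>_. ennreal c) \<gamma> l = ennreal c * emeasure lborel {0..l}"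
      unfolding curve_integral_lborel by (rule nn_integral_cmult_indicator) auto
    also have "\<dots> < \<infinity>" by (cases "0 \<le> l") (auto simp: ennreal_mult_less_top)
    finally show ?thesis .
  qed
  then show ?thesis
    unfolding curve_finite_def by (intro ae_curveI[of "\<lambda>_. 0"]) auto
qed

text \<open>Cutting off by a minimum with a \<open>1/R\<close>-Lipschitz function costs \<open>R\<^sup>-\<^sup>p\<close> times the measure of the
  support, which is finite after replacing \<open>u\<close> by \<open>max 0 ((1 + \<epsilon>) u - \<epsilon>)\<close>.\<close>

lemma admissible_localize:
  assumes adm: "admissible E \<Omega> u g" and E: "bounded E" and gc: "energy p M g < c"
  obtains v k R where "wug p M v k" "energy p M k < c" "\<And>x. x \<in> E \<Longrightarrow> v x = 1" "\<And>x. v x \<le> 1"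
    "\<And>x. x \<notin> \<Omega> \<inter> ball z R \<Longrightarrow> v x = 0"
proof -
  have u[measurable]: "u \<in> borel_measurable M" and ub: "\<And>x. 0 \<le> u x" "\<And>x. u x \<le> 1" and uE: "\<And>x. x \<in> E \<Longrightarrow> u x = 1"
    and uO: "\<And>x. x \<notin> \<Omega> \<Longrightarrow> u x = 0" and uL: "(\<integral>\<^sup>+x. ennreal (u x powr p) \<partial>M) < \<infinity>" and
    g: "wug p M u g" "energy p M g < \<infinity>"
    using adm unfolding admissible_def by auto
  note gm[measurable] = wug_borel[OF g(1)]
  obtain \<epsilon> where \<epsilon>: "0 < \<epsilon>" "energy p M (\<lambda>x. g x + ennreal \<epsilon> * g x) < c"
    by (rule energy_perturb[OF gm gm g(2) g(2) gc]) auto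
  let ?g = "\<lambda>x. g x + ennreal \<epsilon> * g x"
  \<comment> \<open>\<open>F\<close> fixes 1 and vanishes up to
    \<open>a = \<epsilon> / (1 + \<epsilon>)\<close>; its slope \<open>1 + \<epsilon>\<close> is
    covered by the slack in the energy.\<close>
  define F where "F t = max 0 ((1 + \<epsilon>) * t - \<epsilon>)" for t
  define w where "w x = F (u x)" for x
  define a where "a = \<epsilon> / (1 + \<epsilon>)"
  have a: "0 < a" using \<epsilon> by (simp add: a_def)
  have w1: "w x \<le> 1" "0 \<le> w x" for x
  proof -
    have "(1 + \<epsilon>) * u x \<le> (1 + \<epsilon>) * 1" by (intro mult_left_mono ub) (use \<epsilon>(1) in simp)
    then have "(1 + \<epsilon>) * u x - \<epsilon> \<le> 1" unfolding diff_le_eq by simp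
    then show "w x \<le> 1" "0 \<le> w x" unfolding w_def F_def by auto
  qed
  have wE: "w x = 1" if "x \<in> E" for x using uE[OF that] \<epsilon>(1) by (simp add: w_def F_def)
  have wO: "w x = 0" if "x \<notin> \<Omega>" for x using uO[OF that] \<epsilon>(1) by (simp add: w_def F_def)
  have ww: "wug p M w ?g"
  proof -
    have "\<bar>F s - F t\<bar> \<le> (1 + \<epsilon>) * \<bar>s - t\<bar>" for s t
    proof -
      have "(1 + \<epsilon>) * \<bar>s - t\<bar> = \<bar>((1 + \<epsilon>) * s - \<epsilon>) - ((1 + \<epsilon>) * t - \<epsilon>)\<bar>"
        using \<epsilon>(1) by (simp add: right_diff_distrib[symmetric] abs_mult)
      then show ?thesis by (auto simp: F_def max_def)
    qed
    from wug_lipschitz_compose[OF g(1) _ this] \<epsilon>(1)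
    have "wug p M w (\<lambda>x. ennreal (1 + \<epsilon>) * g x)" unfolding w_def by simp
    then show ?thesis using \<epsilon>(1) by (simp add: distrib_right)
  qed
  define S where "S = {x. a < u x}"
  have Sm[measurable]: "S \<in> sets M"
  proof -
    have "{x\<in>space M. a < u x} \<in> sets M" by measurable
    then show ?thesis by (simp add: S_def)
  qed
  have wS: "x \<in> S" if "0 < w x" for x
  proof -
    have "0 < (1 + \<epsilon>) * u x - \<epsilon>" using that by (simp add: w_def F_def less_max_iff_disj)
    then have "\<epsilon> < u x * (1 + \<epsilon>)" by (simp add: mult.commute)
    then show ?thesis using \<epsilon>(1) unfolding S_def a_def mem_Collect_eq by (subst pos_divide_less_eq) auto
  qed
  \<comment> \<open>Chebyshev's inequality: \<open>u\<close> is p-integrable and exceeds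
    \<open>a\<close> on \<open>S\<close>.\<close>
  have "ennreal (a powr p) * emeasure M S = (\<integral>\<^sup>+x. ennreal (a powr p) * indicator S x \<partial>M)"
    by (rule nn_integral_cmult_indicator[symmetric]) (rule Sm)
  also have "\<dots> \<le> (\<integral>\<^sup>+x. ennreal (u x powr p) \<partial>M)"
    using a p_pos by (intro nn_integral_mono)
      (auto simp: S_def intro!: ennreal_leI powr_mono2 split: split_indicator)
  finally have "ennreal (a powr p) * emeasure M S < \<infinity>" using uL by (rule le_less_trans)
  then have Sf: "emeasure M S < \<infinity>" using a by (auto simp: ennreal_mult_less_top)
  have ind: "(indicator S :: 'a \<Rightarrow> ennreal) \<in> borel_measurable M" by measurable
  \<comment> \<open>\<open>S\<close> is only measurable for \<open>M\<close>; \<open>s\<close> is a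
    Borel substitute for its indicator.\<close>
  obtain s :: "'a \<Rightarrow> ennreal" where s[measurable]: "s \<in> borel_measurable borel" and sS: "\<And>x. indicator S x \<le> s x" "AE x in M. s x = indicator S x"
    using borel_majorant[OF ind] by blast
  have "energy p M s = (\<integral>\<^sup>+x. indicator S x \<partial>M)"
    by (rule nn_integral_cong_AE) (use sS(2) in eventually_elim, auto split: split_indicator)
  then have se: "energy p M s < \<infinity>" using Sf by simp
  have m1: "?g \<in> borel_measurable borel" by measurable
  have f1: "energy p M ?g < \<infinity>" using \<epsilon>(2) by (auto intro: less_le_trans)
  obtain \<delta> where \<delta>: "0 < \<delta>" "energy p M (\<lambda>x. (g x + ennreal \<epsilon> * g x) + ennreal \<delta> * s x) < c"
    by (rule energy_perturb[OF m1 s f1 se \<epsilon>(2)]) auto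
  let ?k = "\<lambda>x. (g x + ennreal \<epsilon> * g x) + ennreal \<delta> * s x"
  obtain r where r: "E \<subseteq> ball z r" using bounded_subset_ballD[OF E] by blast
  \<comment> \<open>Large enough for \<open>E\<close> to lie in the ball and for the slope
    \<open>1 / R\<close> of the cut-off to be at most \<open>\<delta>\<close>.\<close>
  define R where "R = max (max r 1) (1 / \<delta>)"
  have R: "r \<le> R" "0 < R" "1 / R \<le> \<delta>"
  proof -
    show "r \<le> R" "0 < R" by (auto simp: R_def)
    have "1 / \<delta> \<le> R" by (simp add: R_def)
    then show "1 / R \<le> \<delta>" using \<open>0 < R\<close> \<delta>(1) by (simp add: field_simps)
  qed
  \<comment> \<open>The cut-off is 1 on the ball of radius \<open>R\<close> and vanishes outside the
    one of radius \<open>2 * R\<close>.\<close>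
  define \<eta> where "\<eta> x = max 0 (min 1 (2 - dist z x / R))" for x
  have eta: "wug p M \<eta> (\<lambda>_. ennreal (1 / R))"
  proof (rule wug_lipschitz)
    fix x y
    have *: "\<bar>max 0 (min 1 s) - max 0 (min 1 t)\<bar> \<le> \<bar>s - t\<bar>" for s t :: real by (auto simp: max_def min_def)
    have "\<bar>\<eta> x - \<eta> y\<bar> \<le> \<bar>(2 - dist z x / R) - (2 - dist z y / R)\<bar>"
      unfolding \<eta>_def by (rule *)
    also have "\<dots> = (1 / R) * \<bar>dist z y - dist z x\<bar>"
      using R(2) by (simp add: diff_divide_distrib[symmetric] abs_divide)
    also have "\<dots> \<le> 1 / R * dist x y"
      using R(2) abs_dist_diff_le[of y z x] by (intro mult_left_mono) (auto simp: dist_commute)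
    finally show "\<bar>\<eta> x - \<eta> y\<bar> \<le> 1 / R * dist x y" .
  qed (use R in auto)
  show thesis
  proof (rule that)
    show "wug p M (\<lambda>x. min (w x) (\<eta> x)) ?k"
    proof (rule wug_max_min(2)[OF ww eta curve_finite_energy[OF m1 f1] curve_finite_const])
      show "(if w x \<le> \<eta> x then ?g x else ennreal (1 / R)) \<le> ?k x" for x
      proof (cases "w x \<le> \<eta> x")
        case True
        then show ?thesis by (simp add: add_increasing2)
      next
        \<comment> \<open>The cut-off acts only where \<open>w\<close> exceeds it. There
          \<open>w\<close> is positive, which puts \<open>x\<close> into \<open>S\<close>.\<close>
        case False
        moreover have "0 \<le> \<eta> x" by (simp add: \<eta>_def)
        ultimately have "x \<in> S" using wS[of x] by linarith
        then have "1 \<le> s x" using sS(1)[of x] by simp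
        have "ennreal (1 / R) \<le> ennreal \<delta> * 1" using R(3) by (simp add: ennreal_leI)
        also have "\<dots> \<le> ennreal \<delta> * s x" by (rule mult_left_mono[OF \<open>1 \<le> s x\<close>]) simp
        also have "\<dots> \<le> ?k x" by (rule add_increasing) auto
        finally show ?thesis using False by simp
      qed
    qed measurable
    show "energy p M ?k < c" by (rule \<delta>(2))
    show "min (w x) (\<eta> x) = 1" if "x \<in> E" for x
    proof -
      have "dist z x < R" using r that R(1) by auto
      then have "dist z x / R \<le> 1" using R(2) by simp
      then show ?thesis using wE[OF that] by (simp add: \<eta>_def)
    qed
    show "min (w x) (\<eta> x) \<le> 1" for x using w1(1)[of x] by simp
    show "min (w x) (\<eta> x) = 0" if "x \<notin> \<Omega> \<inter> ball z (2 * R)" for x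
    proof (cases "x \<in> \<Omega>")
      case True
      then have "2 * R \<le> dist z x" using that by auto
      then have "2 \<le> dist z x / R" using R(2) by (simp add: field_simps)
      then have "\<eta> x = 0" by (simp add: \<eta>_def)
      then show ?thesis using w1(2)[of x] by simp
    next
      case False
      have "0 \<le> \<eta> x" by (simp add: \<eta>_def)
      then show ?thesis using wO[OF False] by simp
    qed
  qed
qed

text \<open>In the notation of the overview \<open>v\<close> is the localized u, \<open>U n\<close>
  is u_j, \<open>V\<close> is u_oo and \<open>u1\<close> is w; \<open>D n\<close> is the set where
  the energy of w is paid.\<close>

lemma cap_bounded_exhaustion:
  assumes E: "bounded E" and op: "\<And>j. open (\<Omega>s j)" and inc: "incseq \<Omega>s"
    and fin: "cap_bounded p M E (\<Omega>s 0) < \<infinity>" and c: "cap_bounded p M E (\<Union>j. \<Omega>s j) < c"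
  obtains j where "cap_bounded p M E (\<Omega>s j) < c"
proof -
  fix x0 :: 'a
  have "open (\<Union>j. \<Omega>s j)" using op by auto
  with c obtain u g where ug: "admissible E (\<Union>j. \<Omega>s j) u g" "energy p M g < c" by (rule cap_bounded_lessE)
  obtain u1 g1 where u1: "admissible E (\<Omega>s 0) u1 g1" using cap_bounded_lessE[OF fin op] by blast
  obtain v k R where v: "wug p M v k" "energy p M k < c" "\<And>x. x \<in> E \<Longrightarrow> v x = 1" "\<And>x. v x \<le> 1"
    "\<And>x. x \<notin> (\<Union>j. \<Omega>s j) \<inter> ball x0 R \<Longrightarrow> v x = 0"
    by (rule admissible_localize[OF ug(1) E ug(2), where z=x0]) blast
  obtain G \<epsilon> where G: "lsc G" "energy p M G < c" "0 < (\<epsilon>::real)" "\<And>y. y \<in> ball x0 R \<Longrightarrow> ennreal \<epsilon> \<le> G y"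
    "\<And>\<gamma> l. arclength_curve UNIV \<gamma> l \<Longrightarrow> ennreal \<bar>v (\<gamma> l) - v (\<gamma> 0)\<bar> \<le> curve_integral G \<gamma> l"
    by (rule genuine_upper_gradient[OF v(1,2), where z=x0 and R=R]) blast
  \<comment> \<open>The outside of the ball counts as target too: \<open>v\<close> is 0 there, and
    the lower bound on \<open>G\<close> is known only inside.\<close>
  define C where "C n = - (\<Omega>s n \<inter> ball x0 R)" for n
  have cC: "closed (C n)" for n unfolding C_def using op by (auto intro: closed_Compl)
  have dC: "decseq C" unfolding C_def using inc by (fastforce simp: decseq_def incseq_def)
  have GC: "ennreal \<epsilon> \<le> G y" if "y \<notin> C n" for y n using that G(4) by (auto simp: C_def)
  define U where "U n = truncated_potential G (C n)" for n
  define V where "V = truncated_potential G (\<Inter>n. C n)"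
  note Gm[measurable] = lsc_borel[OF G(1)]
  have Gf: "energy p M G < \<infinity>" using G(2) by (auto intro: less_le_trans)
  have wU: "wug p M (U n) G" and wV: "wug p M V G" for n
    unfolding U_def V_def by (rule truncated_potential_wug[OF Gm])+
  have Um: "U n \<in> borel_measurable M" for n
  proof -
    have [measurable]: "potential G (C n) \<in> borel_measurable borel"
      by (rule potential_borel[OF G(1) cC G(3) GC])
    show ?thesis unfolding U_def truncated_potential_def[abs_def] by (intro borel_measurable_M) measurable
  qed
  have Vm: "V \<in> borel_measurable M"
  proof -
    have [measurable]: "potential G (\<Inter>n. C n) \<in> borel_measurable borel"
      by (rule potential_borel[OF G(1) _ G(3)]) (use cC GC in auto)
    show ?thesis unfolding V_def truncated_potential_def[abs_def] by (intro borel_measurable_M) measurable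
  qed
  have Ub: "0 \<le> U n x" "U n x \<le> 1" and Vb: "0 \<le> V x" "V x \<le> 1" for n x
    unfolding U_def V_def by (rule truncated_potential_bounds)+
  have UV: "ennreal (V x) = (SUP n. ennreal (U n x))" for x
  proof -
    have "(SUP n. potential G (C n) x) = potential G (\<Inter>n. C n) x"
      by (rule potential_SUP[OF G(1) cC dC G(3) GC])
    moreover have "(SUP n. min 1 (potential G (C n) x)) = min 1 (SUP n. potential G (C n) x)"
      by (simp add: inf_min[symmetric] inf_SUP)
    ultimately show ?thesis by (simp add: U_def V_def ennreal_truncated_potential)
  qed
  have Uinc: "ennreal (U n x) \<le> ennreal (U m x)" if "n \<le> m" for n m x
    unfolding U_def ennreal_truncated_potential
    using potential_antimono[OF decseqD[OF dC that]] by (intro min.mono) auto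
  \<comment> \<open>Every curve counted by the potential ends where \<open>v\<close> is 0, so its
    integral of \<open>G\<close> is at least \<open>v x\<close>.\<close>
  have vV: "v x \<le> V x" for x
  proof (cases "0 \<le> v x")
    case True
    have "ennreal (v x) \<le> potential G (\<Inter>n. C n) x"
    proof (rule potential_greatest)
      fix \<gamma> :: "real \<Rightarrow> 'a" and T assume T: "0 \<le> T" "1-lipschitz_on {0..T} \<gamma>" "\<gamma> 0 = x" "\<gamma> T \<in> (\<Inter>n. C n)"
      have "v (\<gamma> T) = 0" by (rule v(5)) (use T(4) in "auto simp: C_def")
      then show "ennreal (v x) \<le> curve_integral G \<gamma> T"
        using upper_gradient_lipschitz_curve[OF G(5) G(1) T(2,1)] T(3) True by simp
    qed
    moreover have "ennreal (v x) \<le> 1" using v(4)[of x] by (simp add: ennreal_le_1)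
    ultimately have "ennreal (v x) \<le> ennreal (V x)" by (simp add: V_def ennreal_truncated_potential)
    then show ?thesis using Vb(1) by (simp add: ennreal_le_iff)
  next
    case False
    then show ?thesis using Vb(1)[of x] by linarith
  qed
  have u1m[measurable]: "u1 \<in> borel_measurable M" and u1b: "\<And>x. 0 \<le> u1 x" "\<And>x. u1 x \<le> 1" and u1E: "\<And>x. x \<in> E \<Longrightarrow> u1 x = 1"
    and u1O: "\<And>x. x \<notin> \<Omega>s 0 \<Longrightarrow> u1 x = 0" and u1L: "(\<integral>\<^sup>+x. ennreal (u1 x powr p) \<partial>M) < \<infinity>" and
    g1: "wug p M u1 g1" "energy p M g1 < \<infinity>"
    using u1 unfolding admissible_def by auto
  note g1m[measurable] = wug_borel[OF g1(1)]
  note [measurable] = Um Vm borel_measurable_M[OF g1m] borel_measurable_M[OF Gm]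
  \<comment> \<open>Capping by \<open>V\<close> gives back the gradient \<open>G\<close> wherever
    \<open>u1\<close> is at least \<open>V\<close>, so \<open>g1\<close> survives only where
    \<open>u1 < V\<close>.\<close>
  define W where "W x = min (V x) (u1 x)" for x
  define f where "f x = (if V x \<le> u1 x then G x else g1 x)" for x
  have fm: "f \<in> borel_measurable M" unfolding f_def by measurable
  obtain h where hm[measurable]: "h \<in> borel_measurable borel" and h: "\<And>x. f x \<le> h x" "AE x in M. h x = f x"
    using borel_majorant[OF fm] by blast
  note [measurable] = borel_measurable_M[OF hm]
  have wW: "wug p M W h" unfolding W_def
    by (rule wug_max_min(2)[OF wV g1(1) curve_finite_energy[OF Gm Gf] curve_finite_energy[OF g1m g1(2)] hm])
       (use h(1) in "simp add: f_def")
  have hf: "energy p M h < \<infinity>"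
  proof -
    have "energy p M h \<le> (\<integral>\<^sup>+x. ennpowr (g1 x) p + ennpowr (G x) p \<partial>M)"
      by (rule nn_integral_mono_AE) (use h(2) in eventually_elim, auto simp: f_def add_increasing add_increasing2)
    also have "\<dots> = energy p M g1 + energy p M G" by (rule nn_integral_add) measurable
    also have "\<dots> < \<infinity>" using g1(2) Gf by simp
    finally show ?thesis .
  qed
  have [measurable]: "W \<in> borel_measurable M" unfolding W_def by measurable
  define D where "D n = {x. U n x < u1 x \<and> u1 x < V x}" for n
  have Dm[measurable]: "D n \<in> sets M" for n
  proof -
    have "{x\<in>space M. U n x < u1 x \<and> u1 x < V x} \<in> sets M" by measurable
    then show ?thesis by (simp add: D_def)
  qed
  define fn where "fn n x = (if W x \<le> U n x then G x else h x)" for n x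
  have fnm: "fn n \<in> borel_measurable M" for n unfolding fn_def by measurable
  have "\<exists>h'. h' \<in> borel_measurable borel \<and> (\<forall>x. fn n x \<le> h' x) \<and> (AE x in M. h' x = fn n x)" for n
    by (rule borel_majorant[OF fnm[of n]]) blast
  then obtain H where H: "\<And>n. H n \<in> borel_measurable borel" "\<And>n x. fn n x \<le> H n x" "\<And>n. AE x in M. H n x = fn n x"
    by metis
  let ?J = "\<lambda>n x. ennpowr (G x) p + ennpowr (g1 x) p * indicator (D n) x"
  have EH: "energy p M (H n) \<le> (\<integral>\<^sup>+x. ?J n x \<partial>M)" for n
  proof (rule nn_integral_mono_AE, use h(2) H(3)[of n] in eventually_elim)
    fix x assume e: "h x = f x" "H n x = fn n x"
    show "ennpowr (H n x) p \<le> ?J n x"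
    proof (cases "W x \<le> U n x \<or> V x \<le> u1 x")
      case True
      then have "H n x = G x" using e by (auto simp: fn_def f_def)
      then show ?thesis by (simp add: add_increasing2)
    next
      \<comment> \<open>Here \<open>u1 < V\<close>, hence \<open>W = u1\<close>, and
        \<open>W\<close> exceeds \<open>U n\<close>: this is \<open>D n\<close>, the only place
        where \<open>g1\<close> is active.\<close>
      case False
      then have "x \<in> D n" "H n x = g1 x" using e by (auto simp: fn_def f_def D_def W_def)
      then show ?thesis by (simp add: add_increasing)
    qed
  qed
  have lim: "(\<lambda>n. \<integral>\<^sup>+x. ?J n x \<partial>M) \<longlonglongrightarrow> energy p M G"
  proof (rule nn_integral_dominated_convergence[where w="\<lambda>x. ennpowr (G x) p + ennpowr (g1 x) p"])
    show "(\<integral>\<^sup>+x. ennpowr (G x) p + ennpowr (g1 x) p \<partial>M) < \<infinity>"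
      using Gf g1(2) by (simp add: nn_integral_add)
    show "AE x in M. ?J n x \<le> ennpowr (G x) p + ennpowr (g1 x) p" for n
      by (intro AE_I2 add_left_mono) (auto split: split_indicator)
    show "AE x in M. (\<lambda>n. ?J n x) \<longlonglongrightarrow> ennpowr (G x) p"
    proof (rule AE_I2)
      fix x
      \<comment> \<open>The sets \<open>D n\<close> decrease. For a point in all of them the
        supremum \<open>V x\<close> of the \<open>U n x\<close> would be at most
        \<open>u1 x\<close>, against \<open>u1 x < V x\<close>.\<close>
      have "eventually (\<lambda>n. x \<notin> D n) sequentially"
      proof (cases "\<exists>m. x \<notin> D m")
        case True
        then obtain m where m: "x \<notin> D m" ..
        show ?thesis using eventually_ge_at_top[of m]
        proof eventually_elim
          fix n assume "m \<le> n"
          then have "U m x \<le> U n x" using Uinc[of m n x] Ub(1)[of n x] by (simp add: ennreal_le_iff)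
          then show "x \<notin> D n" using m by (auto simp: D_def)
        qed
      next
        case False
        then have lt: "U n x < u1 x" "u1 x < V x" for n by (auto simp: D_def)
        have "ennreal (V x) \<le> ennreal (u1 x)"
          unfolding UV by (rule SUP_least) (intro ennreal_leI less_imp_le lt)
        then have "V x \<le> u1 x" using u1b(1)[of x] by (simp add: ennreal_le_iff)
        with lt(2) show ?thesis by simp
      qed
      then have "eventually (\<lambda>n. ?J n x = ennpowr (G x) p) sequentially"
        by eventually_elim simp
      then show "(\<lambda>n. ?J n x) \<longlonglongrightarrow> ennpowr (G x) p"
        by (rule tendsto_eventually)
    qed
  qed measurable
  from order_tendstoD(2)[OF lim G(2)] obtain n where
    n: "(\<integral>\<^sup>+x. ?J n x \<partial>M) < c"
    by (auto simp: eventually_sequentially)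
  have Hc: "energy p M (H n) < c" using EH n by (rule le_less_trans)
  have "admissible E (\<Omega>s n) (\<lambda>x. max (U n x) (W x)) (H n)"
    unfolding admissible_def
  proof (intro conjI allI impI ballI)
    show "(\<lambda>x. max (U n x) (W x)) \<in> borel_measurable M" by measurable
    show "0 \<le> max (U n x) (W x)" for x using Ub(1)[of n x] by simp
    show "max (U n x) (W x) \<le> 1" for x using Ub(2)[of n x] Vb(2)[of x] by (simp add: W_def)
    show "max (U n x) (W x) = 1" if "x \<in> E" for x
      using u1E[OF that] v(3)[OF that] vV[of x] Vb(2)[of x] Ub(2)[of n x] by (simp add: W_def)
    show "max (U n x) (W x) = 0" if "x \<notin> \<Omega>s n" for x
    proof -
      have "x \<in> C n" using that by (simp add: C_def)
      then have "U n x = 0" unfolding U_def by (rule truncated_potential_zero)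
      moreover have "\<Omega>s 0 \<subseteq> \<Omega>s n" using inc by (simp add: incseqD)
      then have "u1 x = 0" using u1O that by auto
      ultimately show ?thesis using Vb(1)[of x] by (simp add: W_def)
    qed
    have [measurable]: "ball x0 R \<in> sets M" by (rule borel_sets_M) simp
    \<comment> \<open>On the ball the bound 1 is integrable; off it \<open>U n\<close> vanishes and
      \<open>W\<close> is at most \<open>u1\<close>.\<close>
    have "(\<integral>\<^sup>+x. ennreal (max (U n x) (W x) powr p) \<partial>M) \<le> (\<integral>\<^sup>+x. indicator (ball x0 R) x + ennreal (u1 x powr p) \<partial>M)"
    proof (rule nn_integral_mono)
      fix x
      show "ennreal (max (U n x) (W x) powr p) \<le> indicator (ball x0 R) x + ennreal (u1 x powr p)"
      proof (cases "x \<in> ball x0 R")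
        case True
        have "max (U n x) (W x) powr p \<le> 1 powr p"
          using Ub[of n x] Vb[of x] p_pos by (intro powr_mono2) (auto simp: W_def)
        then have "ennreal (max (U n x) (W x) powr p) \<le> 1" by (simp add: ennreal_le_1)
        then show ?thesis using True by (auto intro: order_trans add_increasing2)
      next
        case False
        then have "U n x = 0" unfolding U_def by (intro truncated_potential_zero) (simp add: C_def)
        then have "max (U n x) (W x) powr p \<le> u1 x powr p"
          using Vb[of x] u1b[of x] p_pos by (intro powr_mono2) (auto simp: W_def)
        then show ?thesis by (simp add: add_increasing ennreal_leI)
      qed
    qed
    also have "\<dots> = emeasure M (ball x0 R) + (\<integral>\<^sup>+x. ennreal (u1 x powr p) \<partial>M)"
      by (subst nn_integral_add) auto
    also have "\<dots> < \<infinity>" using ball_finite[of x0 R] u1L by simp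
    finally show "(\<integral>\<^sup>+x. ennreal (max (U n x) (W x) powr p) \<partial>M) < \<infinity>" .
    show "wug p M (\<lambda>x. max (U n x) (W x)) (H n)"
      by (rule wug_max_min(1)[OF wU wW curve_finite_energy[OF Gm Gf] curve_finite_energy[OF hm hf] H(1)])
         (use H(2)[of n] in "simp add: fn_def")
    show "energy p M (H n) < \<infinity>" using Hc by (auto intro: less_le_trans)
  qed
  from cap_bounded_le_energy[OF this] Hc show thesis by (intro that[of n]) (rule le_less_trans)
qed

end

section \<open>Strong subadditivity and unbounded sets\<close>

lemma cap_bounded_mono:
  assumes "A \<subseteq> B" shows "cap_bounded p M A \<Omega> \<le> cap_bounded p M B \<Omega>"
proof -
  have "indicator A x \<le> (indicator B x :: ereal)" for x
    using assms by (auto split: split_indicator)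
  then show ?thesis
    unfolding cap_bounded_def by (intro INF_superset_mono) (auto intro: order_trans)
qed

text \<open>A ball around one centre lies in a larger ball around any other, so the supremum does
  not depend on \<open>x0\<close>, and the increasing sequences converge to it. For bounded
  \<open>E\<close> the sequence is eventually constant; one formula thus covers both cases of
  \<open>cap\<close>.\<close>

lemma cap_eq_SUP:
  fixes E :: "'a::metric_space set"
  shows "cap p M E \<Omega> = (SUP k. cap_bounded p M (E \<inter> ball x0 (real k)) \<Omega>)"
proof (cases "bounded E")
  case True
  show ?thesis
  proof (rule antisym)
    obtain r where r: "E \<subseteq> ball x0 r" using bounded_subset_ballD[OF True] by blast
    obtain k where "r \<le> real k" using real_arch_simple by blast
    then have "E \<inter> ball x0 (real k) = E" using r by (auto intro: less_le_trans)
    then show "cap p M E \<Omega> \<le> (SUP k. cap_bounded p M (E \<inter> ball x0 (real k)) \<Omega>)"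
      using True unfolding cap_def by (auto intro!: SUP_upper2[of k])
    show "(SUP k. cap_bounded p M (E \<inter> ball x0 (real k)) \<Omega>) \<le> cap p M E \<Omega>"
      using True unfolding cap_def by (auto intro!: SUP_least cap_bounded_mono)
  qed
next
  case False
  let ?c = "\<lambda>x k. cap_bounded p M (E \<inter> ball x (real k)) \<Omega>"
  let ?S = "\<lambda>x. SUP k. ?c x k"
  have le: "?S x \<le> ?S y" for x y
  proof (rule SUP_least)
    fix k
    obtain m where m: "real k + dist x y \<le> real m" using real_arch_simple by blast
    have "ball x (real k) \<subseteq> ball y (real m)"
    proof
      fix z assume "z \<in> ball x (real k)"
      then show "z \<in> ball y (real m)" using dist_triangle[of y z x] m by (auto simp: dist_commute)
    qed
    then have "?c x k \<le> cap_bounded p M (E \<inter> ball y (real m)) \<Omega>"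
      by (intro cap_bounded_mono) auto
    also have "\<dots> \<le> ?S y" by (rule SUP_upper) simp
    finally show "?c x k \<le> ?S y" .
  qed
  have lim: "?c x \<longlonglongrightarrow> ?S x" for x
    by (rule LIMSEQ_SUP) (auto simp: incseq_def intro!: cap_bounded_mono)
  have "(THE L. \<forall>x. ?c x \<longlonglongrightarrow> L) = ?S x0"
  proof (rule the_equality)
    have "?S x = ?S x0" for x by (intro antisym le)
    then show "\<forall>x. ?c x \<longlonglongrightarrow> ?S x0" using lim by metis
    fix L assume "\<forall>x. ?c x \<longlonglongrightarrow> L"
    then show "L = ?S x0" using lim LIMSEQ_unique by blast
  qed
  then show ?thesis using False by (simp add: cap_def)
qed

section \<open>Strong subadditivity and the exchange of limits\<close>

context proper_mm_space
begin

lemma admissible_mono: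
  "admissible B \<Omega> u g \<Longrightarrow> A \<subseteq> B \<Longrightarrow> \<Omega> \<subseteq> \<Omega>' \<Longrightarrow> admissible A \<Omega>' u g"
  unfolding admissible_def by blast

text \<open>A larger \<open>\<Omega>\<close> also enlarges the domain of integration in
  \<open>cap_bounded\<close>. This costs nothing, as \<open>cap_bounded_lessE\<close> supplies
  gradients whose energy is already taken over the whole space.\<close>

lemma cap_bounded_antimono:
  assumes "open \<Omega>" "\<Omega> \<subseteq> \<Omega>'" shows "cap_bounded p M E \<Omega>' \<le> cap_bounded p M E \<Omega>"
proof (rule dense_ge)
  fix c assume "cap_bounded p M E \<Omega> < c"
  then obtain u g where ug: "admissible E \<Omega> u g" "energy p M g < c" using assms(1) by (rule cap_bounded_lessE)
  have "cap_bounded p M E \<Omega>' \<le> energy p M g"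
    by (rule cap_bounded_le_energy[OF admissible_mono[OF ug(1) order_refl assms(2)]])
  then show "cap_bounded p M E \<Omega>' \<le> c" using ug(2) by auto
qed

text \<open>At each point one of maximum and minimum takes the gradient of \<open>u\<close> and the
  other that of \<open>w\<close>, so the p-th powers have the same sum as before. The maximum
  competes for the larger set in the larger domain, the minimum for the smaller set in the smaller
  domain.\<close>

lemma admissible_max_min_energy:
  assumes u: "admissible A \<Omega>' u g" and w: "admissible B \<Omega> w h" and AB: "A \<subseteq> B" and O: "\<Omega> \<subseteq> \<Omega>'"
  shows "cap_bounded p M B \<Omega>' + cap_bounded p M A \<Omega> \<le> energy p M g + energy p M h"
proof -
  have u'[measurable]: "u \<in> borel_measurable M" and ub: "\<And>x. 0 \<le> u x" "\<And>x. u x \<le> 1" and uA: "\<And>x. x \<in> A \<Longrightarrow> u x = 1"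
    and uO: "\<And>x. x \<notin> \<Omega>' \<Longrightarrow> u x = 0" and uL: "(\<integral>\<^sup>+x. ennreal (u x powr p) \<partial>M) < \<infinity>" and
    g: "wug p M u g" "energy p M g < \<infinity>"
    using u unfolding admissible_def by auto
  have w'[measurable]: "w \<in> borel_measurable M" and wb: "\<And>x. 0 \<le> w x" "\<And>x. w x \<le> 1" and wB: "\<And>x. x \<in> B \<Longrightarrow> w x = 1"
    and wO: "\<And>x. x \<notin> \<Omega> \<Longrightarrow> w x = 0" and wL: "(\<integral>\<^sup>+x. ennreal (w x powr p) \<partial>M) < \<infinity>" and
    h: "wug p M w h" "energy p M h < \<infinity>"
    using w unfolding admissible_def by auto
  note gm = wug_borel[OF g(1)] and hm = wug_borel[OF h(1)]
  note gf = curve_finite_energy[OF gm g(2)] and hf = curve_finite_energy[OF hm h(2)]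
  note [measurable] = borel_measurable_M[OF gm] borel_measurable_M[OF hm]
  define k1 where "k1 x = (if w x \<le> u x then g x else h x)" for x
  define k2 where "k2 x = (if w x \<le> u x then h x else g x)" for x
  have k1m[measurable]: "k1 \<in> borel_measurable M" and k2m[measurable]: "k2 \<in> borel_measurable M"
    unfolding k1_def k2_def by measurable
  obtain K1 where K1: "K1 \<in> borel_measurable borel" "\<And>x. k1 x \<le> K1 x" "AE x in M. K1 x = k1 x"
    using borel_majorant[OF k1m] by blast
  obtain K2 where K2: "K2 \<in> borel_measurable borel" "\<And>x. k2 x \<le> K2 x" "AE x in M. K2 x = k2 x"
    using borel_majorant[OF k2m] by blast
  have e1: "energy p M K1 = energy p M k1"
    by (rule nn_integral_cong_AE) (use K1(3) in eventually_elim, simp)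
  have e2: "energy p M K2 = energy p M k2"
    by (rule nn_integral_cong_AE) (use K2(3) in eventually_elim, simp)
  have "energy p M K1 + energy p M K2 = (\<integral>\<^sup>+x. ennpowr (k1 x) p + ennpowr (k2 x) p \<partial>M)"
    unfolding e1 e2 by (rule nn_integral_add[symmetric]) measurable
  also have "\<dots> = (\<integral>\<^sup>+x. ennpowr (g x) p + ennpowr (h x) p \<partial>M)"
    by (intro nn_integral_cong) (auto simp: k1_def k2_def add.commute)
  also have "\<dots> = energy p M g + energy p M h" by (rule nn_integral_add) measurable
  finally have sum: "energy p M K1 + energy p M K2 = energy p M g + energy p M h" .
  then have "energy p M K1 + energy p M K2 < \<infinity>" using g(2) h(2) by simp
  then have Kf: "energy p M K1 < \<infinity>" "energy p M K2 < \<infinity>" by auto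
  have L: "(\<integral>\<^sup>+x. ennreal (u x powr p) + ennreal (w x powr p) \<partial>M) < \<infinity>"
    using uL wL by (subst nn_integral_add) auto
  have "admissible B \<Omega>' (\<lambda>x. max (u x) (w x)) K1"
    unfolding admissible_def
  proof (intro conjI allI impI ballI)
    show "wug p M (\<lambda>x. max (u x) (w x)) K1"
      by (rule wug_max_min(1)[OF g(1) h(1) gf hf K1(1)]) (use K1(2) in "simp add: k1_def")
    have "(\<integral>\<^sup>+x. ennreal (max (u x) (w x) powr p) \<partial>M) \<le> (\<integral>\<^sup>+x. ennreal (u x powr p) + ennreal (w x powr p) \<partial>M)"
      by (intro nn_integral_mono) (auto simp: max_def add_increasing add_increasing2)
    then show "(\<integral>\<^sup>+x. ennreal (max (u x) (w x) powr p) \<partial>M) < \<infinity>" using L by (rule le_less_trans)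
    show "max (u x) (w x) = 0" if "x \<notin> \<Omega>'" for x
    proof -
      have "x \<notin> \<Omega>" using that O by blast
      then show ?thesis using uO[OF that] wO by simp
    qed
  qed (use ub wb wB Kf in "auto simp: max_def intro: antisym")
  note c1 = cap_bounded_le_energy[OF this]
  have "admissible A \<Omega> (\<lambda>x. min (w x) (u x)) K2"
    unfolding admissible_def
  proof (intro conjI allI impI ballI)
    show "wug p M (\<lambda>x. min (w x) (u x)) K2"
      by (rule wug_max_min(2)[OF h(1) g(1) hf gf K2(1)]) (use K2(2) in "simp add: k2_def")
    have "(\<integral>\<^sup>+x. ennreal (min (w x) (u x) powr p) \<partial>M) \<le> (\<integral>\<^sup>+x. ennreal (u x powr p) + ennreal (w x powr p) \<partial>M)"
      by (intro nn_integral_mono) (auto simp: min_def add_increasing add_increasing2)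
    then show "(\<integral>\<^sup>+x. ennreal (min (w x) (u x) powr p) \<partial>M) < \<infinity>" using L by (rule le_less_trans)
    show "min (w x) (u x) = 0" if "x \<notin> \<Omega>" for x using wO[OF that] ub(1)[of x] by simp
  qed (use ub wb wB uA AB Kf in "auto simp: min_def")
  note c2 = cap_bounded_le_energy[OF this]
  show ?thesis using add_mono[OF c1 c2] sum by simp
qed

lemma cap_bounded_strong_subadditive:
  assumes "A \<subseteq> B" "\<Omega> \<subseteq> \<Omega>'" "open \<Omega>" "open \<Omega>'"
  shows "cap_bounded p M B \<Omega>' + cap_bounded p M A \<Omega> \<le> cap_bounded p M A \<Omega>' + cap_bounded p M B \<Omega>"
proof (rule ennreal_le_epsilon)
  fix e :: real assume fin: "cap_bounded p M A \<Omega>' + cap_bounded p M B \<Omega> < top" and e: "0 < e"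
  let ?a = "cap_bounded p M A \<Omega>'" and ?b = "cap_bounded p M B \<Omega>"
  have lt: "a < a + ennreal (e/2)" if "a < top" for a :: ennreal
    using that e by (cases a) (auto simp flip: ennreal_plus simp: ennreal_less_iff)
  have "?a < top" "?b < top" using fin by auto
  then obtain u g w h where "admissible A \<Omega>' u g" "energy p M g < ?a + ennreal (e/2)"
    "admissible B \<Omega> w h" "energy p M h < ?b + ennreal (e/2)"
    using cap_bounded_lessE[OF lt assms(4)] cap_bounded_lessE[OF lt assms(3)] by metis
  then have "cap_bounded p M B \<Omega>' + cap_bounded p M A \<Omega> \<le> (?a + ennreal (e/2)) + (?b + ennreal (e/2))"
    using admissible_max_min_energy[OF _ _ assms(1,2)] by (meson add_mono less_imp_le order_trans)
  also have "\<dots> = ?a + ?b + (ennreal (e/2) + ennreal (e/2))" by (simp add: ac_simps)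
  also have "ennreal (e/2) + ennreal (e/2) = ennreal e" using e by (simp flip: ennreal_plus)
  finally show "cap_bounded p M B \<Omega>' + cap_bounded p M A \<Omega> \<le> ?a + ?b + ennreal e" .
qed

lemma cap_exhaustion_tendsto:
  assumes op: "\<And>j. open (\<Omega>s j)" and inc: "incseq \<Omega>s" and fin: "cap p M E (\<Omega>s 0) < \<infinity>"
  shows "(\<lambda>j. cap p M E (\<Omega>s j)) \<longlonglongrightarrow> cap p M E (\<Union>j. \<Omega>s j)"
proof -
  fix x0 :: 'a
  define B where "B k = E \<inter> ball x0 (real k)" for k
  define F where "F k j = cap_bounded p M (B k) (\<Omega>s j)" for k j
  let ?f = "\<lambda>j. cap p M E (\<Omega>s j)"
  let ?\<Omega> = "\<Union>j. \<Omega>s j"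
  have fF: "?f j = (SUP k. F k j)" for j unfolding F_def B_def by (rule cap_eq_SUP)
  have LF: "cap p M E ?\<Omega> = (SUP k. cap_bounded p M (B k) ?\<Omega>)" unfolding B_def by (rule cap_eq_SUP)
  have Bmono: "B k \<subseteq> B m" if "k \<le> m" for k m using that by (auto simp: B_def)
  have Omono: "\<Omega>s i \<subseteq> \<Omega>s j" if "i \<le> j" for i j using inc that by (simp add: incseqD)
  have fdec: "?f j \<le> ?f i" if "i \<le> j" for i j
    unfolding fF F_def by (intro SUP_mono') (rule cap_bounded_antimono[OF op Omono[OF that]])
  have Lf: "cap p M E ?\<Omega> \<le> ?f j" for j
    unfolding fF LF F_def by (intro SUP_mono') (rule cap_bounded_antimono[OF op], blast)
  show ?thesis
  proof (rule order_tendstoI)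
    fix a assume "a < cap p M E ?\<Omega>"
    then show "eventually (\<lambda>j. a < ?f j) sequentially" using Lf by (intro always_eventually) (auto intro: less_le_trans)
  next
    fix c assume c: "cap p M E ?\<Omega> < c"
    obtain d where d: "cap p M E ?\<Omega> < d" "d < c" using dense[OF c] by blast
    obtain e where e: "0 < (e::real)" "d + ennreal e < c" by (rule ennreal_less_add[OF d(2)])
    \<comment> \<open>The value 0 is set apart because a number strictly below \<open>?f 0\<close>
      is sought; otherwise \<open>ennreal (y - e)\<close> will do, which is 0 if \<open>e\<close>
      exceeds \<open>y\<close>.\<close>
    obtain K where K: "?f 0 < F K 0 + ennreal e"
    proof (cases "?f 0 = 0")
      case True
      have "0 < ennreal e" using e(1) by simp
      also have "\<dots> \<le> F 0 0 + ennreal e" by (rule add_increasing) auto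
      finally show thesis using True by (intro that[of 0]) simp
    next
      case False
      then obtain y where y: "0 < y" "?f 0 = ennreal y"
        using fin by (cases "?f 0") (auto simp: ennreal_eq_0_iff le_less)
      have "ennreal (y - e) < ?f 0" using y e by (simp add: ennreal_lessI)
      then obtain K where "ennreal (y - e) < F K 0" unfolding fF by (auto simp: less_SUP_iff)
      then have "ennreal (y - e) + ennreal e < F K 0 + ennreal e"
        by (simp add: ennreal_add_left_cancel_less add.commute)
      moreover have "ennreal y \<le> ennreal (y - e) + ennreal e"
        using y e by (cases "e \<le> y") (auto simp flip: ennreal_plus intro: ennreal_leI add_increasing)
      ultimately show thesis using y(2) by (intro that[of K]) (auto intro: le_less_trans)
    qed
    have FK0: "F K 0 < top"
    proof -
      have "F K 0 \<le> ?f 0" unfolding fF by (rule SUP_upper) simp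
      then show ?thesis using fin by (auto intro: le_less_trans)
    qed
    have "cap_bounded p M (B K) ?\<Omega> < d"
      using d(1) unfolding LF by (rule le_less_trans[rotated]) (rule SUP_upper, simp)
    moreover have "bounded (B K)" unfolding B_def by (rule bounded_subset[OF bounded_ball]) auto
    ultimately obtain j where j: "cap_bounded p M (B K) (\<Omega>s j) < d"
      using cap_bounded_exhaustion[OF _ op inc] FK0 unfolding F_def infinity_ennreal_def by metis
    have "F k j \<le> d + ennreal e" for k
    proof -
      \<comment> \<open>The growth from \<open>B K\<close> to the larger piece inside
        \<open>\<Omega>s j\<close> is traded for the growth inside \<open>\<Omega>s 0\<close>, which
        the choice of \<open>K\<close> keeps below \<open>e\<close>. The finite term
        \<open>F K 0\<close> then cancels.\<close>
      have "F (max k K) j + F K 0 \<le> F K j + F (max k K) 0"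
        unfolding F_def by (rule cap_bounded_strong_subadditive[OF Bmono Omono op op]) auto
      also have "\<dots> \<le> d + ?f 0"
        by (intro add_mono) (use j in "auto simp: F_def[symmetric] fF intro: SUP_upper")
      also have "\<dots> \<le> d + (F K 0 + ennreal e)" using K by (intro add_left_mono) simp
      finally have "F K 0 + F (max k K) j \<le> F K 0 + (d + ennreal e)" by (simp add: ac_simps)
      then have "F (max k K) j \<le> d + ennreal e"
        using FK0 by (auto simp: ennreal_add_left_cancel_le)
      moreover have "F k j \<le> F (max k K) j" unfolding F_def by (rule cap_bounded_mono[OF Bmono]) simp
      ultimately show ?thesis by (rule order_trans[rotated])
    qed
    then have "?f j \<le> d + ennreal e" unfolding fF by (rule SUP_least)
    then have fj: "?f j < c" using e(2) by (rule le_less_trans)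
    show "eventually (\<lambda>j. ?f j < c) sequentially"
      using eventually_ge_at_top[of j] by eventually_elim (use fdec fj in "auto intro: le_less_trans")
  qed
qed

end

theorem proposition7p3:
  fixes p :: real and M :: "'a::metric_space measure"
    and \<Omega>s :: "nat \<Rightarrow> 'a set" and \<Omega> E :: "'a set"
  assumes "1 < p"
    and "metric_measure_space M"
    and "\<And>S :: 'a set. closed S \<Longrightarrow> bounded S \<Longrightarrow> compact S"
    and "connected (UNIV :: 'a set)"
    and "locally_doubling M"
    and "local_poincare p M"
    and "\<And>j. open (\<Omega>s j)"
    and "incseq \<Omega>s"
    and "\<Omega> = (\<Union>j. \<Omega>s j)"
    and "E \<subseteq> \<Omega>s 0"
    and "cap p M E (\<Omega>s 0) < \<infinity>"
  shows "(\<lambda>j. cap p M E (\<Omega>s j)) \<longlonglongrightarrow> cap p M E \<Omega>"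
proof -
  interpret proper_mm_space p M by standard (use assms in auto)
  show ?thesis unfolding assms(9) by (rule cap_exhaustion_tendsto) (use assms in auto)
qed

end
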